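(* Let $\mu_n$ ($n\ge1$) be probability measures, let $\omega_n$ be continual diagrams with $\mu_n=\mathfrak M\,\omega_n$, and let $\epsilon_n\to+0$. Let $(c_k)_{k\ge1}$ be a sequence with $\limsup_{k\to\infty}|c_k|^{1/k}=1$. Suppose that for every function $\phi$ analytic in a neighbourhood of $[-2,2]$ $$\lim_{n\to\infty}\frac1{\epsilon_n}\int_{-2}^2\phi(x)\,d(\mu_n-\rho_{\mathrm{s.c.}})(x)=\sum_{k\ge1}c_k\int_{-2}^2\phi(x)\,\frac{2T_k(x/2)}{\pi\sqrt{4-x^2}}\,dx .$$ Then for every function $\phi$ analytic in a neighbourhood of $[-2,2]$ $$\lim_{n\to\infty}\frac1{\epsilon_n}\int_{-2}^2\phi(x)\,(\omega_n(x)-\Omega_{\mathrm{LSVK}}(x))\,dx=-\frac{4c_1}{\pi}\int_{-2}^2\phi(x)\arcsin\frac x2\,dx+\sum_{k\ge2}\frac{4c_k}{k-1}\int_{-2}^2\phi(x)\,U_{k-2}(x/2)\,\frac{\sqrt{4-x^2}}{2\pi}\,dx .$$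
   Context: A continual diagram is a function $\omega:\mathbb R\to\mathbb R$ with $|\omega(x)-\omega(y)|\le|x-y|$ for all $x,y$, such that for some $a\in\mathbb R$ one has $\omega(x)=|x-a|$ for all sufficiently large $|x|$; it is supported in a segment $I$ if $\omega(x)=|x-a|$ for all $x\notin I$. For any segment $I$ the relation $$\exp\Big\{-\tfrac12\int\log(1-zx)\,d\omega'(x)\Big\}=\int\frac{d\mu(x)}{1-zx}$$ defines a bijection (indeed a homeomorphism, for the uniform and weak topologies) $\mu=\mathfrak{M}\omega$ between the continual diagrams $\omega$ supported in $I$ and the Borel probability measures $\mu$ on $I$; $\mathfrak M$ is called the Markov transform. The semicircle measure is $d\rho_{\mathrm{s.c.}}(x)=\frac1{2\pi}\sqrt{(4-x^2)_+}\,dx$. The Logan--Shepp--Vershik--Kerov diagram is $\Omega_{\mathrm{LSVK}}(x)=\frac2\pi\big(x\arcsin\frac x2+\sqrt{4-x^2}\big)$ for $|x|\le2$ and $\Omega_{\mathrm{LSVK}}(x)=|x|$ for $|x|>2$; one has $\mathfrak M\,\Omega_{\mathrm{LSVK}}=\rho_{\mathrm{s.c.}}$. The Chebyshev polynomials are defined by $T_k(\cos\theta)=\cos k\theta$ and $U_k(\cos\theta)=\sin((k+1)\theta)/\sin\theta$.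
   Formalization: All measures and diagrams are assumed supported in one fixed segment, which may exceed [-2,2]; without a uniform bound the claim fails, e.g. when mass ε_n² is moved to the point 1/ε_n, which shifts ω_n on [-2,2] by about ε_n. *)

theory Defs
  imports "HOL-Probability.Probability" "HOL-Complex_Analysis.Complex_Analysis"
begin

definition continual_diagram :: "(real \<Rightarrow> real) \<Rightarrow> bool" where
  "continual_diagram \<omega> \<longleftrightarrow>
     (\<forall>x y. \<bar>\<omega> x - \<omega> y\<bar> \<le> \<bar>x - y\<bar>) \<and>
     (\<exists>a. eventually (\<lambda>x. \<omega> x = \<bar>x - a\<bar>) at_infinity)"

definition diagram_center :: "(real \<Rightarrow> real) \<Rightarrow> real" where
  "diagram_center \<omega> = (THE a. eventually (\<lambda>x. \<omega> x = \<bar>x - a\<bar>) at_infinity)"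

definition diagram_supported_in :: "(real \<Rightarrow> real) \<Rightarrow> real set \<Rightarrow> bool" where
  "diagram_supported_in \<omega> I \<longleftrightarrow>
     continual_diagram \<omega> \<and> (\<forall>x. x \<notin> I \<longrightarrow> \<omega> x = \<bar>x - diagram_center \<omega>\<bar>)"

(* The integral of f with respect to d\<omega>'.  For a diagram \<omega> the derivative \<omega>' need not have
   bounded variation, so d\<omega>' is the second distributional derivative of \<omega>.  Write
   \<omega> = |x - a| + (\<omega> - |x - a|), a the centre: the first summand contributes twice the point
   mass at a, the second is compactly supported and both derivatives are moved to f.
   Only the values of f near the support of \<omega> matter.  The lemma
   integral_dderiv_test_function below confirms that for a compactly supported C^2 function f
   this is the pairing of f with the distribution \<omega>''. *)
definition integral_dderiv :: "(real \<Rightarrow> real) \<Rightarrow> (real \<Rightarrow> complex) \<Rightarrow> complex" where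
  "integral_dderiv \<omega> f =
     2 * f (diagram_center \<omega>) +
     (LINT x|lborel. (\<omega> x - \<bar>x - diagram_center \<omega>\<bar>) *\<^sub>R
        vector_derivative (\<lambda>t. vector_derivative f (at t)) (at x))"

(* \<mu> is the Markov transform of \<omega>, both living on the segment I.  The relation is required for
   all z such that 1 - z x avoids the cut of the principal logarithm for x in I; these z form
   a set that is star-shaped about 0, on which both sides are holomorphic. *)
definition is_markov_transform :: "real set \<Rightarrow> (real \<Rightarrow> real) \<Rightarrow> real measure \<Rightarrow> bool" where
  "is_markov_transform I \<omega> \<mu> \<longleftrightarrow>
     diagram_supported_in \<omega> I \<and>
     prob_space \<mu> \<and> sets \<mu> = sets borel \<and> emeasure \<mu> I = 1 \<and>
     (\<forall>z::complex. (\<forall>x\<in>I. 1 - z * of_real x \<notin> \<real>\<^sub>\<le>\<^sub>0) \<longrightarrow>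
        exp (- (1/2) * integral_dderiv \<omega> (\<lambda>x. Ln (1 - z * of_real x))) =
        (LINT x|\<mu>. 1 / (1 - z * of_real x)))"

definition semicircle :: "real measure" where
  "semicircle = density lborel (\<lambda>x. ennreal (1 / (2 * pi) * sqrt (max (4 - x\<^sup>2) 0)))"

definition LSVK :: "real \<Rightarrow> real" where
  "LSVK x = (if \<bar>x\<bar> \<le> 2 then 2 / pi * (x * arcsin (x / 2) + sqrt (4 - x\<^sup>2)) else \<bar>x\<bar>)"

definition cheb_T :: "nat \<Rightarrow> real poly" where
  "cheb_T k = (THE p. \<forall>\<theta>. poly p (cos \<theta>) = cos (real k * \<theta>))"

definition cheb_U :: "nat \<Rightarrow> real poly" where
  "cheb_U k = (THE p. \<forall>\<theta>. sin \<theta> \<noteq> 0 \<longrightarrow> poly p (cos \<theta>) = sin (real (k + 1) * \<theta>) / sin \<theta>)"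

lemma poly_eq_if_eq_on_cos:
  fixes p q :: "real poly"
  assumes "\<And>\<theta>. sin \<theta> \<noteq> 0 \<Longrightarrow> poly p (cos \<theta>) = poly q (cos \<theta>)"
  shows "p = q"
proof (rule ccontr)
  assume "p \<noteq> q"
  then have "finite {x. poly (p - q) x = 0}"
    by (intro poly_roots_finite) simp
  moreover have "{-1<..<1::real} \<subseteq> {x. poly (p - q) x = 0}"
  proof
    fix x :: real assume x: "x \<in> {-1<..<1}"
    then have "cos (arccos x) = x" "sin (arccos x) \<noteq> 0"
      by (auto simp: sin_arccos_nonzero)
    then show "x \<in> {x. poly (p - q) x = 0}"
      using assms[of "arccos x"] by simp
  qed
  ultimately have "finite {-1<..<1::real}"
    by (rule rev_finite_subset)
  then show False using infinite_Ioo[of "-1" "1::real"] by simp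
qed

lemma cheb_exist:
  "\<exists>p q :: real poly. (\<forall>\<theta>. poly p (cos \<theta>) = cos (real k * \<theta>)) \<and>
     (\<forall>\<theta>. sin \<theta> * poly q (cos \<theta>) = sin (real k * \<theta>))"
proof (induction k)
  case 0
  have "(\<forall>\<theta>::real. poly 1 (cos \<theta>) = cos (real 0 * \<theta>)) \<and>
     (\<forall>\<theta>::real. sin \<theta> * poly 0 (cos \<theta>) = sin (real 0 * \<theta>))"
    by simp
  then show ?case by blast
next
  case (Suc k)
  then obtain p q :: "real poly" where
    p: "\<And>\<theta>. poly p (cos \<theta>) = cos (real k * \<theta>)" and
    q: "\<And>\<theta>. sin \<theta> * poly q (cos \<theta>) = sin (real k * \<theta>)" by blast
  have k: "real (Suc k) * \<theta> = real k * \<theta> + \<theta>" for \<theta>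
    by (simp add: algebra_simps)
  have "poly ([:0, 1:] * p - [:1, 0, -1:] * q) (cos \<theta>) = cos (real (Suc k) * \<theta>)" for \<theta>
  proof -
    have "poly ([:0, 1:] * p - [:1, 0, -1:] * q) (cos \<theta>) =
        cos \<theta> * poly p (cos \<theta>) - (1 - (cos \<theta>)\<^sup>2) * poly q (cos \<theta>)"
      by (simp add: algebra_simps power2_eq_square)
    also have "1 - (cos \<theta>)\<^sup>2 = sin \<theta> * sin \<theta>"
      using sin_cos_squared_add[of \<theta>] by (simp add: power2_eq_square algebra_simps)
    also have "cos \<theta> * poly p (cos \<theta>) - sin \<theta> * sin \<theta> * poly q (cos \<theta>) = cos (real (Suc k) * \<theta>)"
      unfolding k cos_add p[symmetric] q[symmetric] by (simp add: algebra_simps)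
    finally show ?thesis .
  qed
  moreover have "sin \<theta> * poly (p + [:0, 1:] * q) (cos \<theta>) = sin (real (Suc k) * \<theta>)" for \<theta>
    unfolding k sin_add p[symmetric] q[symmetric] by (simp add: algebra_simps)
  ultimately show ?case by blast
qed

lemma poly_cheb_T_cos: "poly (cheb_T k) (cos \<theta>) = cos (real k * \<theta>)"
proof -
  obtain p :: "real poly" where p: "\<And>\<theta>. poly p (cos \<theta>) = cos (real k * \<theta>)"
    using cheb_exist[of k] by blast
  have "cheb_T k = p"
    unfolding cheb_T_def by (rule the_equality) (auto simp: p intro: poly_eq_if_eq_on_cos)
  then show ?thesis by (simp add: p)
qed

lemma poly_cheb_U_cos:
  assumes "sin \<theta> \<noteq> 0"
  shows "poly (cheb_U k) (cos \<theta>) = sin (real (k + 1) * \<theta>) / sin \<theta>"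
proof -
  obtain p :: "real poly" where "\<And>\<theta>. sin \<theta> * poly p (cos \<theta>) = sin (real (k + 1) * \<theta>)"
    using cheb_exist[of "k + 1"] by blast
  then have p: "poly p (cos \<theta>) = sin (real (k + 1) * \<theta>) / sin \<theta>" if "sin \<theta> \<noteq> 0" for \<theta>
    using that by (simp add: eq_divide_eq mult.commute)
  have "cheb_U k = p"
    unfolding cheb_U_def
  proof (rule the_equality)
    show "\<forall>\<theta>. sin \<theta> \<noteq> 0 \<longrightarrow> poly p (cos \<theta>) = sin (real (k + 1) * \<theta>) / sin \<theta>"
      using p by blast
    fix r :: "real poly"
    assume "\<forall>\<theta>. sin \<theta> \<noteq> 0 \<longrightarrow> poly r (cos \<theta>) = sin (real (k + 1) * \<theta>) / sin \<theta>"
    then show "r = p"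
      using p by (intro poly_eq_if_eq_on_cos) metis
  qed
  then show ?thesis using p assms by simp
qed

lemma integral_dderiv_test_function:
  fixes f f' f'' :: "real \<Rightarrow> complex"
  assumes \<omega>: "continual_diagram \<omega>"
    and f': "\<And>x. (f has_vector_derivative f' x) (at x)"
    and f'': "\<And>x. (f' has_vector_derivative f'' x) (at x)"
    and cont: "continuous_on UNIV f''"
    and supp: "\<And>x. \<bar>x\<bar> > R \<Longrightarrow> f x = 0"
  shows "integral_dderiv \<omega> f = (LINT x|lborel. \<omega> x *\<^sub>R f'' x)"
proof -
  define a where "a = diagram_center \<omega>"
  define S where "S = \<bar>R\<bar> + \<bar>a\<bar> + 1"
  have "\<bar>\<omega> x - \<omega> y\<bar> \<le> \<bar>x - y\<bar>" for x y
    using \<omega> by (auto simp: continual_diagram_def)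
  then have cont_\<omega>: "continuous_on UNIV \<omega>"
    by (intro lipschitz_on_continuous_on[of 1] lipschitz_onI) (auto simp: dist_real_def)
  have op: "open {x::real. \<bar>x\<bar> > R}"
    by (intro open_Collect_less continuous_intros)
  have f'0: "f' x = 0" if "\<bar>x\<bar> > R" for x
  proof -
    have "((\<lambda>_. 0) has_vector_derivative f' x) (at x)"
      by (rule has_vector_derivative_transform_within_open[OF f' op]) (use that supp in auto)
    then show ?thesis
      using vector_derivative_at has_vector_derivative_const by metis
  qed
  have f''0: "f'' x = 0" if "\<bar>x\<bar> > R" for x
  proof -
    have "((\<lambda>_. 0) has_vector_derivative f'' x) (at x)"
      by (rule has_vector_derivative_transform_within_open[OF f'' op]) (use that f'0 in auto)
    then show ?thesis
      using vector_derivative_at has_vector_derivative_const by metis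
  qed
  have ind: "(\<lambda>x. indicator {-S..S} x *\<^sub>R (h x *\<^sub>R f'' x)) = (\<lambda>x. h x *\<^sub>R f'' x)" for h :: "real \<Rightarrow> real"
  proof
    fix x show "indicator {-S..S} x *\<^sub>R (h x *\<^sub>R f'' x) = h x *\<^sub>R f'' x"
    proof (cases "\<bar>x\<bar> > R")
      case True then show ?thesis by (simp add: f''0)
    next
      case False then have "x \<in> {-S..S}" unfolding S_def by auto
      then show ?thesis by simp
    qed
  qed
  have int: "integrable lborel (\<lambda>x. h x *\<^sub>R f'' x)" if "continuous_on UNIV h" for h :: "real \<Rightarrow> real"
  proof -
    have "integrable lborel (\<lambda>x. indicator {-S..S} x *\<^sub>R (h x *\<^sub>R f'' x))"
      by (intro borel_integrable_compact continuous_on_scaleR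
          continuous_on_subset[OF that] continuous_on_subset[OF cont]) auto
    then show ?thesis unfolding ind .
  qed
  have cont_abs: "continuous_on UNIV (\<lambda>x. \<bar>x - a\<bar>)"
    by (intro continuous_intros)
  have bnd: "-S \<le> a" "a \<le> S" "\<bar>S\<bar> > R" "\<bar>-S\<bar> > R"
    by (auto simp: S_def)
  have der: "((\<lambda>x. (x - a) *\<^sub>R f' x - f x) has_vector_derivative (x - a) *\<^sub>R f'' x) (at x within A)" for x A
  proof -
    have "((\<lambda>x. (x - a) *\<^sub>R f' x - f x) has_vector_derivative
        ((x - a) *\<^sub>R f'' x + 1 *\<^sub>R f' x) - f' x) (at x within A)"
      by (intro has_vector_derivative_diff has_vector_derivative_scaleR
          has_vector_derivative_at_within[OF f'] has_vector_derivative_at_within[OF f'']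
          derivative_eq_intros) auto
    then show ?thesis by simp
  qed
  have "(( \<lambda>x. (x - a) *\<^sub>R f'' x) has_integral
      ((S - a) *\<^sub>R f' S - f S) - ((a - a) *\<^sub>R f' a - f a)) {a..S}"
    by (intro fundamental_theorem_of_calculus der) (use bnd in auto)
  then have "((\<lambda>x. (x - a) *\<^sub>R f'' x) has_integral f a) {a..S}"
    using bnd supp f'0 by simp
  then have right: "((\<lambda>x. \<bar>x - a\<bar> *\<^sub>R f'' x) has_integral f a) {a..S}"
    by (rule has_integral_eq[rotated]) auto
  have "(( \<lambda>x. (x - a) *\<^sub>R f'' x) has_integral
      ((a - a) *\<^sub>R f' a - f a) - ((-S - a) *\<^sub>R f' (-S) - f (-S))) {-S..a}"
    by (intro fundamental_theorem_of_calculus der) (use bnd in auto)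
  then have "((\<lambda>x. (x - a) *\<^sub>R f'' x) has_integral - f a) {-S..a}"
    using bnd supp[of "-S"] f'0[of "-S"] by simp
  then have "((\<lambda>x. - ((x - a) *\<^sub>R f'' x)) has_integral f a) {-S..a}"
    by (drule_tac has_integral_neg) simp
  then have left: "((\<lambda>x. \<bar>x - a\<bar> *\<^sub>R f'' x) has_integral f a) {-S..a}"
    by (rule has_integral_eq[rotated]) (auto simp: scaleR_minus_left[symmetric] simp del: scaleR_minus_left)
  have "((\<lambda>x. \<bar>x - a\<bar> *\<^sub>R f'' x) has_integral f a + f a) {-S..S}"
    by (rule has_integral_combine[OF bnd(1,2) left right])
  then have "((\<lambda>x. \<bar>x - a\<bar> *\<^sub>R f'' x) has_integral f a + f a) UNIV"
    by (rule has_integral_on_superset) (use f''0 in \<open>auto simp: S_def not_le\<close>)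
  moreover have "((\<lambda>x. \<bar>x - a\<bar> *\<^sub>R f'' x) has_integral (LINT x|lborel. \<bar>x - a\<bar> *\<^sub>R f'' x)) UNIV"
    by (rule has_integral_integral_lborel[OF int[OF cont_abs]])
  ultimately have abs: "(LINT x|lborel. \<bar>x - a\<bar> *\<^sub>R f'' x) = 2 * f a"
    using has_integral_unique[of _ "f a + f a" UNIV] by (metis mult_2)
  have "(\<lambda>t. vector_derivative f (at t)) = f'"
    using vector_derivative_at[OF f'] by (rule ext)
  then have vd: "vector_derivative (\<lambda>t. vector_derivative f (at t)) (at x) = f'' x" for x
    using vector_derivative_at[OF f''] by simp
  have "(LINT x|lborel. (\<omega> x - \<bar>x - a\<bar>) *\<^sub>R f'' x) =
      (LINT x|lborel. \<omega> x *\<^sub>R f'' x) - (LINT x|lborel. \<bar>x - a\<bar> *\<^sub>R f'' x)"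
    unfolding scaleR_diff_left by (rule Bochner_Integration.integral_diff[OF int[OF cont_\<omega>] int[OF cont_abs]])
  then show ?thesis
    by (simp add: integral_dderiv_def vd abs flip: a_def)
qed

end

(* Write a diagram as |x - a| plus a nonnegative compactly supported excess, and put w = z + 1/z.
   Then 1/(w - x) = z * (sum over k of U_k(x/2) z^k), so the second derivative of the Markov relation says that
   exp(z^2/2 * (integral of the excess against (1 - z x + z^2)^(-2))) equals (w - a) times the
   Stieltjes transform of mu, up to what lies outside [-2,2].  The LSVK diagram and the semicircle law
   satisfy exp(...) = 1 + z^2 and Stieltjes transform z.  Dividing and taking logarithms linearises
   the relation: the coefficients of the diagram fluctuation are the differences of consecutive
   coefficients of the measure fluctuation, corrected by the fluctuation of the centre a.

   Two points need care.  The measures may charge the complement of [-2,2], where nothing is assumed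
   beyond total mass o(epsilon); the mass m outside controls the excess outside linearly in m by a
   contour argument on circles through the end of the segment, and the resulting error, singular
   near the real axis like 1/(Im z)^2, is controlled inside the disc by the maximum principle applied
   after multiplication by (z^2 - r^2)^2.  Uniformity in z of the convergence is the
   Banach-Steinhaus principle, used in its gliding hump form. *)
theory Submission
  imports Defs "HOL-Real_Asymp.Real_Asymp"
begin

section \<open>Chebyshev polynomials and their generating function\<close>

text \<open>Three points decide the form of the argument. The squared kernel expands with a factor 1
  / (1 - z^2). Clearing it turns coefficients into differences with step two, and U_(k+2) - U_k = 2
  T_(k+2) lets the hypothesis, which is diagonal in the T_k, be read off coefficient by coefficient.
  An exponential close to 1 fixes its logarithm only modulo 2 pi i, and the estimates degenerate at
  the real axis. Each such logarithm is therefore followed along a path that starts where it is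
  real. The arcsine term has two sources. The coefficient limits contain -2 c_1 times the integral
  against the slope (2/pi) arcsin(x/2) - sgn x of the LSVK excess; replacing |x| by |x - a| adds -2
  c_1 times the integral against sgn x. The sign functions cancel. Summation over k is a dominated
  limit: the Chebyshev coefficients of a test function decay like q^k with some q < 1 depending on
  the function, so coefficient bounds D / s^k, uniform in n, are needed for every s < 1.\<close>

lemma cheb_U_0: "cheb_U 0 = 1"
  by (rule poly_eq_if_eq_on_cos) (simp add: poly_cheb_U_cos)

lemma cheb_U_1: "cheb_U (Suc 0) = [:0, 2:]"
proof (rule poly_eq_if_eq_on_cos)
  fix \<theta> :: real assume s: "sin \<theta> \<noteq> 0"
  have "sin (2 * \<theta>) / sin \<theta> = 2 * cos \<theta>"
    using s by (simp add: sin_double)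
  then show "poly (cheb_U (Suc 0)) (cos \<theta>) = poly [:0, 2:] (cos \<theta>)"
    using poly_cheb_U_cos[OF s, of 1] by simp
qed

lemma cheb_U_Suc_Suc: "cheb_U (Suc (Suc k)) = [:0, 2:] * cheb_U (Suc k) - cheb_U k"
proof (rule poly_eq_if_eq_on_cos)
  fix \<theta> :: real assume s: "sin \<theta> \<noteq> 0"
  have "sin (real (k + 3) * \<theta>) + sin (real (k + 1) * \<theta>) = 2 * cos \<theta> * sin (real (k + 2) * \<theta>)"
    using sin_add[of "real (k + 2) * \<theta>" \<theta>] sin_diff[of "real (k + 2) * \<theta>" \<theta>]
    by (simp add: algebra_simps)
  then have "sin (real (k + 3) * \<theta>) / sin \<theta> =
      2 * cos \<theta> * (sin (real (k + 2) * \<theta>) / sin \<theta>) - sin (real (k + 1) * \<theta>) / sin \<theta>"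
    using s by (simp add: field_simps)
  then show "poly (cheb_U (Suc (Suc k))) (cos \<theta>) = poly ([:0, 2:] * cheb_U (Suc k) - cheb_U k) (cos \<theta>)"
    using poly_cheb_U_cos[OF s, of "k+2"] poly_cheb_U_cos[OF s, of "k+1"] poly_cheb_U_cos[OF s, of k]
    by (simp add: numeral_eq_Suc mult_ac)
qed

text \<open>sin((k+3)t) - sin((k+1)t) = 2 sin t cos((k+2)t), divided by sin t. This converts the
  difference of two U-coefficients produced by the Markov relation into the single T-coefficient
  controlled by the hypothesis.\<close>

lemma two_cheb_T_eq: "2 * poly (cheb_T (k + 2)) y = poly (cheb_U (k + 2)) y - poly (cheb_U k) y"
proof -
  have "smult 2 (cheb_T (k + 2)) = cheb_U (k + 2) - cheb_U k"
  proof (rule poly_eq_if_eq_on_cos)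
    fix \<theta> :: real assume s: "sin \<theta> \<noteq> 0"
    have "sin (real (k + 3) * \<theta>) - sin (real (k + 1) * \<theta>) = 2 * sin \<theta> * cos (real (k + 2) * \<theta>)"
      using sin_add[of "real (k + 2) * \<theta>" \<theta>] sin_diff[of "real (k + 2) * \<theta>" \<theta>]
      by (simp add: algebra_simps)
    then have "sin (real (k + 3) * \<theta>) / sin \<theta> - sin (real (k + 1) * \<theta>) / sin \<theta> =
        2 * cos (real (k + 2) * \<theta>)"
      using s by (simp add: field_simps)
    then show "poly (smult 2 (cheb_T (k + 2))) (cos \<theta>) = poly (cheb_U (k + 2) - cheb_U k) (cos \<theta>)"
      using poly_cheb_U_cos[OF s, of "k+2"] poly_cheb_U_cos[OF s, of k] poly_cheb_T_cos[of "k+2" \<theta>]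
      by (simp add: numeral_eq_Suc)
  qed
  then have "poly (smult 2 (cheb_T (k + 2))) y = poly (cheb_U (k + 2) - cheb_U k) y" by simp
  then show ?thesis by simp
qed

lemma cheb_T_1: "cheb_T (Suc 0) = [:0, 1:]"
  by (rule poly_eq_if_eq_on_cos) (simp add: poly_cheb_T_cos)

lemma abs_sin_mult_le: "\<bar>sin (real m * \<theta>)\<bar> \<le> real m * \<bar>sin \<theta>\<bar>"
proof (induction m)
  case 0 then show ?case by simp
next
  case (Suc m)
  have "\<bar>sin (real (Suc m) * \<theta>)\<bar> = \<bar>sin (real m * \<theta>) * cos \<theta> + cos (real m * \<theta>) * sin \<theta>\<bar>"
    by (simp add: distrib_right sin_add algebra_simps)
  also have "\<dots> \<le> \<bar>sin (real m * \<theta>)\<bar> * \<bar>cos \<theta>\<bar> + \<bar>cos (real m * \<theta>)\<bar> * \<bar>sin \<theta>\<bar>"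
    by (metis abs_mult abs_triangle_ineq)
  also have "\<dots> \<le> \<bar>sin (real m * \<theta>)\<bar> * 1 + 1 * \<bar>sin \<theta>\<bar>"
    by (intro add_mono mult_mono) auto
  finally show ?case using Suc by (simp add: algebra_simps)
qed

lemma abs_cheb_U_le:
  assumes "\<bar>y\<bar> \<le> 1" shows "\<bar>poly (cheb_U k) y\<bar> \<le> real k + 1"
proof -
  have *: "\<bar>poly (cheb_U k) y\<bar> \<le> real k + 1" if "y \<in> {-1<..<1}" for y
  proof -
    define \<theta> where "\<theta> = arccos y"
    have y: "cos \<theta> = y" "sin \<theta> \<noteq> 0"
      using that by (auto simp: \<theta>_def sin_arccos_nonzero)
    show ?thesis
      using poly_cheb_U_cos[OF y(2), of k] y abs_sin_mult_le[of "k+1" \<theta>]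
      by (simp add: divide_le_eq add.commute)
  qed
  \<comment> \<open>At y = 1 and y = -1 the quotient of sines is 0 / 0, so the bound reaches the end
    points by continuity.\<close>
  have "y \<in> closure {-1<..<1::real}" using assms by (simp add: abs_le_iff)
  then show ?thesis
    by (rule continuous_le_on_closure[rotated]) (auto intro!: continuous_intros *)
qed

text \<open>\<open>1 - z x + z\<^sup>2\<close> is \<open>z\<close> times the distance from \<open>x\<close> of the Joukowski image \<open>z + 1/z\<close>.\<close>
definition cheb_denom :: "complex \<Rightarrow> real \<Rightarrow> complex" where
  "cheb_denom z x = 1 - z * of_real x + z\<^sup>2"

definition U_half :: "nat \<Rightarrow> real \<Rightarrow> real" where
  "U_half k x = poly (cheb_U k) (x / 2)"

lemma U_half_0 [simp]: "U_half 0 x = 1" and U_half_1: "U_half (Suc 0) x = x"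
  and U_half_Suc_Suc: "U_half (Suc (Suc k)) x = x * U_half (Suc k) x - U_half k x"
  by (simp_all add: U_half_def cheb_U_0 cheb_U_1 cheb_U_Suc_Suc)

lemma abs_U_half_le: "\<bar>x\<bar> \<le> 2 \<Longrightarrow> \<bar>U_half k x\<bar> \<le> real k + 1"
  unfolding U_half_def by (rule abs_cheb_U_le) simp

lemma U_half_cos: "sin \<theta> \<noteq> 0 \<Longrightarrow> U_half k (2 * cos \<theta>) = sin (real (k + 1) * \<theta>) / sin \<theta>"
  unfolding U_half_def using poly_cheb_U_cos[of \<theta> k] by simp

lemma continuous_on_U_half [continuous_intros]: "continuous_on S (U_half k)"
  unfolding U_half_def by (intro continuous_intros) auto

lemma borel_measurable_U_half [measurable]: "U_half k \<in> borel_measurable borel"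
  by (intro borel_measurable_continuous_onI continuous_on_U_half)

text \<open>With x = 2 cos t the denominator factors as (1 - z e^(it)) (1 - z e^(-it)), and each
  factor has modulus at least 1 - |z|.\<close>

lemma cheb_denom_lower:
  assumes "\<bar>x\<bar> \<le> 2" "norm z \<le> 1"
  shows "(1 - norm z)\<^sup>2 \<le> norm (cheb_denom z x)"
proof -
  define \<theta> where "\<theta> = arccos (x / 2)"
  have x: "x = 2 * cos \<theta>" using assms by (simp add: \<theta>_def)
  have "cheb_denom z x = (1 - z * cis \<theta>) * (1 - z * cis (-\<theta>))"
    unfolding cheb_denom_def x by (simp add: algebra_simps power2_eq_square cis_mult)
      (simp add: complex_eq_iff algebra_simps)
  moreover have "1 - norm z \<le> norm (1 - z * cis t)" for t
    using norm_triangle_ineq2[of 1 "z * cis t"] by (simp add: norm_mult)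
  ultimately show ?thesis
    using assms(2) by (auto simp: norm_mult power2_eq_square intro!: mult_mono)
qed

lemma cheb_denom_nonzero: "\<bar>x\<bar> \<le> 2 \<Longrightarrow> norm z < 1 \<Longrightarrow> cheb_denom z x \<noteq> 0"
  using cheb_denom_lower[of x z] by auto

lemma summable_linear_power:
  fixes x :: real assumes "\<bar>x\<bar> < 1" shows "summable (\<lambda>k. (real k + 1) * x ^ k)"
proof -
  have "summable (\<lambda>k. diffs (\<lambda>_. 1) k * x ^ k)"
    by (rule termdiff_converges[of x 1]) (use assms in \<open>auto intro: summable_geometric\<close>)
  moreover have "diffs (\<lambda>_. 1::real) k = real k + 1" for k
    by (simp add: diffs_def)
  ultimately show ?thesis by simp
qed

lemma summable_square_power:
  fixes x :: real assumes "0 \<le> x" "x < 1" shows "summable (\<lambda>k. (real k + 1) * (real k + 1) * x ^ k)"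
proof -
  have "summable (\<lambda>k. diffs (\<lambda>k. real k + 1) k * x ^ k)"
    by (rule termdiff_converges[of x 1]) (use assms in \<open>auto intro: summable_linear_power\<close>)
  then show ?thesis
    by (rule summable_comparison_test'[of _ 0])
      (use assms in \<open>auto simp: diffs_def intro!: mult_right_mono mult_mono\<close>)
qed

text \<open>\<open>abs_U_half_le\<close> gives convergence. Summing the three-term recurrence
  against powers of z yields S - 1 - z x = z x (S - 1) - z^2 S for the sum S, a linear equation
  solved by the reciprocal of the denominator.\<close>

lemma cheb_U_generating:
  assumes "\<bar>x\<bar> \<le> 2" "norm z < 1"
  shows "(\<lambda>k. z ^ k * of_real (U_half k x)) sums (1 / cheb_denom z x)"
proof -
  let ?f = "\<lambda>k. z ^ k * complex_of_real (U_half k x)"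
  have s: "summable ?f"
    by (rule summable_comparison_test'[OF summable_linear_power[of "norm z"], of 0])
      (auto simp: norm_mult norm_power mult.commute assms intro!: mult_right_mono abs_U_half_le)
  define S where "S = suminf ?f"
  have S: "?f sums S" using s by (simp add: S_def summable_sums)
  have 1: "(\<lambda>k. ?f (Suc k)) sums (S - 1)"
    using S sums_Suc_iff[of ?f "S - 1"] by simp
  have 2: "(\<lambda>k. ?f (Suc (Suc k))) sums (S - 1 - z * of_real x)"
    using 1 sums_Suc_iff[of "\<lambda>k. ?f (Suc k)" "S - 1 - z * of_real x"] by (simp add: U_half_1)
  have "(\<lambda>k. z * of_real x * ?f (Suc k) - z\<^sup>2 * ?f k) sums (z * of_real x * (S - 1) - z\<^sup>2 * S)"
    by (intro sums_diff sums_mult 1 S)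
  moreover have "(\<lambda>k. z * of_real x * ?f (Suc k) - z\<^sup>2 * ?f k) = (\<lambda>k. ?f (Suc (Suc k)))"
    by (rule ext) (simp add: U_half_Suc_Suc algebra_simps power2_eq_square)
  ultimately have "(\<lambda>k. ?f (Suc (Suc k))) sums (z * of_real x * (S - 1) - z\<^sup>2 * S)"
    by (simp only:)
  from sums_unique2[OF 2 this] have "S - 1 - z * of_real x = z * of_real x * (S - 1) - z\<^sup>2 * S" .
  then have "S * cheb_denom z x = 1"
    by (simp add: cheb_denom_def algebra_simps)
  then show ?thesis
    using S cheb_denom_nonzero[OF assms] by (metis nonzero_eq_divide_eq)
qed

text \<open>Derivative in z of z / (1 - z x + z^2): the quotient rule leaves the numerator (1 - z x
  + z^2) - z (2 z - x) = 1 - z^2. This factor is the origin of the differences with step two later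
  on.\<close>

lemma cheb_U_generating_deriv:
  assumes "\<bar>x\<bar> \<le> 2" "norm z < 1"
  shows "(\<lambda>k. z ^ k * of_real ((real k + 1) * U_half k x)) sums ((1 - z\<^sup>2) / (cheb_denom z x)\<^sup>2)"
proof -
  let ?c = "\<lambda>k. if k = 0 then 0 else complex_of_real (U_half (k - 1) x)"
  have sums: "(\<lambda>k. ?c k * w ^ k) sums (w / cheb_denom w x)" if "norm w < 1" for w
  proof -
    have "(\<lambda>k. w * (w ^ k * of_real (U_half k x))) sums (w * (1 / cheb_denom w x))"
      by (intro sums_mult cheb_U_generating assms that)
    then have "(\<lambda>k. ?c (Suc k) * w ^ Suc k) sums (w / cheb_denom w x)"
      by (simp add: mult_ac)
    then show ?thesis by (subst (asm) sums_Suc_iff) simp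
  qed
  obtain r where r: "norm z < r" "r < 1" using assms(2) dense by blast
  have D: "DERIV (\<lambda>w. \<Sum>n. ?c n * w ^ n) z :> (\<Sum>n. diffs ?c n * z ^ n)"
    by (rule termdiffs_strong'[of 1]) (use sums assms in \<open>auto simp: sums_iff\<close>)
  have ev: "eventually (\<lambda>w. (\<Sum>n. ?c n * w ^ n) = w / cheb_denom w x) (nhds z)"
    using eventually_nhds_in_open[of "ball 0 1" z] assms
    by (auto elim!: eventually_mono simp: sums sums_iff[THEN iffD1, OF sums])
  have d1: "DERIV (\<lambda>w. w / cheb_denom w x) z :> (\<Sum>n. diffs ?c n * z ^ n)"
    by (rule iffD1[OF DERIV_cong_ev[OF refl ev refl] D])
  have nz: "cheb_denom z x \<noteq> 0" by (rule cheb_denom_nonzero[OF assms])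
  have "DERIV (\<lambda>w. w / cheb_denom w x) z :> (1 - z\<^sup>2) / (cheb_denom z x)\<^sup>2"
    using nz unfolding cheb_denom_def
    by (auto intro!: derivative_eq_intros simp: field_simps power2_eq_square)
  with d1 have eq: "(\<Sum>n. diffs ?c n * z ^ n) = (1 - z\<^sup>2) / (cheb_denom z x)\<^sup>2"
    by (rule DERIV_unique)
  have "summable (\<lambda>n. diffs ?c n * z ^ n)"
    by (rule termdiff_converges[of z 1]) (use sums assms in \<open>auto simp: sums_iff\<close>)
  with eq have "(\<lambda>n. diffs ?c n * z ^ n) sums ((1 - z\<^sup>2) / (cheb_denom z x)\<^sup>2)"
    by (simp add: sums_iff)
  moreover have "(\<lambda>n. diffs ?c n * z ^ n) = (\<lambda>k. z ^ k * of_real ((real k + 1) * U_half k x))"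
    by (rule ext) (simp add: diffs_def mult_ac add.commute)
  ultimately show ?thesis by simp
qed

section \<open>Estimates for holomorphic functions\<close>

text \<open>Cauchy's inequality for the derivatives at 0. It turns a bound on one circle, uniform in
  n, into geometric coefficient bounds uniform in n.\<close>

lemma power_series_coeff_bound:
  fixes a :: "nat \<Rightarrow> complex"
  assumes sums: "\<And>z. norm z < r \<Longrightarrow> (\<lambda>k. a k * z ^ k) sums f z"
    and "0 < s" "s < r" and bound: "\<And>z. norm z = s \<Longrightarrow> norm (f z) \<le> B"
  shows "norm (a k) \<le> B / s ^ k"
proof -
  have "f has_fps_expansion Abs_fps a"
    by (rule has_fps_expansionI, rule eventually_mono[OF eventually_nhds_in_open[of "ball 0 r"]])
      (use sums assms(2,3) in auto)
  then have a: "a k = (deriv ^^ k) f 0 / fact k"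
    using fps_nth_fps_expansion[of f "Abs_fps a" k] by simp
  have hol: "f holomorphic_on ball 0 r"
    by (rule power_series_holomorphic[of 0 r a]) (use sums in auto)
  have "norm ((deriv ^^ k) f 0) \<le> fact k * B / s ^ k"
    by (rule Cauchy_inequality)
      (use assms in \<open>auto intro!: holomorphic_on_imp_continuous_on holomorphic_on_subset[OF hol]\<close>)
  then show ?thesis
    unfolding a by (simp add: norm_divide field_simps)
qed

text \<open>As long as exp(f) stays within 1/2 of 1, cos(Im f) is positive, so Im f cannot cross
  pi/2 or -pi/2 on the way from the real value f 0. Hence f 1 is the principal logarithm of exp(f
  1). Nearness is required only for s > 0, since in one application the quantitative estimate makes
  no sense at the starting point.\<close>

lemma norm_le_of_exp_near_1:
  fixes f :: "real \<Rightarrow> complex"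
  assumes cont: "continuous_on {0..1} f" and real: "Im (f 0) = 0"
    and near: "\<And>s. 0 < s \<Longrightarrow> s \<le> 1 \<Longrightarrow> norm (exp (f s) - 1) \<le> d" and d: "d < 1 / 2"
  shows "norm (f 1) \<le> 2 * d"
proof -
  have pos: "cos (Im (f s)) > 0" if "0 < s" "s \<le> 1" for s
  proof -
    have "\<bar>Re (exp (f s) - 1)\<bar> < 1 / 2"
      using abs_Re_le_cmod[of "exp (f s) - 1"] near[OF that] d by linarith
    then have "Re (exp (f s)) > 0" unfolding minus_complex.simps one_complex.simps by linarith
    then show ?thesis unfolding Re_exp by (simp add: zero_less_mult_iff)
  qed
  have small: "\<bar>Im (f 1)\<bar> < pi / 2"
  proof (rule ccontr)
    assume "\<not> ?thesis"
    then have "\<exists>s\<ge>0. s \<le> 1 \<and> \<bar>Im (f s)\<bar> = pi / 2"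
      by (intro IVT' continuous_intros cont) (use real in auto)
    then obtain s where s: "0 \<le> s" "s \<le> 1" "\<bar>Im (f s)\<bar> = pi / 2" by blast
    then have "0 < s" using real by (cases "s = 0") auto
    moreover have "cos (Im (f s)) = cos \<bar>Im (f s)\<bar>" by simp
    ultimately show False using pos[of s] s by simp
  qed
  define u where "u = exp (f 1) - 1"
  have u: "norm u \<le> d" unfolding u_def using near[of 1] by simp
  have "f 1 = Ln (1 + u)"
    unfolding u_def using Ln_exp[of "f 1"] small pi_gt_zero by simp
  then show ?thesis using norm_Ln_le[of u] u d by simp
qed

text \<open>On the circle r^2 = z * cnj z, so z^2 - r^2 = z (z - cnj z) has modulus 2 r |Im z|; its
  square cancels exactly a singularity 1 / (Im z)^2. Inside, the same factor is at least r^2 - s^2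
  in modulus, so it can be divided out again.\<close>

lemma norm_le_off_real_boundary:
  fixes f :: "complex \<Rightarrow> complex"
  assumes hol: "f holomorphic_on ball 0 R" and r: "0 < r" "r < R"
    and bound: "\<And>z. norm z = r \<Longrightarrow> norm (f z) * (Im z)\<^sup>2 \<le> B"
    and s: "norm z \<le> s" "s < r"
  shows "norm (f z) \<le> 4 * r\<^sup>2 * B / (r\<^sup>2 - s\<^sup>2)\<^sup>2"
proof -
  let ?g = "\<lambda>z. (z\<^sup>2 - of_real (r\<^sup>2))\<^sup>2 * f z"
  have "norm (?g z) \<le> 4 * r\<^sup>2 * B"
  proof (rule maximum_modulus_frontier[of ?g "cball 0 r"])
    show "?g holomorphic_on interior (cball 0 r)"
      by (intro holomorphic_intros holomorphic_on_subset[OF hol]) (use r in auto)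
    show "continuous_on (closure (cball 0 r)) ?g"
      by (intro continuous_intros holomorphic_on_imp_continuous_on holomorphic_on_subset[OF hol]) (use r in auto)
    show "z \<in> cball 0 r" using s by simp
    fix w assume "w \<in> frontier (cball (0::complex) r)"
    then have w: "norm w = r" using r by (simp add: frontier_cball)
    have "w\<^sup>2 - of_real (r\<^sup>2) = w * (w - cnj w)"
      using complex_norm_square[of w] w by (simp add: algebra_simps power2_eq_square)
    moreover have "norm (w - cnj w) = 2 * \<bar>Im w\<bar>"
      by (simp add: complex_diff_cnj norm_mult)
    ultimately have "norm ((w\<^sup>2 - of_real (r\<^sup>2))\<^sup>2) = 4 * r\<^sup>2 * (Im w)\<^sup>2"
      using w by (simp add: norm_power norm_mult power_mult_distrib)
    then have "norm (?g w) = 4 * r\<^sup>2 * (norm (f w) * (Im w)\<^sup>2)"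
      by (simp add: norm_mult)
    also have "\<dots> \<le> 4 * r\<^sup>2 * B"
      by (intro mult_left_mono bound w) auto
    finally show "norm (?g w) \<le> 4 * r\<^sup>2 * B" .
  qed auto
  then have g: "norm (z\<^sup>2 - of_real (r\<^sup>2)) ^ 2 * norm (f z) \<le> 4 * r\<^sup>2 * B"
    by (simp add: norm_mult norm_power)
  have s0: "0 \<le> s" using s norm_ge_zero order_trans by blast
  have "r\<^sup>2 - s\<^sup>2 \<le> r\<^sup>2 - norm z ^ 2" using s by (simp add: power_mono)
  also have "\<dots> \<le> norm (z\<^sup>2 - of_real (r\<^sup>2))"
    using norm_triangle_ineq2[of "of_real (r\<^sup>2)" "z\<^sup>2"] by (simp add: norm_power norm_minus_commute)
  finally have 1: "r\<^sup>2 - s\<^sup>2 \<le> norm (z\<^sup>2 - of_real (r\<^sup>2))" .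
  have 2: "0 < r\<^sup>2 - s\<^sup>2" using s s0 by (simp add: power_strict_mono)
  have "(r\<^sup>2 - s\<^sup>2)\<^sup>2 * norm (f z) \<le> 4 * r\<^sup>2 * B"
    by (rule order_trans[OF mult_right_mono[OF power_mono[OF 1]] g]) (use 2 in auto)
  then show ?thesis using 2 by (simp add: field_simps)
qed

text \<open>\<open>hump_sum d n m\<close> is the m-th functional applied to a partial sum of the
  first n weighted vectors, \<open>d m i\<close> being functional m on vector i. Whether vector i is
  added is decided by functional i alone: it is skipped exactly when the sum so far is already at
  least half as large as the new weighted diagonal entry.\<close>

primrec hump_sum :: "(nat \<Rightarrow> nat \<Rightarrow> complex) \<Rightarrow> nat \<Rightarrow> nat \<Rightarrow> complex" where
  "hump_sum d 0 m = 0"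
| "hump_sum d (Suc i) m = hump_sum d i m +
     (if norm (hump_sum d i i) \<ge> (1/4) ^ i * norm (d i i) / 2 then 0 else (1/4) ^ i * d m i)"

text \<open>Sokal's form of the gliding hump: of two vectors differing by \<open>v\<close>, one has norm at least
  \<open>norm v / 2\<close>, so no cancellation can hide the diagonal.\<close>
lemma gliding_hump:
  fixes d :: "nat \<Rightarrow> nat \<Rightarrow> complex"
  assumes diag: "\<And>i j. norm (d i j) \<le> norm (d i i)"
  obtains s :: "nat \<Rightarrow> real" where "\<And>j. s j \<in> {0, 1}"
    "\<And>i. (1/4) ^ i * norm (d i i) / 6 \<le> norm (\<Sum>j. of_real (s j * (1/4) ^ j) * d i j)"
proof -
  define s :: "nat \<Rightarrow> real" where
    "s j = (if norm (hump_sum d j j) \<ge> (1/4) ^ j * norm (d j j) / 2 then 0 else 1)" for j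
  have hump: "hump_sum d n i = (\<Sum>j<n. of_real (s j * (1/4) ^ j) * d i j)" for n i
    by (induction n) (auto simp: s_def)
  have s: "s j \<in> {0, 1}" for j by (simp add: s_def)
  have bd: "norm (of_real (s j * (1/4) ^ j) * d i j) \<le> (1/4) ^ j * norm (d i i)" for i j
    using s[of j] diag[of i j] by (auto simp: norm_mult norm_power intro!: mult_left_mono)
  have sg: "(\<lambda>j. (1/4::real) ^ j * c) sums (4/3 * c)" for c
    using sums_mult2[OF geometric_sums[of "1/4::real"], of c] by simp
  have summ: "summable (\<lambda>j. of_real (s j * (1/4) ^ j) * d i j)" for i
    by (rule summable_comparison_test'[OF sums_summable[OF sg], of 0]) (use bd in auto)
  have "(1/4) ^ i * norm (d i i) / 6 \<le> norm (\<Sum>j. of_real (s j * (1/4) ^ j) * d i j)" for i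
  proof -
    have tail: "norm (\<Sum>j. of_real (s (j + Suc i) * (1/4) ^ (j + Suc i)) * d i (j + Suc i))
        \<le> (\<Sum>j. (1/4) ^ j * ((1/4) ^ Suc i * norm (d i i)))"
    proof (rule norm_suminf_le)
      show "norm (of_real (s (j + Suc i) * (1/4) ^ (j + Suc i)) * d i (j + Suc i))
          \<le> (1/4) ^ j * ((1/4) ^ Suc i * norm (d i i))" for j
        using bd[of "j + Suc i" i] by (simp add: power_add mult_ac)
      show "summable (\<lambda>j. (1/4) ^ j * ((1/4) ^ Suc i * norm (d i i)))"
        using sg sums_summable by blast
    qed
    \<comment> \<open>1/4 + 1/16 + ... = 1/3, so the later vectors can destroy at most a third of
      the weighted diagonal entry, while the choice at stage i secured a half. The difference is the
      1/6 of the claim.\<close>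
    also have "(\<Sum>j. (1/4) ^ j * ((1/4) ^ Suc i * norm (d i i))) = (1/4) ^ i * norm (d i i) / 3"
      using sg[of "(1/4) ^ Suc i * norm (d i i)"] by (simp add: sums_iff)
    finally have tail: "norm (\<Sum>j. of_real (s (j + Suc i) * (1/4) ^ (j + Suc i)) * d i (j + Suc i))
        \<le> (1/4) ^ i * norm (d i i) / 3" .
    have "(1/4) ^ i * norm (d i i) / 2 \<le> norm (hump_sum d (Suc i) i)"
    proof (cases "norm (hump_sum d i i) \<ge> (1/4) ^ i * norm (d i i) / 2")
      case True then show ?thesis by simp
    next
      case False
      have "norm ((1/4) ^ i * d i i) = (1/4) ^ i * norm (d i i)"
        by (simp add: norm_mult norm_power)
      then show ?thesis
        using False norm_diff_ineq[of "(1/4) ^ i * d i i" "hump_sum d i i"] by (simp add: add.commute)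
    qed
    moreover have "(\<Sum>j. of_real (s j * (1/4) ^ j) * d i j) =
        (\<Sum>j. of_real (s (j + Suc i) * (1/4) ^ (j + Suc i)) * d i (j + Suc i)) + hump_sum d (Suc i) i"
      unfolding hump by (rule suminf_split_initial_segment[OF summ])
    ultimately show ?thesis
      using tail norm_diff_ineq[of "hump_sum d (Suc i) i"
          "\<Sum>j. of_real (s (j + Suc i) * (1/4) ^ (j + Suc i)) * d i (j + Suc i)"]
      by (simp only: add.commute)
  qed
  with s that show thesis by blast
qed

section \<open>Chebyshev integrals and the LSVK diagram\<close>

lemma set_integral_FTC:
  fixes F f :: "real \<Rightarrow> 'a::euclidean_space"
  assumes "a \<le> b" "continuous_on {a..b} F" "finite S"
    "\<And>x. x \<in> {a<..<b} - S \<Longrightarrow> (F has_vector_derivative f x) (at x)"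
    and int: "set_integrable lborel {a..b} f"
  shows "(LBINT x:{a..b}. f x) = F b - F a"
proof -
  have "(f has_integral F b - F a) {a..b}"
    by (rule fundamental_theorem_of_calculus_interior_strong[of S]) (use assms in auto)
  then show ?thesis
    using set_borel_integral_eq_integral(2)[OF int] by (simp add: integral_unique)
qed

lemma set_integrable_continuous:
  fixes f :: "real \<Rightarrow> 'a::{banach, second_countable_topology}"
  assumes "continuous_on {a..b} f" shows "set_integrable lborel {a..b} f"
  unfolding set_integrable_def by (rule borel_integrable_compact) (use assms in auto)

section \<open>The substitution x = 2 cos t and the two orthogonality relations\<close>

definition half_arccos :: "real \<Rightarrow> real" where "half_arccos x = arccos (x / 2)"

lemma half_arccos_eqs:
  assumes "-2 < x" "x < 2"
  shows "cos (half_arccos x) = x / 2" "sin (half_arccos x) = sqrt (4 - x\<^sup>2) / 2"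
    "sin (half_arccos x) > 0" "sqrt (4 - x\<^sup>2) > 0"
    "DERIV half_arccos x :> - 1 / sqrt (4 - x\<^sup>2)"
proof -
  have x: "- 1 < x / 2" "x / 2 < 1" using assms by auto
  show "cos (half_arccos x) = x / 2" using x by (simp add: half_arccos_def)
  have s: "sqrt (1 - (x / 2)\<^sup>2) = sqrt (4 - x\<^sup>2) / 2"
    using real_sqrt_divide[of "4 - x\<^sup>2" 4] by (simp add: field_simps power_divide)
  show "sin (half_arccos x) = sqrt (4 - x\<^sup>2) / 2"
    using x s by (simp add: half_arccos_def sin_arccos)
  have "x\<^sup>2 < 2\<^sup>2" using assms by (intro power2_strict_mono) auto
  then show "sqrt (4 - x\<^sup>2) > 0" by simp
  then show "sin (half_arccos x) > 0" using \<open>sin (half_arccos x) = sqrt (4 - x\<^sup>2) / 2\<close> by linarith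
  have "DERIV half_arccos x :> inverse (- sqrt (1 - (x / 2)\<^sup>2)) * (1 / 2)"
    unfolding half_arccos_def
    by (rule DERIV_chain2[where f = arccos and g = "\<lambda>x. x / 2", OF DERIV_arccos[OF x]]) (auto intro!: derivative_eq_intros)
  then show "DERIV half_arccos x :> - 1 / sqrt (4 - x\<^sup>2)"
    unfolding s by (simp add: field_simps)
qed

lemma continuous_on_half_arccos [continuous_intros]: "continuous_on {-2..2} half_arccos"
  unfolding half_arccos_def by (intro continuous_intros) auto

lemma half_arccos_ends [simp]: "half_arccos 2 = 0" "half_arccos (-2) = pi" "half_arccos 0 = pi / 2"
  by (auto simp: half_arccos_def)

lemma U_half_arccos: "-2 < x \<Longrightarrow> x < 2 \<Longrightarrow>
    U_half k x = sin (real (k + 1) * half_arccos x) / sin (half_arccos x)"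
  using U_half_cos[of "half_arccos x" k] half_arccos_eqs(1,3)[of x] by simp

text \<open>The frequency 0 is separated because it alone gives a primitive that is nonzero at pi;
  every orthogonality relation below reduces to this.\<close>

definition cos_primitive :: "real \<Rightarrow> real \<Rightarrow> real" where
  "cos_primitive m t = (if m = 0 then t else sin (m * t) / m)"

lemma DERIV_cos_primitive: "DERIV (cos_primitive m) t :> cos (m * t)"
  by (cases "m = 0") (auto simp: cos_primitive_def[abs_def] intro!: derivative_eq_intros)

lemma cos_primitive_0 [simp]: "cos_primitive m 0 = 0"
  by (simp add: cos_primitive_def)

lemma cos_primitive_pi: "cos_primitive (of_int m) pi = (if m = 0 then pi else 0)"
  by (simp add: cos_primitive_def sin_times_pi_eq_0)

lemma continuous_on_cos_primitive [continuous_intros]: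
  "continuous_on S f \<Longrightarrow> continuous_on S (\<lambda>x. cos_primitive m (f x))"
  by (rule continuous_on_compose2[of UNIV "cos_primitive m"])
    (auto intro!: continuous_at_imp_continuous_on DERIV_isCont[OF DERIV_cos_primitive])

text \<open>The weight is unbounded at both ends. The continuous primitive
  \<open>- half_arccos\<close> gives gauge integrability, and nonnegativity upgrades it to Lebesgue
  integrability.\<close>

lemma set_integrable_arcsine: "set_integrable lborel {-2..2} (\<lambda>x. 1 / sqrt (4 - x\<^sup>2))"
proof -
  have "((\<lambda>x. 1 / sqrt (4 - x\<^sup>2)) has_integral (- half_arccos 2 - (- half_arccos (-2)))) {-2..2}"
  proof (rule fundamental_theorem_of_calculus_interior)
    show "continuous_on {-2..2} (\<lambda>x. - half_arccos x)" by (intro continuous_intros)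
    fix x :: real assume "x \<in> {-2<..<2}"
    then show "((\<lambda>x. - half_arccos x) has_vector_derivative 1 / sqrt (4 - x\<^sup>2)) (at x)"
      using DERIV_minus[OF half_arccos_eqs(5)[of x]]
      by (simp add: has_real_derivative_iff_has_vector_derivative)
  qed simp
  moreover have "x\<^sup>2 \<le> 4" if "x \<in> {-2..2}" for x :: real
    using that abs_le_square_iff[of x 2] by auto
  ultimately have "(\<lambda>x. 1 / sqrt (4 - x\<^sup>2)) absolutely_integrable_on {-2..2}"
    by (intro nonnegative_absolutely_integrable_1) (auto simp: integrable_on_def)
  then show ?thesis
    unfolding set_integrable_def by (subst (asm) integrable_completion) auto
qed

lemma set_integrable_arcsine_weight:
  assumes "continuous_on {-2..2} f"
  shows "set_integrable lborel {-2..2} (\<lambda>x. f x / sqrt (4 - x\<^sup>2) :: real)"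
proof -
  obtain B where B: "\<And>x. x \<in> {-2..2} \<Longrightarrow> norm (f x) \<le> B"
    using compact_imp_bounded[OF compact_continuous_image[OF assms]] unfolding bounded_iff by (metis compact_Icc imageI)
  have [measurable]: "(\<lambda>x. indicator {-2..2} x *\<^sub>R f x) \<in> borel_measurable borel"
    using borel_measurable_continuous_on_indicator[OF _ assms] by simp
  have "(\<lambda>x. (indicator {-2..2} x *\<^sub>R f x) * (1 / sqrt (4 - x\<^sup>2))) \<in> borel_measurable borel"
    by measurable
  moreover have "(indicator {-2..2} x *\<^sub>R f x) * (1 / sqrt (4 - x\<^sup>2)) = indicator {-2..2} x *\<^sub>R (f x / sqrt (4 - x\<^sup>2))" for x
    by simp
  ultimately have meas: "set_borel_measurable lborel {-2..2} (\<lambda>x. f x / sqrt (4 - x\<^sup>2))"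
    by (simp add: set_borel_measurable_def)
  show ?thesis
  proof (rule set_integrable_bound[OF set_integrable_mult_right[OF set_integrable_arcsine, of B] meas])
    have "norm (f x / sqrt (4 - x\<^sup>2)) \<le> norm (B * (1 / sqrt (4 - x\<^sup>2)))" if "x \<in> {-2..2}" for x
      using B[OF that] by (auto simp: abs_divide intro!: divide_right_mono)
    then show "AE x in lborel. x \<in> {-2..2} \<longrightarrow> norm (f x / sqrt (4 - x\<^sup>2)) \<le> norm (B * (1 / sqrt (4 - x\<^sup>2)))"
      by simp
  qed
qed

text \<open>In the variable t the integrand is a difference of cosines with frequencies j - k and j
  + k + 2. The second is never 0, so only j = k leaves a contribution at t = pi.\<close>

lemma cheb_U_orthogonal:
  "(LBINT x:{-2..2}. U_half j x * (U_half k x * (sqrt (4 - x\<^sup>2) / (2 * pi)))) = (if j = k then 1 else 0)"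
proof -
  let ?F = "\<lambda>x. (cos_primitive (of_int (int j + int k + 2)) (half_arccos x)
      - cos_primitive (of_int (int j - int k)) (half_arccos x)) / pi"
  have "(LBINT x:{-2..2}. U_half j x * (U_half k x * (sqrt (4 - x\<^sup>2) / (2 * pi)))) = ?F 2 - ?F (-2)"
  proof (rule set_integral_FTC[of _ _ _ "{}"])
    show "continuous_on {-2..2} ?F" by (intro continuous_intros) auto
    show "set_integrable lborel {-2..2} (\<lambda>x. U_half j x * (U_half k x * (sqrt (4 - x\<^sup>2) / (2 * pi))))"
      by (intro set_integrable_continuous continuous_intros) auto
    fix x :: real assume "x \<in> {-2<..<2} - {}"
    then have x: "-2 < x" "x < 2" by auto
    define t where "t = half_arccos x"
    note e = half_arccos_eqs[OF x, folded t_def]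
    have "DERIV ?F x :> (cos (of_int (int j + int k + 2) * t) * (- 1 / sqrt (4 - x\<^sup>2))
        - cos (of_int (int j - int k) * t) * (- 1 / sqrt (4 - x\<^sup>2))) / pi"
      unfolding t_def
      by (intro DERIV_cdivide DERIV_diff DERIV_chain2[OF DERIV_cos_primitive half_arccos_eqs(5)[OF x]])
    also have "(cos (of_int (int j + int k + 2) * t) * (- 1 / sqrt (4 - x\<^sup>2))
        - cos (of_int (int j - int k) * t) * (- 1 / sqrt (4 - x\<^sup>2))) / pi =
        (cos (real (j+1) * t - real (k+1) * t) - cos (real (j+1) * t + real (k+1) * t)) / (sqrt (4 - x\<^sup>2) * pi)"
      using e(4) by (simp add: field_simps)
    also have "\<dots> = 2 * sin (real (j+1) * t) * sin (real (k+1) * t) / (sqrt (4 - x\<^sup>2) * pi)"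
      by (simp only: cos_diff cos_add) simp
    also have "\<dots> = U_half j x * (U_half k x * (sqrt (4 - x\<^sup>2) / (2 * pi)))"
      unfolding U_half_arccos[OF x] t_def[symmetric] e(2) using e(4)
      by (simp add: field_simps)
    finally show "(?F has_vector_derivative U_half j x * (U_half k x * (sqrt (4 - x\<^sup>2) / (2 * pi)))) (at x)"
      by (simp add: has_real_derivative_iff_has_vector_derivative)
  qed simp_all
  also have "\<dots> = (if j = k then 1 else 0)"
    unfolding half_arccos_ends cos_primitive_pi cos_primitive_0 by auto
  finally show ?thesis .
qed

text \<open>The frequencies are j + (k+1) and j - (k+1). As the second index starts at 1, their sum
  is positive even for j = 0, so the constant is orthogonal to the whole family.\<close>

lemma cheb_T_orthogonal:
  "(LBINT x:{-2..2}. poly (cheb_T j) (x / 2) * (2 * poly (cheb_T (k + 1)) (x / 2) / (pi * sqrt (4 - x\<^sup>2)))) =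
    (if j = k + 1 then 1 else 0)"
proof -
  let ?F = "\<lambda>x. - (cos_primitive (of_int (int j + int k + 1)) (half_arccos x)
      + cos_primitive (of_int (int j - int k - 1)) (half_arccos x)) / pi"
  let ?f = "\<lambda>x. poly (cheb_T j) (x / 2) * (2 * poly (cheb_T (k + 1)) (x / 2) / (pi * sqrt (4 - x\<^sup>2)))"
  have "(LBINT x:{-2..2}. ?f x) = ?F 2 - ?F (-2)"
  proof (rule set_integral_FTC[of _ _ _ "{}"])
    show "continuous_on {-2..2} ?F" by (intro continuous_intros) auto
    have "set_integrable lborel {-2..2} (\<lambda>x. (poly (cheb_T j) (x / 2) * 2 * poly (cheb_T (k + 1)) (x / 2) / pi) / sqrt (4 - x\<^sup>2))"
      by (intro set_integrable_arcsine_weight continuous_intros) auto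
    then show "set_integrable lborel {-2..2} ?f" by (simp add: mult_ac)
    fix x :: real assume "x \<in> {-2<..<2} - {}"
    then have x: "-2 < x" "x < 2" by auto
    define t where "t = half_arccos x"
    note e = half_arccos_eqs[OF x, folded t_def]
    have "DERIV ?F x :> - (cos (of_int (int j + int k + 1) * t) * (- 1 / sqrt (4 - x\<^sup>2))
        + cos (of_int (int j - int k - 1) * t) * (- 1 / sqrt (4 - x\<^sup>2))) / pi"
      unfolding t_def
      by (intro DERIV_cdivide DERIV_minus DERIV_add DERIV_chain2[OF DERIV_cos_primitive half_arccos_eqs(5)[OF x]])
    also have "- (cos (of_int (int j + int k + 1) * t) * (- 1 / sqrt (4 - x\<^sup>2))
        + cos (of_int (int j - int k - 1) * t) * (- 1 / sqrt (4 - x\<^sup>2))) / pi =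
        (cos (real j * t - real (k+1) * t) + cos (real j * t + real (k+1) * t)) / (sqrt (4 - x\<^sup>2) * pi)"
      using e(4) by (simp add: field_simps)
    also have "\<dots> = 2 * cos (real j * t) * cos (real (k+1) * t) / (sqrt (4 - x\<^sup>2) * pi)"
      by (simp only: cos_diff cos_add) simp
    also have "\<dots> = ?f x"
      unfolding poly_cheb_T_cos[symmetric] e(1) by (simp add: mult_ac)
    finally show "(?F has_vector_derivative ?f x) (at x)"
      by (simp add: has_real_derivative_iff_has_vector_derivative)
  qed simp_all
  also have "\<dots> = (if j = k + 1 then 1 else 0)"
    unfolding half_arccos_ends cos_primitive_pi cos_primitive_0 by auto
  finally show ?thesis .
qed

section \<open>Termwise integration of the generating series\<close>

lemma set_integrable_mult_bounded:
  fixes g :: "'a \<Rightarrow> complex" and h :: "'a \<Rightarrow> real"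
  assumes g: "set_integrable M A g" and [measurable]: "h \<in> borel_measurable M"
    and h: "\<And>x. x \<in> A \<Longrightarrow> \<bar>h x\<bar> \<le> C"
  shows "set_integrable M A (\<lambda>x. g x * of_real (h x))"
proof (rule set_integrable_bound[OF set_integrable_mult_right[OF g, of "of_real C"]])
  have [measurable]: "(\<lambda>x. indicator A x *\<^sub>R g x) \<in> borel_measurable M"
    using g by (auto simp: set_integrable_def)
  have "(\<lambda>x. (indicator A x *\<^sub>R g x) * of_real (h x)) \<in> borel_measurable M" by measurable
  then show "set_borel_measurable M A (\<lambda>x. g x * of_real (h x))"
    by (simp add: set_borel_measurable_def)
  have "norm (g x * of_real (h x)) \<le> norm (of_real C * g x)" if "x \<in> A" for x
    using mult_right_mono[of "\<bar>h x\<bar>" "\<bar>C\<bar>" "norm (g x)"] h[OF that]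
    by (simp add: norm_mult mult.commute)
  then show "AE x in M. x \<in> A \<longrightarrow> norm (g x * of_real (h x)) \<le> norm (of_real C * g x)"
    by simp
qed

text \<open>Dominated termwise integration, with the non-polynomial factor kept in \<open>g\<close>.
  An arbitrary measure is allowed because the expansion serves \<open>\<mu> n\<close>, the
  semicircle law and Lebesgue measure alike.\<close>

lemma set_integral_sums:
  fixes g S :: "'a \<Rightarrow> complex" and a :: "nat \<Rightarrow> 'a \<Rightarrow> real"
  assumes g: "set_integrable M A g" and [measurable]: "\<And>k. a k \<in> borel_measurable M"
    and a: "\<And>k x. x \<in> A \<Longrightarrow> \<bar>a k x\<bar> \<le> C k"
    and summ: "summable (\<lambda>k. C k * norm z ^ k)" and A: "A \<in> sets M"
    and S: "\<And>x. x \<in> A \<Longrightarrow> (\<lambda>k. z ^ k * of_real (a k x)) sums S x"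
  shows "(\<lambda>k. (LINT x:A|M. g x * of_real (a k x)) * z ^ k) sums (LINT x:A|M. g x * S x)"
    and "set_integrable M A (\<lambda>x. g x * S x)"
proof -
  let ?f = "\<lambda>k x. indicator A x *\<^sub>R (g x * of_real (a k x) * z ^ k)"
  have int: "integrable M (?f k)" for k
  proof -
    have "set_integrable M A (\<lambda>x. g x * of_real (a k x) * z ^ k)"
      by (intro set_integrable_mult_left set_integrable_mult_bounded[OF g _ a]) auto
    then show ?thesis by (simp add: set_integrable_def)
  qed
  have bd: "norm (?f k x) \<le> norm (indicator A x *\<^sub>R g x) * (C k * norm z ^ k)" for k x
  proof (cases "x \<in> A")
    case True
    then show ?thesis using a[OF True, of k]
      by (auto simp: norm_mult norm_power mult.assoc intro!: mult_left_mono mult_right_mono)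
  qed simp
  have ing: "integrable M (\<lambda>x. norm (indicator A x *\<^sub>R g x))"
    using g unfolding set_integrable_def by (rule integrable_norm)
  have ae: "AE x in M. summable (\<lambda>k. norm (?f k x))"
    by (rule AE_I2, rule summable_comparison_test'[OF summable_mult[OF summ], of 0])
      (use bd in simp)
  have su: "summable (\<lambda>k. LINT x|M. norm (?f k x))"
  proof (rule summable_comparison_test'[OF summable_mult[OF summ], of 0])
    fix k
    have "(LINT x|M. norm (?f k x)) \<le> (LINT x|M. norm (indicator A x *\<^sub>R g x) * (C k * norm z ^ k))"
      by (intro integral_mono integrable_norm int integrable_mult_left ing bd)
    then show "norm (LINT x|M. norm (?f k x)) \<le> (LINT x|M. norm (indicator A x *\<^sub>R g x)) * (C k * norm z ^ k)"
      by simp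
  qed
  have lim: "(\<Sum>k. ?f k x) = indicator A x *\<^sub>R (g x * S x)" for x
  proof (cases "x \<in> A")
    case True
    have "(\<lambda>k. g x * (z ^ k * of_real (a k x))) sums (g x * S x)"
      by (intro sums_mult S True)
    then show ?thesis using True by (simp add: sums_iff mult_ac)
  qed simp
  have "(\<lambda>k. LINT x|M. ?f k x) sums (LINT x|M. (\<Sum>k. ?f k x))"
    by (rule sums_integral[OF int ae su])
  moreover have "(LINT x|M. ?f k x) = (LINT x:A|M. g x * of_real (a k x)) * z ^ k" for k
    by (simp add: set_lebesgue_integral_def flip: integral_mult_left_zero)
  ultimately show "(\<lambda>k. (LINT x:A|M. g x * of_real (a k x)) * z ^ k) sums (LINT x:A|M. g x * S x)"
    unfolding lim by (simp add: set_lebesgue_integral_def)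
  show "set_integrable M A (\<lambda>x. g x * S x)"
    using integrable_suminf[OF int ae su] unfolding lim by (simp add: set_integrable_def)
qed

text \<open>The first series is the side of the measures, with g = 1; the second is the side of the
  diagrams, with g an excess. In the second, 1 - z^2 stays on the right so that each coefficient is
  just k + 1 times one moment.\<close>

lemma cheb_U_integral_sums:
  fixes g :: "real \<Rightarrow> complex"
  assumes g: "set_integrable M {-2..2} g" and M: "sets M = sets borel" and z: "norm z < 1"
  shows "(\<lambda>k. (LINT x:{-2..2}|M. g x * of_real (U_half k x)) * z ^ k) sums
      (LINT x:{-2..2}|M. g x / cheb_denom z x)"
    and "(\<lambda>k. of_nat (k + 1) * (LINT x:{-2..2}|M. g x * of_real (U_half k x)) * z ^ k) sums
      ((1 - z\<^sup>2) * (LINT x:{-2..2}|M. g x / (cheb_denom z x)\<^sup>2))"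
    and "set_integrable M {-2..2} (\<lambda>x. g x / cheb_denom z x)"
    and "set_integrable M {-2..2} (\<lambda>x. g x / (cheb_denom z x)\<^sup>2)"
proof -
  have meas[measurable]: "U_half k \<in> borel_measurable M" "{-2..2} \<in> sets M" for k
    using measurable_cong_sets[OF M refl] M by auto
  have bd: "x \<in> {-2..2} \<Longrightarrow> \<bar>U_half k x\<bar> \<le> real k + 1" for x k
    by (rule abs_U_half_le) auto
  have 1: "summable (\<lambda>k. (real k + 1) * norm z ^ k)"
    by (rule summable_linear_power) (use z in auto)
  have 2: "summable (\<lambda>k. (real k + 1) * (real k + 1) * norm z ^ k)"
    by (rule summable_square_power) (use z in auto)
  have gen: "(\<lambda>k. z ^ k * of_real (U_half k x)) sums (1 / cheb_denom z x)" if "x \<in> {-2..2}" for x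
    by (rule cheb_U_generating) (use that z in auto)
  have gen': "(\<lambda>k. z ^ k * of_real ((real k + 1) * U_half k x)) sums ((1 - z\<^sup>2) / (cheb_denom z x)\<^sup>2)"
    if "x \<in> {-2..2}" for x
    by (rule cheb_U_generating_deriv) (use that z in auto)
  note i = set_integral_sums[OF g meas(1) bd 1 meas(2) gen]
  show "(\<lambda>k. (LINT x:{-2..2}|M. g x * of_real (U_half k x)) * z ^ k) sums
      (LINT x:{-2..2}|M. g x / cheb_denom z x)"
    "set_integrable M {-2..2} (\<lambda>x. g x / cheb_denom z x)" using i by simp_all
  have meas': "(\<lambda>x. (real k + 1) * U_half k x) \<in> borel_measurable M" for k
    by measurable
  have bd': "x \<in> {-2..2} \<Longrightarrow> \<bar>(real k + 1) * U_half k x\<bar> \<le> (real k + 1) * (real k + 1)" for x k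
    using bd by (auto simp: abs_mult intro!: mult_left_mono)
  note j = set_integral_sums[where a = "\<lambda>k x. (real k + 1) * U_half k x", OF g meas' bd' 2 meas(2) gen']
  have e: "g x * of_real ((real k + 1) * U_half k x) = of_nat (k + 1) * (g x * of_real (U_half k x))" for k x
    by simp
  have e': "g x * ((1 - z\<^sup>2) / (cheb_denom z x)\<^sup>2) = (1 - z\<^sup>2) * (g x / (cheb_denom z x)\<^sup>2)" for x
    by simp
  show "(\<lambda>k. of_nat (k + 1) * (LINT x:{-2..2}|M. g x * of_real (U_half k x)) * z ^ k) sums
      ((1 - z\<^sup>2) * (LINT x:{-2..2}|M. g x / (cheb_denom z x)\<^sup>2))"
    using j(1) unfolding e e' set_integral_mult_right by simp
  have "1 - z\<^sup>2 \<noteq> 0"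
  proof
    assume "1 - z\<^sup>2 = 0"
    then have "norm z ^ 2 = 1" by (simp flip: norm_power)
    then show False using z power2_eq_1_iff[of "norm z"] norm_ge_zero[of z] by linarith
  qed
  then show "set_integrable M {-2..2} (\<lambda>x. g x / (cheb_denom z x)\<^sup>2)"
    using j(2) unfolding e' by (rule iffD1[OF set_integrable_mult_right_iff])
qed

text \<open>Derivative of LSVK x - |x| inside [-2,2] away from 0. The jump of \<open>sgn\<close> at
  0 is why 0 is an exceptional point in the integrations below.\<close>

definition lsvk_slope :: "real \<Rightarrow> real" where
  "lsvk_slope x = 2 / pi * arcsin (x / 2) - sgn x"

lemma set_integrable_sgn_mult:
  fixes g :: "real \<Rightarrow> complex"
  assumes "continuous_on {-2..2} g"
  shows "set_integrable lborel {-2..2} (\<lambda>x. g x * of_real (sgn x))"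
  by (rule set_integrable_mult_bounded[where C = 1])
    (auto simp: sgn_real_def intro!: set_integrable_continuous assms)

lemma set_integrable_arcsin_mult:
  fixes g :: "real \<Rightarrow> complex"
  assumes "continuous_on {-2..2} g"
  shows "set_integrable lborel {-2..2} (\<lambda>x. g x * of_real (arcsin (x / 2)))"
  by (intro set_integrable_continuous continuous_intros assms) auto

lemma lsvk_slope_integral:
  fixes g :: "real \<Rightarrow> complex"
  assumes "continuous_on {-2..2} g"
  shows "set_integrable lborel {-2..2} (\<lambda>x. g x * of_real (lsvk_slope x))"
    "(LBINT x:{-2..2}. g x * of_real (lsvk_slope x)) =
      of_real (2 / pi) * (LBINT x:{-2..2}. g x * of_real (arcsin (x / 2))) - (LBINT x:{-2..2}. g x * of_real (sgn x))"
proof -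
  have e: "g x * of_real (lsvk_slope x) = of_real (2 / pi) * (g x * of_real (arcsin (x / 2))) - g x * of_real (sgn x)" for x
    by (simp add: lsvk_slope_def algebra_simps)
  have i: "set_integrable lborel {-2..2} (\<lambda>x. of_real (2 / pi) * (g x * of_real (arcsin (x / 2))))"
    by (intro set_integrable_mult_right set_integrable_arcsin_mult assms)
  note j = set_integral_diff[OF i set_integrable_sgn_mult[OF assms]]
  show "set_integrable lborel {-2..2} (\<lambda>x. g x * of_real (lsvk_slope x))"
    unfolding e by (rule j(1))
  show "(LBINT x:{-2..2}. g x * of_real (lsvk_slope x)) =
      of_real (2 / pi) * (LBINT x:{-2..2}. g x * of_real (arcsin (x / 2))) - (LBINT x:{-2..2}. g x * of_real (sgn x))"
    unfolding e j(2) by simp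
qed

lemma DERIV_lsvk_excess:
  assumes "-2 < x" "x < 2" "x \<noteq> 0"
  shows "DERIV (\<lambda>x. LSVK x - \<bar>x\<bar>) x :> lsvk_slope x"
proof -
  let ?L = "\<lambda>x. 2 / pi * (x * arcsin (x / 2) + sqrt (4 - x\<^sup>2))"
  have s: "sqrt (1 - (x / 2)\<^sup>2) = sqrt (4 - x\<^sup>2) / 2"
    using real_sqrt_divide[of "4 - x\<^sup>2" 4] by (simp add: field_simps power_divide)
  have pos: "sqrt (4 - x\<^sup>2) > 0" by (rule half_arccos_eqs) (use assms in auto)
  then have pos': "4 - x\<^sup>2 > 0" by simp
  have a: "DERIV (\<lambda>x. arcsin (x / 2)) x :> inverse (sqrt (1 - (x / 2)\<^sup>2)) * (1 / 2)"
    by (rule DERIV_chain2[OF DERIV_arcsin]) (use assms in \<open>auto intro!: derivative_eq_intros\<close>)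
  have q: "DERIV (\<lambda>x. sqrt (4 - x\<^sup>2)) x :> (inverse (sqrt (4 - x\<^sup>2)) / 2) * (- (2 * x))"
    by (rule DERIV_chain2[OF DERIV_real_sqrt]) (use pos' in \<open>auto intro!: derivative_eq_intros\<close>)
  have "DERIV ?L x :> 2 / pi * ((1 * arcsin (x / 2) + (inverse (sqrt (1 - (x / 2)\<^sup>2)) * (1 / 2)) * x)
     + (inverse (sqrt (4 - x\<^sup>2)) / 2) * (- (2 * x)))"
    by (intro DERIV_cmult DERIV_add DERIV_mult[OF DERIV_ident] a q)
  also have "2 / pi * ((1 * arcsin (x / 2) + (inverse (sqrt (1 - (x / 2)\<^sup>2)) * (1 / 2)) * x)
     + (inverse (sqrt (4 - x\<^sup>2)) / 2) * (- (2 * x))) = 2 / pi * arcsin (x / 2)"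
    unfolding s using pos by (simp add: field_simps)
  finally have L: "DERIV ?L x :> 2 / pi * arcsin (x / 2)" .
  have "DERIV LSVK x :> 2 / pi * arcsin (x / 2)"
    by (rule iffD1[OF DERIV_cong_ev[OF refl _ refl] L], rule eventually_mono[OF eventually_nhds_in_open[of "{-2<..<2}"]])
      (use assms in \<open>auto simp: LSVK_def\<close>)
  moreover have "DERIV abs x :> sgn x" 
  proof (cases "x > 0")
    case True
    then show ?thesis
      by (intro iffD1[OF DERIV_cong_ev[OF refl _ refl] DERIV_ident[THEN DERIV_cong]]
          eventually_mono[OF eventually_nhds_in_open[of "{0<..}"]]) auto
  next
    case False
    then show ?thesis using assms(3)
      by (intro iffD1[OF DERIV_cong_ev[OF refl _ refl] DERIV_minus[OF DERIV_ident, THEN DERIV_cong]]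
          eventually_mono[OF eventually_nhds_in_open[of "{..<0}"]]) auto
  qed
  ultimately show ?thesis
    unfolding lsvk_slope_def by (rule DERIV_diff)
qed

lemma LSVK_eq: "\<bar>x\<bar> \<le> 2 \<Longrightarrow> LSVK x = 2 / pi * (x * arcsin (x / 2) + sqrt (4 - x\<^sup>2))"
  by (simp add: LSVK_def)

lemma continuous_on_LSVK: "continuous_on {-2..2} LSVK"
proof -
  have "continuous_on {-2..2} (\<lambda>x. 2 / pi * (x * arcsin (x / 2) + sqrt (4 - x\<^sup>2)))"
    by (intro continuous_intros) auto
  then show ?thesis
    by (rule continuous_on_eq) (auto simp: LSVK_eq)
qed

text \<open>The boundary terms vanish because LSVK takes the value 2 at both 2 and -2.\<close>

lemma lsvk_excess_by_parts:
  fixes g g' :: "real \<Rightarrow> complex"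
  assumes g: "continuous_on {-2..2} g" and g': "continuous_on {-2..2} g'"
    and der: "\<And>x. x \<in> {-2<..<2} \<Longrightarrow> (g has_vector_derivative g' x) (at x)"
  shows "(LBINT x:{-2..2}. g' x * of_real (LSVK x - \<bar>x\<bar>)) = - (LBINT x:{-2..2}. g x * of_real (lsvk_slope x))"
proof -
  let ?F = "\<lambda>x. g x * of_real (LSVK x - \<bar>x\<bar>)"
  have i: "set_integrable lborel {-2..2} (\<lambda>x. g' x * of_real (LSVK x - \<bar>x\<bar>))"
    by (intro set_integrable_continuous continuous_intros g' continuous_on_LSVK)
  have "(LBINT x:{-2..2}. g x * of_real (lsvk_slope x) + g' x * of_real (LSVK x - \<bar>x\<bar>)) = ?F 2 - ?F (-2)"
  proof (rule set_integral_FTC[of _ _ _ "{0}"])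
    show "continuous_on {-2..2} ?F" by (intro continuous_intros g continuous_on_LSVK)
    show "set_integrable lborel {-2..2} (\<lambda>x. g x * of_real (lsvk_slope x) + g' x * of_real (LSVK x - \<bar>x\<bar>))"
      by (intro set_integral_add lsvk_slope_integral g i)
    fix x :: real assume "x \<in> {-2<..<2} - {0}"
    then have x: "x \<in> {-2<..<2}" "x \<noteq> 0" by auto
    have "DERIV (\<lambda>x. LSVK x - \<bar>x\<bar>) x :> lsvk_slope x"
      by (rule DERIV_lsvk_excess) (use x in auto)
    with x(1) show "(?F has_vector_derivative g x * of_real (lsvk_slope x) + g' x * of_real (LSVK x - \<bar>x\<bar>)) (at x)"
      by (intro has_vector_derivative_mult der has_vector_derivative_of_real)
  qed simp_all
  also have "\<dots> = 0" by (simp add: LSVK_eq)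
  finally show ?thesis
    using set_integral_add(2)[OF lsvk_slope_integral(1)[OF g] i] by (simp add: eq_neg_iff_add_eq_0 add.commute)
qed

text \<open>\<open>W\<close> is a primitive of \<open>U_half k\<close>. Integrating the arcsine part
  by parts then needs a primitive \<open>V\<close> of W / sqrt(4 - x^2), because arcsin(x/2) has
  derivative 1 / sqrt(4 - x^2).\<close>

lemma lsvk_slope_cheb_U:
  "(LBINT x:{-2..2}. U_half k x * lsvk_slope x) = 4 * cos (real (k + 1) * pi / 2) / real (k + 1)"
proof -
  define m where "m = real (k + 1)"
  have m: "m > 0" by (simp add: m_def)
  define W where "W x = 2 * cos (m * half_arccos x) / m" for x
  define V where "V x = - 2 * sin (m * half_arccos x) / m\<^sup>2" for x
  have contW: "continuous_on {-2..2} W" unfolding W_def by (intro continuous_intros) (use m in auto)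
  have contV: "continuous_on {-2..2} V" unfolding V_def by (intro continuous_intros) (use m in auto)
  have W: "DERIV W x :> U_half k x" and V: "DERIV V x :> W x / sqrt (4 - x\<^sup>2)" if "-2 < x" "x < 2" for x
  proof -
    note e = half_arccos_eqs[OF that]
    have 1: "DERIV (\<lambda>x. m * half_arccos x) x :> m * (- 1 / sqrt (4 - x\<^sup>2))"
      by (intro DERIV_cmult e)
    have "DERIV W x :> 2 * (- sin (m * half_arccos x) * (m * (- 1 / sqrt (4 - x\<^sup>2)))) / m"
      unfolding W_def by (intro DERIV_cdivide DERIV_cmult DERIV_chain2[OF DERIV_cos 1])
    also have "2 * (- sin (m * half_arccos x) * (m * (- 1 / sqrt (4 - x\<^sup>2)))) / m = U_half k x"
      unfolding U_half_arccos[OF that, of k, folded m_def] e(2) using e(4) m by (simp add: field_simps)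
    finally show "DERIV W x :> U_half k x" .
    have "DERIV V x :> - 2 * (cos (m * half_arccos x) * (m * (- 1 / sqrt (4 - x\<^sup>2)))) / m\<^sup>2"
      unfolding V_def by (intro DERIV_cdivide DERIV_cmult DERIV_chain2[OF DERIV_sin 1])
    also have "- 2 * (cos (m * half_arccos x) * (m * (- 1 / sqrt (4 - x\<^sup>2)))) / m\<^sup>2 = W x / sqrt (4 - x\<^sup>2)"
      unfolding W_def using e(4) m by (simp add: field_simps power2_eq_square)
    finally show "DERIV V x :> W x / sqrt (4 - x\<^sup>2)" .
  qed
  have ends: "W 2 = 2 / m" "W 0 = 2 * cos (m * pi / 2) / m" "V 2 = 0" "V (-2) = 0"
    using sin_npi[of "k + 1"] by (simp_all add: W_def V_def m_def)
  \<comment> \<open>Subtracting \<open>W 0\<close> makes the sign term continuous through its jump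
    at 0. The end values of \<open>W\<close> then cancel against the arcsine part, since arcsin is
    pi/2 and -pi/2 there, and 2 W(0) remains.\<close>
  let ?F = "\<lambda>x. 2 / pi * (W x * arcsin (x / 2) - V x) - (W x - W 0) * sgn x"
  have "(LBINT x:{-2..2}. U_half k x * lsvk_slope x) = ?F 2 - ?F (-2)"
  proof (rule set_integral_FTC[of _ _ _ "{0}"])
    have "continuous_on {-2..2} (\<lambda>x. (W x - W 0) * sgn x)"
    proof -
      have "continuous_on {0..2} (\<lambda>x. (W x - W 0) * sgn x)"
        by (rule continuous_on_eq[of _ "\<lambda>x. W x - W 0"])
          (auto simp: sgn_real_def intro!: continuous_intros continuous_on_subset[OF contW])
      moreover have "continuous_on {-2..0} (\<lambda>x. (W x - W 0) * sgn x)"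
        by (rule continuous_on_eq[of _ "\<lambda>x. - (W x - W 0)"])
          (auto simp: sgn_real_def intro!: continuous_on_minus continuous_on_diff continuous_on_const continuous_on_subset[OF contW])
      ultimately have "continuous_on ({-2..0} \<union> {0..2}) (\<lambda>x. (W x - W 0) * sgn x)"
        by (intro continuous_on_closed_Un) auto
      then show ?thesis by (simp add: ivl_disj_un_two_touch(4))
    qed
    note sgn = this
    have "continuous_on {-2..2} (\<lambda>x. arcsin (x / 2))" by (intro continuous_intros) auto
    then show "continuous_on {-2..2} ?F"
      by (intro continuous_on_diff[OF _ sgn] continuous_on_mult continuous_on_const
          continuous_on_diff[OF _ contV] contW)
    have "set_integrable lborel {-2..2} (\<lambda>x. complex_of_real (U_half k x) * of_real (lsvk_slope x))"
      by (intro lsvk_slope_integral continuous_intros)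
    then have "integrable lborel (\<lambda>x. Re (indicator {-2..2} x *\<^sub>R (complex_of_real (U_half k x) * of_real (lsvk_slope x))))"
      unfolding set_integrable_def by (rule integrable_Re)
    then show "set_integrable lborel {-2..2} (\<lambda>x. U_half k x * lsvk_slope x)"
      by (simp add: set_integrable_def)
    fix x :: real assume "x \<in> {-2<..<2} - {0}"
    then have x: "-2 < x" "x < 2" "x \<noteq> 0" by auto
    have s: "sqrt (1 - (x / 2)\<^sup>2) = sqrt (4 - x\<^sup>2) / 2"
      using real_sqrt_divide[of "4 - x\<^sup>2" 4] by (simp add: field_simps power_divide)
    have a: "DERIV (\<lambda>x. arcsin (x / 2)) x :> inverse (sqrt (1 - (x / 2)\<^sup>2)) * (1 / 2)"
      by (rule DERIV_chain2[OF DERIV_arcsin]) (use x in \<open>auto intro!: derivative_eq_intros\<close>)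
    have sg: "DERIV sgn x :> 0"
      by (rule iffD1[OF DERIV_cong_ev[OF refl _ refl] DERIV_const[of "sgn x"]],
          rule eventually_mono[OF eventually_nhds_in_open[of "if x > 0 then {0<..} else {..<0}"]])
        (use x in \<open>auto split: if_splits\<close>)
    have "DERIV ?F x :> 2 / pi * (U_half k x * arcsin (x / 2) + (inverse (sqrt (1 - (x / 2)\<^sup>2)) * (1 / 2)) * W x - W x / sqrt (4 - x\<^sup>2))
       - ((U_half k x - 0) * sgn x + 0 * (W x - W 0))"
      by (intro DERIV_diff DERIV_cmult DERIV_mult W V a sg DERIV_const x)
    also have "2 / pi * (U_half k x * arcsin (x / 2) + (inverse (sqrt (1 - (x / 2)\<^sup>2)) * (1 / 2)) * W x - W x / sqrt (4 - x\<^sup>2))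
       - ((U_half k x - 0) * sgn x + 0 * (W x - W 0)) = U_half k x * lsvk_slope x"
      unfolding s lsvk_slope_def using half_arccos_eqs(4)[OF x(1,2)] by (simp add: field_simps)
    finally show "(?F has_vector_derivative U_half k x * lsvk_slope x) (at x)"
      by (simp add: has_real_derivative_iff_has_vector_derivative)
  qed simp_all
  also have "\<dots> = 2 * W 0" by (simp add: ends)
  finally show ?thesis by (simp add: ends(2) m_def)
qed

text \<open>One integration by parts replaces the excess by its slope, whose moments are 4 cos((k+1)
  pi/2) / (k+1). As i^m + (-i)^m = 2 cos(m pi/2), the resulting series is twice Ln(1 + iz) + Ln(1 -
  iz), and (1 + iz)(1 - iz) = 1 + z^2.\<close>

lemma lsvk_transform:
  assumes z: "norm z < 1"
  shows "exp (1 / 2 * (z\<^sup>2 * (LBINT x:{-2..2}. of_real (LSVK x - \<bar>x\<bar>) / (cheb_denom z x)\<^sup>2))) = 1 + z\<^sup>2"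
proof -
  have nz: "cheb_denom z x \<noteq> 0" if "x \<in> {-2..2}" for x
    by (rule cheb_denom_nonzero) (use that z in auto)
  have cont: "continuous_on {-2..2} (cheb_denom z)"
    unfolding cheb_denom_def by (intro continuous_intros)
  have "(LBINT x:{-2..2}. z\<^sup>2 / (cheb_denom z x)\<^sup>2 * of_real (LSVK x - \<bar>x\<bar>)) =
      - (LBINT x:{-2..2}. z / cheb_denom z x * of_real (lsvk_slope x))"
  proof (rule lsvk_excess_by_parts)
    fix x :: real assume x: "x \<in> {-2<..<2}"
    have "((\<lambda>x. cheb_denom z x) has_vector_derivative - z) (at x)"
      unfolding cheb_denom_def by (auto intro!: derivative_eq_intros)
    then have "((\<lambda>x. z * inverse (cheb_denom z x)) has_vector_derivative z * - (inverse (cheb_denom z x) * - z * inverse (cheb_denom z x))) (at x)"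
      unfolding has_vector_derivative_def
      by (auto intro!: derivative_eq_intros nz x[THEN subsetD[rotated]] simp: greaterThanLessThan_subseteq_atLeastAtMost_iff)
    then show "((\<lambda>x. z / cheb_denom z x) has_vector_derivative z\<^sup>2 / (cheb_denom z x)\<^sup>2) (at x)"
      by (simp add: field_simps power2_eq_square)
  qed (intro continuous_intros cont, use nz in auto)+
  then have Z: "z\<^sup>2 * (LBINT x:{-2..2}. of_real (LSVK x - \<bar>x\<bar>) / (cheb_denom z x)\<^sup>2) =
      - z * (LBINT x:{-2..2}. of_real (lsvk_slope x) / cheb_denom z x)"
    unfolding set_integral_mult_right[symmetric] set_integral_mult_left[symmetric]
    by (simp add: mult_ac set_integral_uminus[symmetric] set_lebesgue_integral_def)
  have i: "set_integrable lborel {-2..2} (\<lambda>x. complex_of_real (lsvk_slope x))"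
    using lsvk_slope_integral(1)[of "\<lambda>_. 1"] by simp
  have "(\<lambda>k. (LBINT x:{-2..2}. of_real (lsvk_slope x) * of_real (U_half k x)) * z ^ k) sums
      (LBINT x:{-2..2}. of_real (lsvk_slope x) / cheb_denom z x)"
    by (rule cheb_U_integral_sums[OF i _ z]) simp
  moreover have "(LBINT x:{-2..2}. complex_of_real (lsvk_slope x) * of_real (U_half k x)) =
      of_real (4 * cos (real (k + 1) * pi / 2) / real (k + 1))" for k
    unfolding lsvk_slope_cheb_U[symmetric] of_real_mult[symmetric] set_integral_complex_of_real
    by (simp add: mult.commute)
  ultimately have s: "(\<lambda>k. of_real (4 * cos (real (k + 1) * pi / 2) / real (k + 1)) * z ^ k) sums
      (LBINT x:{-2..2}. of_real (lsvk_slope x) / cheb_denom z x)" by simp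
  have ln: "(\<lambda>n. - ((- (w * z)) ^ n) / of_nat n) sums Ln (1 + w * z)" if "norm w = 1" for w
    using Ln_series'[of "w * z"] that z by (simp add: norm_mult)
  have "(\<lambda>n. 2 * (- ((- (\<i> * z)) ^ n) / of_nat n + (- ((- (- \<i> * z)) ^ n) / of_nat n))) sums
      (2 * (Ln (1 + \<i> * z) + Ln (1 + - \<i> * z)))"
    by (intro sums_mult sums_add ln) auto
  \<comment> \<open>The term n = 0 is a division by zero and hence 0, so the shift of the index
    costs nothing.\<close>
  then have "(\<lambda>n. 2 * (- ((- (\<i> * z)) ^ Suc n) / of_nat (Suc n) + (- ((- (- \<i> * z)) ^ Suc n) / of_nat (Suc n)))) sums
      (2 * (Ln (1 + \<i> * z) + Ln (1 + - \<i> * z)))"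
    by (subst sums_Suc_iff) simp
  moreover have "2 * (- ((- (\<i> * z)) ^ Suc n) / of_nat (Suc n) + (- ((- (- \<i> * z)) ^ Suc n) / of_nat (Suc n))) =
      - z * (of_real (4 * cos (real (n + 1) * pi / 2) / real (n + 1)) * z ^ n)" for n
  proof -
    have "(\<i> ^ m + (- \<i>) ^ m) = of_real (2 * cos (real m * pi / 2))" for m
    proof -
      have cis_pi_half: "cis (pi / 2) = \<i>" and cis_minus_pi_half: "cis (- (pi / 2)) = - \<i>"
        by (simp_all add: complex_eq_iff)
      have "\<i> ^ m = cis (real m * (pi / 2))"
        using Complex.DeMoivre[of "pi / 2" m] by (simp only: cis_pi_half)
      moreover have "(- \<i>) ^ m = cis (- (real m * (pi / 2)))"
        using Complex.DeMoivre[of "- (pi / 2)" m] by (simp only: cis_minus_pi_half mult_minus_right)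
      ultimately show ?thesis by (simp add: complex_eq_iff)
    qed
    from this[of "Suc n"] have XY: "(- (\<i> * z)) ^ Suc n + (- (- \<i> * z)) ^ Suc n = of_real (2 * cos (real (Suc n) * pi / 2)) * z ^ Suc n"
      by (simp only: power_mult_distrib mult_minus_left[symmetric] distrib_right[symmetric]) (simp add: add.commute)
    have fr: "2 * (- X / N + (- Y / N)) = - 2 * (X + Y) / N" for X Y N :: complex
      by (simp add: diff_divide_distrib algebra_simps)
    show ?thesis unfolding fr XY by simp
  qed
  ultimately have "- z * (LBINT x:{-2..2}. of_real (lsvk_slope x) / cheb_denom z x) =
      2 * (Ln (1 + \<i> * z) + Ln (1 + - \<i> * z))"
    by (simp only:) (rule sums_unique2[OF sums_mult[OF s]])
  moreover have nz1: "1 + w * z \<noteq> 0" if "norm w = 1" for w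
  proof
    assume "1 + w * z = 0"
    then have "w * z = -1" by (simp add: eq_neg_iff_add_eq_0 add.commute)
    then show False using z that by (metis norm_mult mult_1 norm_minus_cancel norm_one less_irrefl)
  qed
  ultimately have "1 / 2 * (z\<^sup>2 * (LBINT x:{-2..2}. of_real (LSVK x - \<bar>x\<bar>) / (cheb_denom z x)\<^sup>2)) =
      Ln (1 + \<i> * z) + Ln (1 + - \<i> * z)"
    unfolding Z by simp
  then show ?thesis
    using nz1[of \<i>] nz1[of "- \<i>"] by (simp add: exp_add algebra_simps power2_eq_square)
qed

section \<open>Cauchy transforms\<close>

text \<open>The difference quotient minus the proposed derivative is exactly the integral of g(x) h
  / ((w - x)^2 (w + h - x)). For |h| < \<delta>/2 the last factor is at least \<delta>/2 in modulus,
  so the error is linear in h.\<close>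

lemma DERIV_cauchy_transform:
  fixes g :: "real \<Rightarrow> complex"
  assumes g: "set_integrable M A g" and M: "sets M = sets borel" and A: "A \<in> sets borel"
    and \<delta>: "\<delta> > 0" "\<And>x. x \<in> A \<Longrightarrow> \<delta> \<le> norm (w - of_real x)"
  shows "DERIV (\<lambda>w. LINT x:A|M. g x / (w - of_real x)) w :> - (LINT x:A|M. g x / (w - of_real x)\<^sup>2)"
    and "set_integrable M A (\<lambda>x. g x / (w - of_real x))"
    and "set_integrable M A (\<lambda>x. g x / (w - of_real x)\<^sup>2)"
proof -
  have Mb: "f \<in> borel_measurable M \<longleftrightarrow> f \<in> borel_measurable borel" for f :: "real \<Rightarrow> complex"
    by (rule arg_cong[where f = "\<lambda>S. f \<in> S"], rule measurable_cong_sets[OF M refl])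
  have [measurable]: "(\<lambda>x. indicator A x *\<^sub>R g x) \<in> borel_measurable borel"
    by (rule Mb[THEN iffD1, OF borel_measurable_integrable[OF g[unfolded set_integrable_def]]])
  have AM: "A \<in> sets M" using A M by simp
  have bint: "set_integrable M A (\<lambda>x. g x * h x)"
    if h: "h \<in> borel_measurable borel" "\<And>x. x \<in> A \<Longrightarrow> norm (h x) \<le> C" for h :: "real \<Rightarrow> complex" and C :: real
  proof (rule set_integrable_bound[OF set_integrable_mult_right[OF g, of "of_real C"]])
    have "(\<lambda>x. (indicator A x *\<^sub>R g x) * h x) \<in> borel_measurable borel"
      using h(1) by measurable
    then show "set_borel_measurable M A (\<lambda>x. g x * h x)"
      unfolding set_borel_measurable_def Mb by simp
    have "norm (g x * h x) \<le> norm (of_real C * g x)" if "x \<in> A" for x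
      using mult_right_mono[of "norm (h x)" "\<bar>C\<bar>" "norm (g x)"] h(2)[OF that]
      by (simp add: norm_mult mult.commute)
    then show "AE x in M. x \<in> A \<longrightarrow> norm (g x * h x) \<le> norm (of_real C * g x)"
      by simp
  qed
  have i1: "set_integrable M A (\<lambda>x. g x / (u - of_real x))" if "norm (u - w) \<le> \<delta> / 2" for u
  proof -
    have "norm (1 / (u - of_real x)) \<le> 2 / \<delta>" if "x \<in> A" for x
    proof -
      have far: "\<delta> / 2 \<le> norm (u - of_real x)"
        using \<delta>(2)[OF that] norm_triangle_ineq[of "u - of_real x" "w - u"] \<open>norm (u - w) \<le> \<delta> / 2\<close>
        by (simp add: norm_minus_commute)
      then have "1 / norm (u - of_real x) \<le> 1 / (\<delta> / 2)"
        by (intro divide_left_mono mult_pos_pos far) (use \<delta>(1) far in linarith)+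
      then show ?thesis by (simp add: norm_divide)
    qed
    then show ?thesis using bint[of "\<lambda>x. 1 / (u - of_real x)" "2 / \<delta>"] by simp
  qed
  show "set_integrable M A (\<lambda>x. g x / (w - of_real x))" by (rule i1) (use \<delta> in simp)
  have b2: "norm (1 / (w - of_real x)\<^sup>2) \<le> 1 / \<delta>\<^sup>2" if "x \<in> A" for x
    using \<delta>(2)[OF that] \<delta>(1) by (simp add: norm_divide norm_power frac_le power_mono)
  have i2: "set_integrable M A (\<lambda>x. g x / (w - of_real x)\<^sup>2)"
    using bint[OF _ b2] by simp
  then show "set_integrable M A (\<lambda>x. g x / (w - of_real x)\<^sup>2)" .
  define B where "B = (LINT x:A|M. norm (g x)) * (2 / \<delta>^3)"
  let ?F = "\<lambda>w. LINT x:A|M. g x / (w - of_real x)"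
  have est: "norm ((?F (w + h) - ?F w) / h - - (LINT x:A|M. g x / (w - of_real x)\<^sup>2)) \<le> B * norm h"
    if h: "h \<noteq> 0" "norm h < \<delta> / 2" for h
  proof -
    have ih: "set_integrable M A (\<lambda>x. g x / (w + h - of_real x))" by (rule i1) (use h in simp)
    have far: "\<delta> / 2 \<le> norm (w + h - of_real x)" if "x \<in> A" for x
      using \<delta>(2)[OF that] norm_triangle_ineq[of "w + h - of_real x" "- h"] h by simp
    have alg: "(g x / (w + h - of_real x) - g x / (w - of_real x)) / h + g x / (w - of_real x)\<^sup>2 =
        g x * (h / ((w - of_real x)\<^sup>2 * (w + h - of_real x)))" if "x \<in> A" for x
    proof -
      have "w + h - of_real x \<noteq> 0" "w - of_real x \<noteq> 0" using far[OF that] \<delta>(2)[OF that] \<delta>(1) by auto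
      then show ?thesis using h(1) by (simp add: divide_simps) (simp add: algebra_simps power2_eq_square)
    qed
    have "(?F (w + h) - ?F w) / h - - (LINT x:A|M. g x / (w - of_real x)\<^sup>2) =
        (LINT x:A|M. (g x / (w + h - of_real x) - g x / (w - of_real x)) / h + g x / (w - of_real x)\<^sup>2)"
      using set_integral_add(2)[OF set_integrable_divide[OF set_integral_diff(1)[OF ih i1[of w]], of h] i2]
        set_integral_diff(2)[OF ih i1[of w]] \<delta>(1) by simp
    also have "\<dots> = (LINT x:A|M. g x * (h / ((w - of_real x)\<^sup>2 * (w + h - of_real x))))"
      by (rule set_lebesgue_integral_cong) (use AM alg in auto)
    finally have eq: "(?F (w + h) - ?F w) / h - - (LINT x:A|M. g x / (w - of_real x)\<^sup>2) =
        (LINT x:A|M. g x * (h / ((w - of_real x)\<^sup>2 * (w + h - of_real x))))" .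
    have hb: "norm (h / ((w - of_real x)\<^sup>2 * (w + h - of_real x))) \<le> 2 / \<delta>^3 * norm h" if "x \<in> A" for x
    proof -
      have "\<delta>\<^sup>2 * (\<delta> / 2) \<le> norm (w - of_real x)^2 * norm (w + h - of_real x)"
        using \<delta>(2)[OF that] far[OF that] \<delta>(1) by (intro mult_mono power_mono) auto
      then have "norm h / (norm (w - of_real x)^2 * norm (w + h - of_real x)) \<le> norm h / (\<delta>\<^sup>2 * (\<delta> / 2))"
        using \<delta>(1) frac_le[of "norm h" "norm h" "\<delta>\<^sup>2 * (\<delta> / 2)"] by simp
      then show ?thesis by (simp add: norm_divide norm_mult norm_power power3_eq_cube power2_eq_square mult_ac)
    qed
    have "norm (LINT x:A|M. g x * (h / ((w - of_real x)\<^sup>2 * (w + h - of_real x)))) \<le>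
        (LINT x:A|M. norm (g x) * (2 / \<delta>^3 * norm h))"
      unfolding set_lebesgue_integral_def
    proof (rule Bochner_Integration.integral_norm_bound_integral)
      show "integrable M (\<lambda>x. indicator A x *\<^sub>R (g x * (h / ((w - of_real x)\<^sup>2 * (w + h - of_real x)))))"
        using bint[OF _ hb] by (simp add: set_integrable_def)
      show "integrable M (\<lambda>x. indicator A x *\<^sub>R (norm (g x) * (2 / \<delta>^3 * norm h)))"
        using integrable_mult_left[OF integrable_norm[OF g[unfolded set_integrable_def]], of "2 / \<delta>^3 * norm h"]
        by (simp add: mult.assoc del: times_divide_eq_right times_divide_eq_left)
      fix x show "norm (indicator A x *\<^sub>R (g x * (h / ((w - of_real x)\<^sup>2 * (w + h - of_real x))))) \<le>
          indicator A x *\<^sub>R (norm (g x) * (2 / \<delta>^3 * norm h))"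
        using hb[of x] by (cases "x \<in> A") (auto simp: norm_mult intro!: mult_left_mono simp del: times_divide_eq_right)
    qed
    also have "\<dots> = B * norm h" by (simp add: B_def)
    finally show ?thesis unfolding eq .
  qed
  show "DERIV ?F w :> - (LINT x:A|M. g x / (w - of_real x)\<^sup>2)"
    unfolding DERIV_def
  proof (rule Lim_transform_bound[THEN LIM_zero_cancel, rotated])
    show "((\<lambda>h. B * norm h) \<longlongrightarrow> 0) (at (0::complex))"
      by (auto intro!: tendsto_eq_intros)
    have "eventually (\<lambda>h. h \<noteq> 0 \<and> norm h < \<delta> / 2) (at (0::complex))"
      unfolding eventually_at using \<delta>(1) by (intro exI[of _ "\<delta> / 2"]) auto
    then show "\<forall>\<^sub>F h in at 0. norm ((?F (w + h) - ?F w) / h - - (LINT x:A|M. g x / (w - of_real x)\<^sup>2)) \<le> norm (B * norm h)"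
      by eventually_elim (use est abs_ge_self order_trans in fastforce)
  qed
qed

text \<open>A point off the closed set C has positive distance from the image of A, so the
  derivative formula applies there. The transform with the squared kernel is minus a derivative of a
  holomorphic function, which gives its continuity.\<close>

lemma holomorphic_cauchy_transform:
  fixes g :: "real \<Rightarrow> complex"
  assumes g: "set_integrable M A g" and M: "sets M = sets borel" and A: "A \<in> sets borel"
    and C: "closed C" "of_real ` A \<subseteq> C"
  shows "(\<lambda>w. LINT x:A|M. g x / (w - of_real x)) holomorphic_on - C"
    and "continuous_on (- C) (\<lambda>w. LINT x:A|M. g x / (w - of_real x)\<^sup>2)"
proof -
  let ?F = "\<lambda>w. LINT x:A|M. g x / (w - of_real x)"
  have D: "DERIV ?F w :> - (LINT x:A|M. g x / (w - of_real x)\<^sup>2)" if w: "w \<in> - C" for w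
  proof -
    obtain \<delta> where \<delta>: "\<delta> > 0" "ball w \<delta> \<subseteq> - C"
      using C(1) w open_contains_ball by (metis open_Compl)
    show ?thesis
    proof (rule DERIV_cauchy_transform(1)[OF g M A \<delta>(1)])
      fix x assume "x \<in> A"
      then have "complex_of_real x \<notin> ball w \<delta>" using C(2) \<delta>(2) by blast
      then show "\<delta> \<le> norm (w - of_real x)" by (simp add: dist_norm)
    qed
  qed
  have op: "open (- C)" using C(1) by (rule open_Compl)
  show hol: "?F holomorphic_on - C"
    using D by (auto simp: holomorphic_on_open[OF op])
  have "deriv ?F holomorphic_on - C" by (rule holomorphic_deriv[OF hol op])
  then have "continuous_on (- C) (\<lambda>w. - deriv ?F w)"
    by (intro continuous_on_minus holomorphic_on_imp_continuous_on)
  then show "continuous_on (- C) (\<lambda>w. LINT x:A|M. g x / (w - of_real x)\<^sup>2)"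
    by (rule continuous_on_eq) (simp add: DERIV_imp_deriv[OF D])
qed

text \<open>The primitive arctan((x - u) / |v|) varies by at most pi, whatever u and v are. This
  uniformity is the source of the bound of order 1 / |Im w| for transforms of a bounded density with
  the squared kernel.\<close>

lemma poisson_kernel_integral_le:
  assumes v: "v \<noteq> 0" and ab: "a \<le> b"
  shows "(LBINT x:{a..b}. \<bar>v\<bar> / ((x - u)\<^sup>2 + v\<^sup>2)) \<le> pi"
    and "set_integrable lborel {a..b} (\<lambda>x. \<bar>v\<bar> / ((x - u)\<^sup>2 + v\<^sup>2))"
proof -
  let ?F = "\<lambda>x. arctan ((x - u) / \<bar>v\<bar>)"
  have pos: "(x - u)\<^sup>2 + v\<^sup>2 > 0" for x using v by (simp add: sum_power2_gt_zero_iff)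
  show int: "set_integrable lborel {a..b} (\<lambda>x. \<bar>v\<bar> / ((x - u)\<^sup>2 + v\<^sup>2))"
    by (intro set_integrable_continuous continuous_intros ballI) (metis pos less_irrefl)
  have D: "DERIV ?F x :> \<bar>v\<bar> / ((x - u)\<^sup>2 + v\<^sup>2)" for x
  proof -
    have "DERIV ?F x :> inverse (1 + ((x - u) / \<bar>v\<bar>)\<^sup>2) * (1 / \<bar>v\<bar>)"
      by (rule DERIV_chain2[OF DERIV_arctan]) (rule DERIV_cdivide[OF DERIV_diff[OF DERIV_ident DERIV_const], THEN DERIV_cong], simp)
    also have "inverse (1 + ((x - u) / \<bar>v\<bar>)\<^sup>2) * (1 / \<bar>v\<bar>) = \<bar>v\<bar> / ((x - u)\<^sup>2 + v\<^sup>2)"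
    proof -
      have "inverse (1 + ((x - u) / y)\<^sup>2) * (1 / y) = y / ((x - u)\<^sup>2 + y\<^sup>2)" if "y > 0" for y
      proof -
        have "1 + ((x - u) / y)\<^sup>2 = ((x - u)\<^sup>2 + y\<^sup>2) / y\<^sup>2"
          using that by (simp add: power_divide field_simps)
        then show ?thesis using that by (simp add: power2_eq_square)
      qed
      from this[of "\<bar>v\<bar>"] v show ?thesis by (simp only: power2_abs zero_less_abs_iff) simp
    qed
    finally show ?thesis .
  qed
  have "(LBINT x:{a..b}. \<bar>v\<bar> / ((x - u)\<^sup>2 + v\<^sup>2)) = ?F b - ?F a"
  proof (rule set_integral_FTC[OF ab _ finite.emptyI _ int])
    show "continuous_on {a..b} ?F" using D DERIV_isCont by (blast intro: continuous_at_imp_continuous_on)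
    fix x show "(?F has_vector_derivative \<bar>v\<bar> / ((x - u)\<^sup>2 + v\<^sup>2)) (at x)"
      using D[of x] by (simp only: has_real_derivative_iff_has_vector_derivative)
  qed
  also have "\<dots> \<le> pi"
    using arctan_bounded[of "(b - u) / \<bar>v\<bar>"] arctan_bounded[of "(a - u) / \<bar>v\<bar>"] by linarith
  finally show "(LBINT x:{a..b}. \<bar>v\<bar> / ((x - u)\<^sup>2 + v\<^sup>2)) \<le> pi" .
qed

section \<open>The excess of a diagram outside the segment\<close>

definition diam_circle :: "real \<Rightarrow> real \<Rightarrow> real \<Rightarrow> complex" where
  "diam_circle p q \<theta> = of_real ((p + q) / 2) + of_real ((q - p) / 2) * cis \<theta>"

text \<open>Vanishes at the two points where the circle over [p,q] meets the real axis and so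
  compensates singularities of order 1 / |Im w| there.\<close>

definition end_weight :: "real \<Rightarrow> real \<Rightarrow> complex \<Rightarrow> complex" where
  "end_weight p q w = (w - of_real p) * (w - of_real q)"

text \<open>Derivative in t of \<open>diam_circle p q (2 * pi * t)\<close>.\<close>

definition diam_speed :: "real \<Rightarrow> real \<Rightarrow> real \<Rightarrow> complex" where
  "diam_speed p q t = of_real (pi * (q - p)) * \<i> * cis (2 * pi * t)"

lemma diam_circle_Re: "Re (diam_circle p q \<theta>) = (p + q) / 2 + (q - p) / 2 * cos \<theta>"
  and diam_circle_Im: "Im (diam_circle p q \<theta>) = (q - p) / 2 * sin \<theta>"
  by (simp_all add: diam_circle_def)

text \<open>Thales: w, p and q form a right triangle, and |w - p| |w - q| is twice its area, as is
  (q - p) |Im w|.\<close>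

lemma norm_end_weight_diam_circle:
  assumes "p \<le> q"
  shows "norm (end_weight p q (diam_circle p q \<theta>)) = (q - p) * \<bar>Im (diam_circle p q \<theta>)\<bar>"
proof -
  let ?r = "(q - p) / 2"
  have "diam_circle p q \<theta> - of_real p = of_real ?r * (cis \<theta> + 1)"
    "diam_circle p q \<theta> - of_real q = of_real ?r * (cis \<theta> - 1)"
    by (simp_all add: diam_circle_def field_simps)
  then have "end_weight p q (diam_circle p q \<theta>) = of_real ?r * (cis \<theta> + 1) * (of_real ?r * (cis \<theta> - 1))"
    by (simp only: end_weight_def)
  also have "\<dots> = of_real ?r * of_real ?r * cis \<theta> * (cis \<theta> - cis (- \<theta>))"
  proof -
    have gen: "r * (c + 1) * (r * (c - 1)) = r * r * c * (c - d)" if "c * d = 1" for r c d :: complex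
      using that by algebra
    show ?thesis by (rule gen) (simp add: cis_mult)
  qed
  also have "cis \<theta> - cis (- \<theta>) = 2 * \<i> * of_real (sin \<theta>)"
    by (simp add: complex_eq_iff)
  finally have eq: "end_weight p q (diam_circle p q \<theta>) =
      of_real ?r * of_real ?r * cis \<theta> * (2 * \<i> * of_real (sin \<theta>))" .
  show ?thesis
    unfolding eq using assms
    by (simp only: norm_mult norm_of_real norm_cis norm_ii norm_numeral) (simp add: diam_circle_Im abs_mult)
qed

lemma circlepath_diam_circle:
  "circlepath (of_real ((p + q) / 2)) ((q - p) / 2) t = diam_circle p q (2 * pi * t)"
  by (simp add: circlepath diam_circle_def cis_conv_exp mult_ac)

lemma continuous_on_diam_circle [continuous_intros]:
  "continuous_on S f \<Longrightarrow> continuous_on S (\<lambda>x. diam_circle p q (f x))"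
  unfolding diam_circle_def by (intro continuous_intros)

lemma norm_diam_circle_minus: "norm (w - of_real x) ^ 2 = (x - Re w)\<^sup>2 + (Im w)\<^sup>2" for w :: complex
  by (simp add: cmod_power2) (simp add: power2_eq_square algebra_simps)

lemma contour_integral_diam_circle:
  assumes "(f has_contour_integral I) (circlepath (of_real ((p + q) / 2)) ((q - p) / 2))"
    and f: "continuous_on {0..1} (\<lambda>t. f (diam_circle p q (2 * pi * t)))"
  shows "(LBINT t:{0..1}. f (diam_circle p q (2 * pi * t)) * diam_speed p q t) = I"
    and "set_integrable lborel {0..1} (\<lambda>t. f (diam_circle p q (2 * pi * t)) * diam_speed p q t)"
proof -
  let ?h = "\<lambda>t. f (diam_circle p q (2 * pi * t)) * diam_speed p q t"
  show int: "set_integrable lborel {0..1} ?h"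
    unfolding diam_speed_def by (intro set_integrable_continuous continuous_intros f)
  have "(?h has_integral I) {0..1}"
    using assms(1) unfolding has_contour_integral_def
  proof (rule has_integral_eq[rotated])
    fix t :: real assume "t \<in> {0..1}"
    then have vd: "vector_derivative (circlepath (of_real ((p + q) / 2)) ((q - p) / 2)) (at t within {0..1}) = diam_speed p q t"
      by (simp add: vector_derivative_circlepath01 diam_speed_def cis_conv_exp mult_ac)
    show "f (circlepath (of_real ((p + q) / 2)) ((q - p) / 2) t) *
        vector_derivative (circlepath (of_real ((p + q) / 2)) ((q - p) / 2)) (at t within {0..1}) = ?h t"
      unfolding vd circlepath_diam_circle ..
  qed
  then show "(LBINT t:{0..1}. ?h t) = I"
    using set_borel_integral_eq_integral(2)[OF int] by (simp add: integral_unique)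
qed

text \<open>A double pole picks out the derivative of the numerator, and (w - p)(w - q) has
  derivative 2x - p - q at x. If x lies outside, the integrand is holomorphic in a concentric disc
  reaching up to x, and the integral is 0.\<close>

lemma end_weight_double_pole:
  assumes pq: "p < q" and x: "x \<noteq> p" "x \<noteq> q"
  shows "(LBINT t:{0..1}. end_weight p q (diam_circle p q (2 * pi * t)) / (diam_circle p q (2 * pi * t) - of_real x)\<^sup>2 *
      diam_speed p q t) =
      (if p < x \<and> x < q then 2 * pi * \<i> * of_real (2 * x - p - q) else 0)"
proof -
  let ?c = "complex_of_real ((p + q) / 2)" and ?r = "(q - p) / 2"
  let ?f = "\<lambda>w. end_weight p q w / (w - of_real x)\<^sup>2"
  have off: "diam_circle p q \<theta> \<noteq> of_real x" for \<theta>
  proof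
    assume "diam_circle p q \<theta> = of_real x"
    then have "of_real x - ?c = of_real ?r * cis \<theta>"
      by (metis diam_circle_def add_diff_cancel_left')
    then have "norm (of_real x - ?c) = ?r" using pq by (simp only: norm_mult norm_cis norm_of_real) simp
    then have "\<bar>x - (p + q) / 2\<bar> = ?r" by (simp only: of_real_diff[symmetric] norm_of_real)
    then show False using x by (auto simp: abs_if field_simps split: if_splits)
  qed
  have cont: "continuous_on {0..1} (\<lambda>t. ?f (diam_circle p q (2 * pi * t)))"
    unfolding end_weight_def by (intro continuous_intros) (use off in auto)
  show ?thesis
  proof (cases "p < x \<and> x < q")
    case True
    have inball: "of_real x \<in> ball ?c ?r"
    proof -
      have "norm (?c - of_real x) = \<bar>(p + q) / 2 - x\<bar>"
        by (simp only: of_real_diff[symmetric] norm_of_real)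
      also have "\<dots> < ?r" using True by (auto simp: abs_if field_simps)
      finally show ?thesis by (simp add: dist_norm)
    qed
    have ce: "continuous_on (cball ?c ?r) (end_weight p q)" "end_weight p q holomorphic_on ball ?c ?r"
      unfolding end_weight_def by (auto intro!: continuous_intros holomorphic_intros)
    note cd = Cauchy_derivative_integral_circlepath[OF ce inball]
    have "DERIV (end_weight p q) (of_real x) :> of_real (2 * x - p - q)"
      unfolding end_weight_def by (auto intro!: derivative_eq_intros)
    from DERIV_unique[OF cd(2) this]
    have "contour_integral (circlepath ?c ?r) ?f = 2 * pi * \<i> * of_real (2 * x - p - q)"
      by (simp add: field_simps)
    with has_contour_integral_integral[OF cd(1)]
    have "(?f has_contour_integral 2 * pi * \<i> * of_real (2 * x - p - q)) (circlepath ?c ?r)" by simp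
    then show ?thesis using contour_integral_diam_circle(1)[OF _ cont] True by auto
  next
    case False
    \<comment> \<open>Radius of the concentric disc that has x on its boundary; it exceeds the
      radius of the circle because x is neither inside nor an end point.\<close>
    define e where "e = \<bar>x - (p + q) / 2\<bar>"
    have e: "?r < e" using False x by (auto simp: e_def abs_if field_simps)
    have xe: "of_real x \<notin> ball ?c e"
    proof -
      have "dist ?c (of_real x) = \<bar>(p + q) / 2 - x\<bar>"
        by (simp only: dist_norm of_real_diff[symmetric] norm_of_real)
      then show ?thesis by (simp add: e_def)
    qed
    have "(?f has_contour_integral 0) (circlepath ?c ?r)"
    proof (rule Cauchy_theorem_convex_simple)
      show "?f holomorphic_on ball ?c e"
        unfolding end_weight_def by (intro holomorphic_intros) (use xe in auto)
      show "path_image (circlepath ?c ?r) \<subseteq> ball ?c e" using e pq by auto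
    qed auto
    then show ?thesis using contour_integral_diam_circle(1)[OF _ cont] False by auto
  qed
qed

text \<open>The integrand over t and x is singular where the circle crosses the real axis. The
  Poisson bound makes the inner absolute integral at most S pi / |Im w|, and the end weight
  contributes a factor proportional to |Im w|, so the double integral converges absolutely and
  Fubini applies.\<close>

lemma end_weight_swap:
  fixes s :: "real \<Rightarrow> real"
  assumes pq: "p < q" and [measurable]: "s \<in> borel_measurable borel"
    and s: "\<And>x. \<bar>s x\<bar> \<le> S" and R: "0 < R"
  defines "w \<equiv> \<lambda>t. diam_circle p q (2 * pi * t)"
  defines "h \<equiv> \<lambda>t. end_weight p q (w t) * diam_speed p q t"
  shows "set_integrable lborel {0..1} (\<lambda>t. h t * (LBINT x:{-R..R}. of_real (s x) / (w t - of_real x)\<^sup>2))"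
    and "(LBINT t:{0..1}. h t * (LBINT x:{-R..R}. of_real (s x) / (w t - of_real x)\<^sup>2)) =
      (LBINT x:{-R..R}. of_real (s x) * (if p < x \<and> x < q then 2 * pi * \<i> * of_real (2 * x - p - q) else 0))"
    and "\<And>t. t \<in> {0..1} \<Longrightarrow> t \<notin> {0, 1/2, 1} \<Longrightarrow>
      norm (LBINT x:{-R..R}. of_real (s x) / (w t - of_real x)\<^sup>2) \<le> S * pi / \<bar>Im (w t)\<bar>"
proof -
  have "continuous_on UNIV w" unfolding w_def by (intro continuous_intros)
  then have [measurable]: "w \<in> borel_measurable borel" by (rule borel_measurable_continuous_onI)
  have "continuous_on UNIV h" unfolding h_def diam_speed_def end_weight_def w_def by (intro continuous_intros)
  then have [measurable]: "h \<in> borel_measurable borel" by (rule borel_measurable_continuous_onI)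
  define f where "f = (\<lambda>t x. (indicator {0..1} t * indicator {-R..R} x :: real) *\<^sub>R (h t * (of_real (s x) / (w t - of_real x)\<^sup>2)))"
  have fm: "(\<lambda>(t, x). f t x) \<in> borel_measurable (lborel \<Otimes>\<^sub>M lborel)"
    unfolding f_def by measurable
  have S0: "0 \<le> S" using s[of 0] by linarith
  define K where "K = (q - p) * (pi * (q - p)) * S"
  have sin0: "sin (2 * pi * t) \<noteq> 0" if "t \<in> {0..1}" "t \<notin> {0, 1/2, 1}" for t :: real
  proof
    assume "sin (2 * pi * t) = 0"
    then obtain i :: int where i: "2 * pi * t = of_int i * pi" unfolding sin_zero_iff_int2 by auto
    then have "2 * t = of_int i" by simp
    moreover from this have "i \<in> {0..2}" using that(1) by auto
    then have "i = 0 \<or> i = 1 \<or> i = 2" by auto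
    ultimately show False using that(2) by auto
  qed
  have Im0: "Im (w t) \<noteq> 0" if "t \<in> {0..1}" "t \<notin> {0, 1/2, 1}" for t
    using sin0[OF that] pq by (simp add: w_def diam_circle_Im)
  have nh: "norm (h t) = (q - p) * (pi * (q - p)) * \<bar>Im (w t)\<bar>" for t
    unfolding h_def norm_mult using norm_end_weight_diam_circle[of p q] pq
    by (simp add: w_def diam_speed_def norm_mult flip: of_real_diff)
  have pk: "norm (of_real (s x) / (w t - of_real x)\<^sup>2) \<le> S * (1 / \<bar>Im (w t)\<bar>) * (\<bar>Im (w t)\<bar> / ((x - Re (w t))\<^sup>2 + (Im (w t))\<^sup>2))"
    if "Im (w t) \<noteq> 0" for t x
    using s[of x] that
    by (simp add: norm_divide norm_power norm_diam_circle_minus divide_right_mono)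
  have R': "-R \<le> R" using R by simp
  note po = poisson_kernel_integral_le[OF _ R']
  have integr: "set_integrable lborel {-R..R} (\<lambda>x. of_real (s x) / (w t - of_real x)\<^sup>2)" if "Im (w t) \<noteq> 0" for t
  proof (rule set_integrable_bound[OF set_integrable_mult_right[OF po(2)[OF that, of "Re (w t)"], of "S * (1 / \<bar>Im (w t)\<bar>)"]])
    show "set_borel_measurable lborel {-R..R} (\<lambda>x. of_real (s x) / (w t - of_real x)\<^sup>2)"
      unfolding set_borel_measurable_def by measurable
    show "AE x in lborel. x \<in> {-R..R} \<longrightarrow> norm (of_real (s x) / (w t - of_real x)\<^sup>2) \<le>
        norm (S * (1 / \<bar>Im (w t)\<bar>) * (\<bar>Im (w t)\<bar> / ((x - Re (w t))\<^sup>2 + (Im (w t))\<^sup>2)))"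
      by (intro AE_I2 impI) (simp only: real_norm_def, rule order_trans[OF pk[OF that] abs_ge_self])
  qed
  have nint: "(LBINT x:{-R..R}. norm (of_real (s x) / (w t - of_real x)\<^sup>2)) \<le> S * pi / \<bar>Im (w t)\<bar>"
    if "Im (w t) \<noteq> 0" for t
  proof -
    have "(LBINT x:{-R..R}. norm (of_real (s x) / (w t - of_real x)\<^sup>2)) \<le>
        (LBINT x:{-R..R}. S * (1 / \<bar>Im (w t)\<bar>) * (\<bar>Im (w t)\<bar> / ((x - Re (w t))\<^sup>2 + (Im (w t))\<^sup>2)))"
      by (intro set_integral_mono set_integrable_norm integr that set_integrable_mult_right po(2) pk)
    also have "\<dots> = S * (1 / \<bar>Im (w t)\<bar>) * (LBINT x:{-R..R}. \<bar>Im (w t)\<bar> / ((x - Re (w t))\<^sup>2 + (Im (w t))\<^sup>2))"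
      by (rule set_integral_mult_right)
    also have "\<dots> \<le> S * (1 / \<bar>Im (w t)\<bar>) * pi"
      by (intro mult_left_mono po(1) that) (use S0 in auto)
    finally show ?thesis by simp
  qed
  show "norm (LBINT x:{-R..R}. of_real (s x) / (w t - of_real x)\<^sup>2) \<le> S * pi / \<bar>Im (w t)\<bar>"
    if "t \<in> {0..1}" "t \<notin> {0, 1/2, 1}" for t
    using set_integral_norm_bound[OF integr[OF Im0[OF that]]] nint[OF Im0[OF that]] by linarith
  \<comment> \<open>The parameters at which the circle is real: the right end point for t = 0 and t
    = 1, the left one for t = 1/2.\<close>
  have ae: "AE t in lborel. t \<notin> {0, 1/2, 1::real}"
    using AE_lborel_singleton[of 0] AE_lborel_singleton[of "1/2::real"] AE_lborel_singleton[of "1::real"]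
    by eventually_elim auto
  have fn: "(LBINT x. norm (f t x)) = indicator {0..1} t * (norm (h t) * (LBINT x:{-R..R}. norm (of_real (s x) / (w t - of_real x)\<^sup>2)))" for t
  proof -
    have "norm (f t x) = indicator {0..1} t * (norm (h t) * (indicator {-R..R} x *\<^sub>R norm (of_real (s x) / (w t - of_real x)\<^sup>2)))" for x
      unfolding f_def by (simp only: norm_scaleR norm_mult abs_mult abs_indicator real_scaleR_def mult_ac)
    then show ?thesis by (simp only: integral_mult_right_zero set_lebesgue_integral_def)
  qed
  have fst: "integrable lborel (\<lambda>t. LBINT x. norm (case (t, x) of (t, x) \<Rightarrow> f t x))"
  proof (rule Bochner_Integration.integrable_bound[where f = "\<lambda>t. indicator {0..1::real} t *\<^sub>R (K * pi)"])
    show "integrable lborel (\<lambda>t. indicator {0..1::real} t *\<^sub>R (K * pi))"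
      by (rule integrable_scaleR_left) (auto intro: integrable_real_indicator)
    show "(\<lambda>t. LBINT x. norm (case (t, x) of (t, x) \<Rightarrow> f t x)) \<in> borel_measurable lborel"
      using fm by (intro lborel.borel_measurable_lebesgue_integral) (simp add: case_prod_beta')
    show "AE t in lborel. norm (LBINT x. norm (case (t, x) of (t, x) \<Rightarrow> f t x)) \<le> norm (indicator {0..1::real} t *\<^sub>R (K * pi))"
      using ae
    proof eventually_elim
      fix t :: real assume t: "t \<notin> {0, 1/2, 1}"
      show "norm (LBINT x. norm (case (t, x) of (t, x) \<Rightarrow> f t x)) \<le> norm (indicator {0..1::real} t *\<^sub>R (K * pi))"
      proof (cases "t \<in> {0..1}")
        case True
        have "norm (h t) * (LBINT x:{-R..R}. norm (of_real (s x) / (w t - of_real x)\<^sup>2)) \<le>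
            norm (h t) * (S * pi / \<bar>Im (w t)\<bar>)"
          by (intro mult_left_mono nint Im0 True t) auto
        also have "\<dots> = K * pi" using Im0[OF True t] by (simp add: nh K_def)
        finally have "(LBINT x. norm (f t x)) \<le> K * pi" using True by (simp add: fn)
        moreover have "0 \<le> (LBINT x. norm (f t x))" by (rule Bochner_Integration.integral_nonneg) simp
        ultimately show ?thesis using True by simp
      qed (simp add: fn)
    qed
  qed
  have snd: "AE t in lborel. integrable lborel (\<lambda>x. case (t, x) of (t, x) \<Rightarrow> f t x)"
    using ae
  proof eventually_elim
    fix t :: real assume t: "t \<notin> {0, 1/2, 1}"
    show "integrable lborel (\<lambda>x. case (t, x) of (t, x) \<Rightarrow> f t x)"
    proof (cases "t \<in> {0..1}")
      case True
      have "set_integrable lborel {-R..R} (\<lambda>x. h t * (of_real (s x) / (w t - of_real x)\<^sup>2))"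
        by (intro set_integrable_mult_right integr Im0 True t)
      then show ?thesis using True by (simp add: f_def set_integrable_def)
    qed (simp add: f_def)
  qed
  have int: "integrable (lborel \<Otimes>\<^sub>M lborel) (\<lambda>(t, x). f t x)"
    by (rule lborel_pair.Fubini_integrable[OF fm fst snd])
  have inner: "(LBINT x. f t x) = indicator {0..1} t *\<^sub>R (h t * (LBINT x:{-R..R}. of_real (s x) / (w t - of_real x)\<^sup>2))" for t
    unfolding set_integral_mult_right[symmetric] unfolding set_lebesgue_integral_def f_def
    by (simp flip: integral_scaleR_right)
  show "set_integrable lborel {0..1} (\<lambda>t. h t * (LBINT x:{-R..R}. of_real (s x) / (w t - of_real x)\<^sup>2))"
    using lborel_pair.integrable_fst'[OF int] by (simp add: set_integrable_def inner)
  have "(LBINT t:{0..1}. h t * (LBINT x:{-R..R}. of_real (s x) / (w t - of_real x)\<^sup>2)) = (LBINT t. LBINT x. f t x)"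
    by (simp add: inner set_lebesgue_integral_def)
  also have "\<dots> = (LBINT x. LBINT t. f t x)"
    by (rule lborel_pair.Fubini_integral[OF int, symmetric])
  also have "\<dots> = (LBINT x:{-R..R}. of_real (s x) * (if p < x \<and> x < q then 2 * pi * \<i> * of_real (2 * x - p - q) else 0))"
    unfolding set_lebesgue_integral_def
  proof (rule integral_cong_AE)
    show "(\<lambda>x. LBINT t. f t x) \<in> borel_measurable lborel"
      by (rule borel_measurable_integrable[OF lborel_pair.integrable_snd[OF int]])
    show "(\<lambda>x. indicator {-R..R} x *\<^sub>R (complex_of_real (s x) * (if p < x \<and> x < q then 2 * pi * \<i> * of_real (2 * x - p - q) else 0))) \<in> borel_measurable lborel"
      by measurable
    have "AE x in lborel. x \<noteq> p \<and> x \<noteq> q"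
      using AE_lborel_singleton[of p] AE_lborel_singleton[of q] by eventually_elim auto
    then show "AE x in lborel. (LBINT t. f t x) = indicator {-R..R} x *\<^sub>R (complex_of_real (s x) * (if p < x \<and> x < q then 2 * pi * \<i> * of_real (2 * x - p - q) else 0))"
    proof eventually_elim
      fix x assume x: "x \<noteq> p \<and> x \<noteq> q"
      have "(LBINT t. f t x) = indicator {-R..R} x *\<^sub>R (of_real (s x) * (LBINT t:{0..1}. end_weight p q (w t) / (w t - of_real x)\<^sup>2 *
          diam_speed p q t))"
        unfolding set_lebesgue_integral_def f_def h_def
        by (simp flip: integral_scaleR_right integral_mult_right_zero) (simp add: mult_ac)
      then show "(LBINT t. f t x) = indicator {-R..R} x *\<^sub>R (complex_of_real (s x) * (if p < x \<and> x < q then 2 * pi * \<i> * of_real (2 * x - p - q) else 0))"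
        unfolding w_def using end_weight_double_pole[OF pq] x by simp
    qed
  qed
  finally show "(LBINT t:{0..1}. h t * (LBINT x:{-R..R}. of_real (s x) / (w t - of_real x)\<^sup>2)) =
      (LBINT x:{-R..R}. of_real (s x) * (if p < x \<and> x < q then 2 * pi * \<i> * of_real (2 * x - p - q) else 0))" .
qed

section \<open>A single diagram and its measure near the right end of [-2,2]\<close>

lemma norm_cauchy_transform_le:
  fixes w :: complex
  assumes "finite_measure M" and M: "sets M = sets borel" and A: "A \<in> sets borel"
    and \<delta>: "\<delta> > 0" "\<And>x. x \<in> A \<Longrightarrow> \<delta> \<le> norm (w - of_real x)"
  shows "set_integrable M A (\<lambda>x. 1 / (w - of_real x))"
    and "norm (LINT x:A|M. 1 / (w - of_real x)) \<le> measure M A / \<delta>"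
proof -
  interpret finite_measure M by fact
  have one: "set_integrable M A (\<lambda>_. 1 :: complex)" "set_integrable M A (\<lambda>_. 1 / \<delta> :: real)"
    using A M by (auto simp: set_integrable_def less_top[symmetric])
  show i: "set_integrable M A (\<lambda>x. 1 / (w - of_real x))"
    by (rule DERIV_cauchy_transform(2)[OF one(1) M A \<delta>])
  have "norm (LINT x:A|M. 1 / (w - of_real x)) \<le> (LINT x:A|M. norm (1 / (w - of_real x)))"
    by (rule set_integral_norm_bound[OF i])
  also have "\<dots> \<le> (LINT x:A|M. 1 / \<delta>)"
    by (intro set_integral_mono set_integrable_norm i one)
      (simp only: norm_divide norm_one, rule frac_le, use \<delta> in auto)
  also have "\<dots> = measure M A / \<delta>"
    using A M by (simp add: set_lebesgue_integral_def)
  finally show "norm (LINT x:A|M. 1 / (w - of_real x)) \<le> measure M A / \<delta>" .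
qed

lemma norm_Ln_le_add_inverse:
  assumes "z \<noteq> 0" shows "norm (Ln z) \<le> norm z + 1 / norm z + pi"
proof -
  have "norm (Ln z) \<le> \<bar>Re (Ln z)\<bar> + \<bar>Im (Ln z)\<bar>" by (rule cmod_le)
  moreover have "\<bar>Im (Ln z)\<bar> \<le> pi" using mpi_less_Im_Ln[OF assms] Im_Ln_le_pi[OF assms] by linarith
  moreover have "ln (norm z) \<le> norm z" using ln_le_minus_one[of "norm z"] assms by simp
  moreover have "- ln (norm z) \<le> 1 / norm z"
    using ln_le_minus_one[of "1 / norm z"] assms by (simp add: ln_div)
  moreover have "0 \<le> norm z" "0 \<le> 1 / norm z" by auto
  ultimately have "\<bar>ln (norm z)\<bar> \<le> norm z + 1 / norm z" "\<bar>Im (Ln z)\<bar> \<le> pi"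
      "norm (Ln z) \<le> \<bar>Re (Ln z)\<bar> + \<bar>Im (Ln z)\<bar>"
    by linarith+
  then show ?thesis unfolding Re_Ln[OF assms] by linarith
qed

text \<open>The Markov relation in the variable w = 1/z: the exponential of the point mass at the
  centre \<open>a\<close> has become the factor w - a, and \<open>\<sigma>\<close> is the excess
  over |x - a|. The conditions on \<open>R\<close> and \<open>a\<close> are normalisations, since R
  may be enlarged and the centres tend to 0.\<close>

locale markov_pair =
  fixes M :: "real measure" and \<sigma> :: "real \<Rightarrow> real" and a R S :: real
  assumes prob: "prob_space M" and sets_M: "sets M = sets borel"
    and \<sigma>_measurable: "\<sigma> \<in> borel_measurable borel"
    and \<sigma>_bounds: "\<And>x. 0 \<le> \<sigma> x" "\<And>x. \<sigma> x \<le> S"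
    and R: "3 \<le> R" and a: "\<bar>a\<bar> \<le> 1"
    and transform: "\<And>w :: complex. w \<notin> of_real ` {-R..R} \<Longrightarrow>
      exp (1 / 2 * (LBINT x:{-R..R}. of_real (\<sigma> x) / (w - of_real x)\<^sup>2)) =
      (w - of_real a) * (LINT x:{-R..R}|M. 1 / (w - of_real x))"

sublocale markov_pair \<subseteq> prob_space M by (rule prob)

context markov_pair
begin

declare \<sigma>_measurable [measurable]

definition Z :: "complex \<Rightarrow> complex" where
  "Z w = (LBINT x:{-R..R}. of_real (\<sigma> x) / (w - of_real x)\<^sup>2)"

definition G :: "real set \<Rightarrow> complex \<Rightarrow> complex" where
  "G A w = (LINT x:A|M. 1 / (w - of_real x))"

lemma S_nonneg: "0 \<le> S" using \<sigma>_bounds[of 0] by linarith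

lemma set_integrable_1: "A \<in> sets borel \<Longrightarrow> set_integrable M A (\<lambda>_. 1 :: complex)"
  using sets_M by (auto simp: set_integrable_def less_top[symmetric])

lemma set_integrable_\<sigma>: "set_integrable lborel {-R..R} (\<lambda>x. complex_of_real (\<sigma> x))"
  using set_integrable_mult_bounded[of lborel "{-R..R}" "\<lambda>_. 1" \<sigma> S] \<sigma>_bounds
  by (simp add: set_integrable_continuous)

lemma real_segment_separated:
  assumes "w \<notin> complex_of_real ` {-R..R}"
  obtains \<delta> where "\<delta> > 0" "\<And>x. x \<in> {-R..R} \<Longrightarrow> \<delta> \<le> norm (w - of_real x)"
proof -
  have "closed (complex_of_real ` {-R..R})"
    by (intro compact_imp_closed compact_continuous_image continuous_intros) auto
  from separate_point_closed[OF this assms] show thesis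
    using that by (auto simp: dist_norm)
qed

text \<open>The cut at 2 separates a part that is bounded away from 0 to the right of 2 from a part
  of small mass.\<close>

lemma G_split:
  assumes "w \<notin> of_real ` {-R..R}"
  shows "(LINT x:{-R..R}|M. 1 / (w - of_real x)) = G {-R..2} w + G {2<..R} w"
proof -
  obtain \<delta> where \<delta>: "\<delta> > 0" "\<And>x. x \<in> {-R..R} \<Longrightarrow> \<delta> \<le> norm (w - of_real x)"
    using real_segment_separated[OF assms] by blast
  have "set_integrable M {-R..2} (\<lambda>x. 1 / (w - of_real x))" "set_integrable M {2<..R} (\<lambda>x. 1 / (w - of_real x))"
    by (rule norm_cauchy_transform_le[OF finite_measure_axioms sets_M _ \<delta>(1)]; use R \<delta>(2) in auto)+
  then have "(LINT x:{-R..2} \<union> {2<..R}|M. 1 / (w - of_real x)) = G {-R..2} w + G {2<..R} w"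
    unfolding G_def by (intro set_integral_Un) auto
  moreover have "{-R..R} = {-R..2} \<union> {2<..R}" using R by auto
  ultimately show ?thesis by simp
qed

text \<open>The real part of 1 / (w - x) is (Re w - x) / |w - x|^2. The numerator is at least 2 - x,
  and the denominator is at most (3R)^2 + R^2 = 10 R^2, which explains that constant
  throughout.\<close>

lemma G_left_lower:
  assumes d: "d \<le> (LINT x:{-R..2}|M. 2 - x)" and w: "2 < Re w" "Re w \<le> 2 * R" "\<bar>Im w\<bar> \<le> R"
  shows "d / (10 * R\<^sup>2) \<le> Re (G {-R..2} w)"
proof -
  have int: "set_integrable M {-R..2} (\<lambda>x. 1 / (w - of_real x))"
  proof (rule norm_cauchy_transform_le[OF finite_measure_axioms sets_M])
    show "0 < Re w - 2" using w by simp
    show "Re w - 2 \<le> norm (w - of_real x)" if "x \<in> {-R..2}" for x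
      using complex_Re_le_cmod[of "w - of_real x"] that by simp
  qed simp
  have re: "Re (G {-R..2} w) = (LINT x:{-R..2}|M. Re (1 / (w - of_real x)))"
    unfolding G_def set_lebesgue_integral_def using int
    by (subst integral_Re[symmetric]) (auto simp: set_integrable_def)
  have lin: "set_integrable M {-R..2} (\<lambda>x. (2 - x) / (10 * R\<^sup>2))"
    unfolding set_integrable_def
  proof (rule integrable_const_bound[where B = "(2 + R) / (10 * R\<^sup>2)"])
    show "AE x in M. norm (indicator {-R..2} x *\<^sub>R ((2 - x) / (10 * R\<^sup>2))) \<le> (2 + R) / (10 * R\<^sup>2)"
      using R by (intro AE_I2) (auto simp: indicator_def intro!: divide_right_mono)
    show "(\<lambda>x. indicator {-R..2} x *\<^sub>R ((2 - x) / (10 * R\<^sup>2))) \<in> borel_measurable M"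
      unfolding measurable_cong_sets[OF sets_M refl] by measurable
  qed
  have "d / (10 * R\<^sup>2) \<le> (LINT x:{-R..2}|M. 2 - x) / (10 * R\<^sup>2)"
    using d by (intro divide_right_mono) auto
  also have "\<dots> = (LINT x:{-R..2}|M. (2 - x) / (10 * R\<^sup>2))" by simp
  also have "\<dots> \<le> (LINT x:{-R..2}|M. Re (1 / (w - of_real x)))"
  proof (rule set_integral_mono[OF lin])
    show "set_integrable M {-R..2} (\<lambda>x. Re (1 / (w - of_real x)))"
      using integrable_Re[OF int[unfolded set_integrable_def]] by (simp add: set_integrable_def)
    fix x assume x: "x \<in> {-R..2}"
    have pos: "0 < norm (w - of_real x) ^ 2" using w x by (auto simp: complex_eq_iff)
    have "(x - Re w)\<^sup>2 \<le> (3 * R)\<^sup>2"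
      using x w R by (intro power2_le_iff_abs_le[THEN iffD2]) auto
    moreover have "(Im w)\<^sup>2 \<le> R\<^sup>2" using w(3) R by (intro power2_le_iff_abs_le[THEN iffD2]) auto
    ultimately have "norm (w - of_real x) ^ 2 \<le> 10 * R\<^sup>2"
      unfolding norm_diam_circle_minus by (simp add: power2_eq_square)
    then have "(2 - x) / (10 * R\<^sup>2) \<le> (Re w - x) / norm (w - of_real x) ^ 2"
      using pos x w by (intro frac_le) auto
    also have "\<dots> = Re (1 / (w - of_real x))"
      by (simp add: Re_divide cmod_power2)
    finally show "(2 - x) / (10 * R\<^sup>2) \<le> Re (1 / (w - of_real x))" .
  qed
  finally show ?thesis unfolding re .
qed

text \<open>Dividing the Markov relation by its main part leaves 1 + G_right / G_left, where G_right
  carries only the mass to the right of 2. The difference of logarithms in the exponent is the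
  function \<open>V\<close> of the following estimates.\<close>

lemma exp_V:
  assumes w: "w \<notin> of_real ` {-R..R}" and nz: "G {-R..2} w \<noteq> 0" "w \<noteq> of_real a"
  shows "exp (1 / 2 * Z w - Ln (w - of_real a) - Ln (G {-R..2} w)) - 1 = G {2<..R} w / G {-R..2} w"
proof -
  have "exp (1 / 2 * Z w) = (w - of_real a) * (G {-R..2} w + G {2<..R} w)"
    unfolding Z_def transform[OF w] G_split[OF w] ..
  moreover have "exp (1 / 2 * Z w - Ln (w - of_real a) - Ln (G {-R..2} w)) =
      exp (1 / 2 * Z w) / (w - of_real a) / G {-R..2} w"
    using nz by (simp add: exp_diff)
  ultimately show ?thesis using nz by (simp add: add_divide_distrib)
qed

lemma continuous_on_Z: "continuous_on (- of_real ` {-R..R}) Z"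
  and holomorphic_G: "A \<in> sets borel \<Longrightarrow> closed C \<Longrightarrow> of_real ` A \<subseteq> C \<Longrightarrow> G A holomorphic_on - C"
proof -
  have "closed (complex_of_real ` {-R..R})"
    by (intro compact_imp_closed compact_continuous_image continuous_intros) auto
  from holomorphic_cauchy_transform(2)[OF set_integrable_\<sigma> _ _ this]
  show "continuous_on (- of_real ` {-R..R}) Z" unfolding Z_def[abs_def] by simp
  show "G A holomorphic_on - C" if "A \<in> sets borel" "closed C" "of_real ` A \<subseteq> C"
    unfolding G_def[abs_def] by (rule holomorphic_cauchy_transform(1)[OF set_integrable_1 sets_M]; fact)
qed

lemma holomorphic_G_right: "G {-R..2} holomorphic_on {w. 2 < Re w}"
proof -
  have "closed {w. Re w \<le> 2}" by (rule closed_halfspace_Re_le)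
  from holomorphic_G[OF _ this, of "{-R..2}"] show ?thesis
    by (rule holomorphic_on_subset) auto
qed

text \<open>On the circle with diameter \<open>[p, 2 R]\<close> the function \<open>V\<close> is a logarithm of \<open>G / G_left\<close>; the branch
  is followed along the arc from the right end point, where \<open>V\<close> is real.\<close>
lemma V_bound:
  assumes d: "0 < d" "d \<le> (LINT x:{-R..2}|M. 2 - x)" and p: "2 < p" "p < 3"
    and small: "8 * measure M {2<..R} \<le> c" and c: "c = d / (10 * R\<^sup>2)"
    and \<theta>: "- pi < \<theta>" "\<theta> < pi" "\<theta> \<noteq> 0" and w: "w = diam_circle p (2 * R)"
    and good: "\<bar>\<theta>\<bar> \<le> pi / 2 \<or> 4 * measure M {2<..R} \<le> c * \<bar>Im (w \<theta>)\<bar>"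
  shows "norm (1 / 2 * Z (w \<theta>) - Ln (w \<theta> - of_real a) - Ln (G {-R..2} (w \<theta>))) * \<bar>Im (w \<theta>)\<bar>
    \<le> 4 * R * measure M {2<..R} / c"
proof -
  let ?m = "measure M {2<..R}"
  define V where "V u = 1 / 2 * Z u - Ln (u - of_real a) - Ln (G {-R..2} u)" for u
  have c0: "0 < c" using d R by (simp add: c)
  have pR: "p < 2 * R" using p R by simp
  define r where "r = (2 * R - p) / 2"
  have r: "1 \<le> r" "r \<le> R - 1" using p R by (auto simp: r_def)
  have Re_w: "Re (w t) = (p + 2 * R) / 2 + r * cos t" and Im_w: "Im (w t) = r * sin t" for t
    by (simp_all add: w r_def diam_circle_Re diam_circle_Im)
  have r2: "2 * r = 2 * R - p" by (simp add: r_def)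
  have rc: "r * cos t \<le> r" "- r \<le> r * cos t" for t
    using mult_left_mono[of "cos t" 1 r] mult_left_mono[of "-1" "cos t" r] r by simp_all
  have mid: "(p + 2 * R) / 2 = 2 * R - r" by (simp add: r_def field_simps)
  have Re_le: "Re (w t) \<le> 2 * R" for t
    unfolding Re_w mid using rc(1)[of t] by simp
  have Re_ge: "p \<le> Re (w t)" for t
    unfolding Re_w mid using rc(2)[of t] r2 by simp
  have Im_le: "\<bar>Im (w t)\<bar> \<le> R - 1" for t
    using mult_mono[of r "R - 1" "\<bar>sin t\<bar>" 1] r by (simp add: Im_w abs_mult)
  have Ga: "c \<le> Re (G {-R..2} (w t))" for t
    unfolding c by (rule G_left_lower[OF d(2)]) (use p Re_ge[of t] Re_le[of t] Im_le[of t] in auto)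
  have shrink: "\<bar>s * \<theta>\<bar> \<le> \<bar>\<theta>\<bar>" if "0 \<le> s" "s \<le> 1" for s
    unfolding abs_mult using that by (simp add: mult_left_le_one_le)
  have arc: "w (s * \<theta>) \<notin> of_real ` {-R..R}" if "0 \<le> s" "s \<le> 1" for s
  proof (cases "s = 0")
    case True
    then have "Re (w (s * \<theta>)) > R" using R by (simp add: Re_w mid)
    then show ?thesis by auto
  next
    case False
    then have "s * \<theta> \<noteq> 0" using \<theta> by simp
    moreover have "\<bar>s * \<theta>\<bar> < pi" using shrink[OF that] \<theta> by linarith
    ultimately have "sin (s * \<theta>) \<noteq> 0"
      using sin_eq_0_pi[of "s * \<theta>"] by (auto simp: abs_less_iff)
    then have "Im (w (s * \<theta>)) \<noteq> 0" using r by (simp add: Im_w)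
    then show ?thesis by auto
  qed
  have dist: "norm (G {2<..R} (w t)) \<le> ?m / \<delta>" if "0 < \<delta>" "\<bar>t\<bar> \<le> pi / 2 \<and> \<delta> \<le> 1 \<or> \<delta> \<le> \<bar>Im (w t)\<bar>" for t \<delta>
    unfolding G_def
  proof (rule norm_cauchy_transform_le(2)[OF finite_measure_axioms sets_M _ that(1)])
    fix x assume x: "x \<in> {2<..R}"
    show "\<delta> \<le> norm (w t - of_real x)"
    proof (cases "\<delta> \<le> \<bar>Im (w t)\<bar>")
      case True
      then show ?thesis using abs_Im_le_cmod[of "w t - of_real x"] by simp
    next
      case False
      then have t: "\<bar>t\<bar> \<le> pi / 2" "\<delta> \<le> 1" using that(2) by auto
      have "0 \<le> cos t" by (rule cos_ge_zero) (use t in auto)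
      then have "(p + 2 * R) / 2 \<le> Re (w t)" using r by (simp add: Re_w)
      then have "1 \<le> Re (w t - of_real x)" using x p by simp
      then show ?thesis using complex_Re_le_cmod[of "w t - of_real x"] t by linarith
    qed
  qed simp
  define v where "v = \<bar>Im (w \<theta>)\<bar>"
  have "sin \<theta> \<noteq> 0" using sin_eq_0_pi[of \<theta>] \<theta> by auto
  then have v0: "0 < v" using r by (simp add: v_def Im_w)
  \<comment> \<open>A lower bound for the distance of the whole arc from angle 0 to \<theta> from
    (2,R]. On the right half, Re w >= (p + 2R)/2 >= R + 1 gives 1; on the left half the imaginary
    part is smallest at the end of the arc, where it is v.\<close>
  define \<delta> where "\<delta> = (if \<bar>\<theta>\<bar> \<le> pi / 2 then 1 else min 1 v)"
  have \<delta>0: "0 < \<delta>" "\<delta> \<le> 1" using v0 by (auto simp: \<delta>_def)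
  have near: "norm (exp (V (w (s * \<theta>))) - 1) \<le> ?m / (c * \<delta>)" if "0 < s" "s \<le> 1" for s
  proof -
    have s\<theta>: "\<bar>s * \<theta>\<bar> \<le> \<bar>\<theta>\<bar>" using shrink that by simp
    have "\<bar>s * \<theta>\<bar> \<le> pi / 2 \<and> \<delta> \<le> 1 \<or> \<delta> \<le> \<bar>Im (w (s * \<theta>))\<bar>"
    proof (cases "\<bar>s * \<theta>\<bar> \<le> pi / 2")
      case False
      then have "\<delta> \<le> v" using s\<theta> by (auto simp: \<delta>_def)
      \<comment> \<open>Between pi/2 and pi the sine decreases, so earlier points of the arc are
        farther from the axis than its end point.\<close>
      moreover have "sin \<bar>\<theta>\<bar> \<le> sin \<bar>s * \<theta>\<bar>"
      proof -
        have "sin (pi - \<bar>\<theta>\<bar>) \<le> sin (pi - \<bar>s * \<theta>\<bar>)"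
          by (rule sin_monotone_2pi_le) (use False s\<theta> \<theta> in \<open>auto simp: abs_if split: if_splits\<close>)
        then show ?thesis by simp
      qed
      moreover have "0 \<le> sin \<bar>\<theta>\<bar>" by (rule sin_ge_zero) (use \<theta> in auto)
      moreover have "\<bar>sin t\<bar> = \<bar>sin \<bar>t\<bar>\<bar>" for t :: real by (cases "t \<ge> 0") auto
      from this[of \<theta>] this[of "s * \<theta>"]
      have "\<bar>sin \<theta>\<bar> = \<bar>sin \<bar>\<theta>\<bar>\<bar>" "\<bar>sin (s * \<theta>)\<bar> = \<bar>sin \<bar>s * \<theta>\<bar>\<bar>" .
      ultimately have "\<bar>sin \<theta>\<bar> \<le> \<bar>sin (s * \<theta>)\<bar>" by linarith
      then have "v \<le> \<bar>Im (w (s * \<theta>))\<bar>"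
        unfolding v_def Im_w abs_mult by (intro mult_left_mono) auto
      with \<open>\<delta> \<le> v\<close> show ?thesis by simp
    qed (use \<delta>0 in simp)
    from dist[OF \<delta>0(1) this] have Gb: "norm (G {2<..R} (w (s * \<theta>))) \<le> ?m / \<delta>" .
    have Gn: "c \<le> norm (G {-R..2} (w (s * \<theta>)))"
      using Ga[of "s * \<theta>"] complex_Re_le_cmod order_trans by blast
    have "exp (V (w (s * \<theta>))) - 1 = G {2<..R} (w (s * \<theta>)) / G {-R..2} (w (s * \<theta>))"
      unfolding V_def
    proof (rule exp_V)
      show "w (s * \<theta>) \<notin> of_real ` {-R..R}" using arc that by simp
      show "G {-R..2} (w (s * \<theta>)) \<noteq> 0" using Gn c0 by auto
      show "w (s * \<theta>) \<noteq> of_real a" using Re_ge[of "s * \<theta>"] p a by auto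
    qed
    then have "norm (exp (V (w (s * \<theta>))) - 1) = norm (G {2<..R} (w (s * \<theta>))) / norm (G {-R..2} (w (s * \<theta>)))"
      by (simp add: norm_divide)
    also have "\<dots> \<le> (?m / \<delta>) / c"
      by (rule frac_le) (use Gb Gn c0 \<delta>0 in auto)
    finally show ?thesis by (simp add: mult.commute)
  qed
  have "norm (V (w (1 * \<theta>))) \<le> 2 * (?m / (c * \<delta>))"
  proof (rule norm_le_of_exp_near_1[where f = "\<lambda>s. V (w (s * \<theta>))"])
    have img: "(\<lambda>s. w (s * \<theta>)) ` {0..1} \<subseteq> - of_real ` {-R..R}"
    proof
      fix u assume "u \<in> (\<lambda>s. w (s * \<theta>)) ` {0..1}"
      then obtain s where "u = w (s * \<theta>)" "0 \<le> s" "s \<le> 1" by auto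
      then show "u \<in> - of_real ` {-R..R}" using arc[of s] by simp
    qed
    have cw: "continuous_on {0..1} (\<lambda>s. w (s * \<theta>))" unfolding w by (intro continuous_intros)
    have cG: "continuous_on {0..1} (\<lambda>s. G {-R..2} (w (s * \<theta>)))"
      by (rule continuous_on_compose2[OF holomorphic_on_imp_continuous_on[OF holomorphic_G_right] cw])
        (use Re_ge p in \<open>force intro: less_le_trans\<close>)
    have nr: "u \<notin> \<real>\<^sub>\<le>\<^sub>0" if "0 < Re u" for u using that by (auto simp: complex_nonpos_Reals_iff)
    have Re_gt_a: "a < Re (w t)" for t using Re_ge[of t] p a by linarith
    have Ga_pos: "0 < Re (G {-R..2} (w t))" for t using Ga[of t] c0 by linarith
    show "continuous_on {0..1} (\<lambda>s. V (w (s * \<theta>)))"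
      unfolding V_def
      by (intro continuous_on_diff continuous_on_mult continuous_on_const continuous_on_Ln' cG cw
          continuous_on_compose2[OF continuous_on_Z cw img] nr)
        (use Re_gt_a Ga_pos in simp_all)
    \<comment> \<open>The arc starts at the real point 2R, to the right of the segment and of the
      centre, where both logarithms and the transform are real.\<close>
    show "Im (V (w (0 * \<theta>))) = 0"
    proof -
      have w0: "w 0 = of_real (2 * R)" by (simp add: w diam_circle_def field_simps)
      have "Im (Z (w 0)) = 0" unfolding Z_def w0
        by (simp only: of_real_diff[symmetric] of_real_power[symmetric] of_real_divide[symmetric] set_integral_complex_of_real Im_complex_of_real)
      moreover have "Im (Ln (w 0 - of_real a)) = 0"
        unfolding w0 of_real_diff[symmetric] using R a by (subst Ln_of_real) auto
      moreover have "Im (G {-R..2} (w 0)) = 0"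
      proof -
        have "1 / (complex_of_real (2 * R) - of_real x) = of_real (1 / (2 * R - x))" for x by simp
        then have "G {-R..2} (w 0) = of_real (LINT x:{-R..2}|M. 1 / (2 * R - x))"
          unfolding G_def w0 by (simp only: set_integral_complex_of_real)
        then show ?thesis by simp
      qed
      then have "G {-R..2} (w 0) = of_real (Re (G {-R..2} (w 0)))" by (simp add: complex_eq_iff)
      then have "Im (Ln (G {-R..2} (w 0))) = 0"
        using Ln_of_real[of "Re (G {-R..2} (w 0))"] Ga[of 0] c0 by (metis Im_complex_of_real less_le_trans)
      ultimately show ?thesis by (simp add: V_def)
    qed
    show "?m / (c * \<delta>) < 1 / 2"
    proof (cases "\<delta> = 1")
      case True then show ?thesis using small c0 measure_nonneg[of M "{2<..R}"] by (simp add: field_simps)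
    next
      case False
      then have "\<delta> = v" "\<not> \<bar>\<theta>\<bar> \<le> pi / 2" by (auto simp: \<delta>_def min_def split: if_splits)
      then have "4 * ?m \<le> c * \<delta>" using good by (auto simp: v_def)
      moreover have "0 < c * \<delta>" using c0 \<delta>0 by simp
      ultimately show ?thesis by (simp add: divide_less_eq)
    qed
  qed (use near in auto)
  then have V: "norm (V (w \<theta>)) \<le> 2 * (?m / (c * \<delta>))" by simp
  \<comment> \<open>Absorbs the 1/\<delta> of the estimate into |Im w|: if \<delta> = 1 then v is at
    most the radius of the circle, otherwise \<delta> = v.\<close>
  have "v \<le> R * \<delta>" using Im_le[of \<theta>] R \<delta>0 v0 by (auto simp: \<delta>_def v_def min_def intro: order_trans[of _ "R - 1"])
  then have "norm (V (w \<theta>)) * v \<le> 2 * (?m / (c * \<delta>)) * (R * \<delta>)"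
    by (intro mult_mono V) (use c0 \<delta>0 v0 in auto)
  also have "\<dots> = 2 * R * ?m / c" using \<delta>0 by simp
  also have "\<dots> \<le> 4 * R * ?m / c" using R c0 by (intro divide_right_mono mult_right_mono) auto
  finally show ?thesis by (simp add: V_def v_def)
qed

end

text \<open>Double angle: sin x = 2 sin(x/2) cos(x/2), and both the cosine and the slope of the sine
  are at least sqrt 2 / 2 up to pi/4.\<close>

lemma half_le_sin:
  fixes x :: real assumes "0 \<le> x" "x \<le> pi / 2" shows "x / 2 \<le> sin x"
proof (cases "x = 0")
  case False
  define y where "y = x / 2"
  have y: "0 < y" "y \<le> pi / 4" using assms False by (auto simp: y_def)
  have c: "sqrt 2 / 2 \<le> cos t" if "0 \<le> t" "t \<le> y" for t
    using cos_monotone_0_pi_le[of t "pi / 4"] that y by (simp add: cos_45)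
  obtain t where t: "0 < t" "t < y" "sin y - sin 0 = (y - 0) * cos t"
    using MVT2[of 0 y sin cos] y by (auto intro: DERIV_sin)
  have "y * (sqrt 2 / 2) \<le> sin y"
    using t c[of t] y by (simp add: mult_left_mono)
  then have "y * (sqrt 2 / 2) * (sqrt 2 / 2) \<le> sin y * cos y"
    using c[of y] y by (intro mult_mono) (auto intro: order_trans[rotated] simp: sin_ge_zero)
  moreover have "y * (sqrt 2 / 2) * (sqrt 2 / 2) = y / 2" by simp
  ultimately have "y \<le> sin (2 * y)" unfolding sin_double by linarith
  then show ?thesis by (simp add: y_def)
qed simp

text \<open>The sum after the first R in the bracket is the bound of \<open>V_bound_crude\<close>,
  paid on an arc of parameter length 4m/c; the first R belongs to the bound 4Rm/c valid on the rest
  of the circle. Here m is the mass to the right of 2.\<close>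

definition excess_const :: "real \<Rightarrow> real \<Rightarrow> real \<Rightarrow> real" where
  "excess_const R S c = 16 * R\<^sup>2 * (R + (S * pi / 2 + R * (3 * R + 2 + pi) + 1 + R * (1 / c + pi))) / c"

context markov_pair
begin

text \<open>No control of the branch and no smallness: each of the three terms of V is estimated
  separately, the principal logarithms having imaginary part at most pi in modulus. It serves next
  to the left end point, where the perturbation of the transform is no longer small.\<close>

lemma V_bound_crude:
  assumes d: "0 < d" "d \<le> (LINT x:{-R..2}|M. 2 - x)" and w: "2 < Re w" "Re w \<le> 2 * R" "\<bar>Im w\<bar> \<le> R" "Im w \<noteq> 0"
    and c: "c = d / (10 * R\<^sup>2)" and Zb: "norm (Z w) \<le> S * pi / \<bar>Im w\<bar>"
  shows "norm (1 / 2 * Z w - Ln (w - of_real a) - Ln (G {-R..2} w)) * \<bar>Im w\<bar> \<le>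
    S * pi / 2 + R * (3 * R + 2 + pi) + 1 + R * (1 / c + pi)"
proof -
  let ?v = "\<bar>Im w\<bar>"
  have c0: "0 < c" using d R by (simp add: c)
  have Ga: "c \<le> norm (G {-R..2} w)"
    using G_left_lower[OF d(2) w(1-3)] complex_Re_le_cmod[of "G {-R..2} w"] unfolding c by linarith
  have Gu: "norm (G {-R..2} w) \<le> 1 / ?v"
  proof -
    have "norm (G {-R..2} w) \<le> measure M {-R..2} / ?v"
      unfolding G_def
      by (rule norm_cauchy_transform_le(2)[OF finite_measure_axioms sets_M])
        (use w(4) abs_Im_le_cmod[of "w - of_real _"] in auto)
    also have "\<dots> \<le> 1 / ?v" by (rule divide_right_mono) auto
    finally show ?thesis .
  qed
  have w1: "1 \<le> norm (w - of_real a)"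
    using complex_Re_le_cmod[of "w - of_real a"] w(1) a by simp
  have w2: "norm (w - of_real a) \<le> 3 * R + 1"
    using cmod_le[of "w - of_real a"] w a by simp
  have L1: "norm (Ln (w - of_real a)) \<le> 3 * R + 2 + pi"
  proof -
    have "1 / norm (w - of_real a) \<le> 1" using frac_le[of 1 1 1 "norm (w - of_real a)"] w1 by simp
    moreover have "w - of_real a \<noteq> 0" using w1 by auto
    ultimately show ?thesis using norm_Ln_le_add_inverse[of "w - of_real a"] w2 by linarith
  qed
  have L2: "norm (Ln (G {-R..2} w)) \<le> 1 / ?v + (1 / c + pi)"
  proof -
    have "1 / norm (G {-R..2} w) \<le> 1 / c" using Ga c0 by (intro frac_le) auto
    moreover have "G {-R..2} w \<noteq> 0" using Ga c0 by auto
    ultimately show ?thesis using norm_Ln_le_add_inverse[of "G {-R..2} w"] Gu by linarith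
  qed
  have "norm (1 / 2 * Z w - Ln (w - of_real a) - Ln (G {-R..2} w)) \<le>
      norm (1 / 2 * Z w) + norm (Ln (w - of_real a)) + norm (Ln (G {-R..2} w))"
    by (intro order_trans[OF norm_triangle_ineq4] add_right_mono norm_triangle_ineq4)
  also have "\<dots> \<le> (S * pi / ?v) / 2 + (3 * R + 2 + pi) + (1 / ?v + (1 / c + pi))"
    using L1 L2 Zb by (simp add: norm_mult norm_divide)
  finally have "norm (1 / 2 * Z w - Ln (w - of_real a) - Ln (G {-R..2} w)) * ?v \<le>
      ((S * pi / ?v) / 2 + (3 * R + 2 + pi) + (1 / ?v + (1 / c + pi))) * ?v"
    by (rule mult_right_mono) simp
  also have "\<dots> = S * pi / 2 + ?v * (3 * R + 2 + pi) + 1 + ?v * (1 / c + pi)"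
    using w(4) by (simp add: field_simps)
  also have "\<dots> \<le> S * pi / 2 + R * (3 * R + 2 + pi) + 1 + R * (1 / c + pi)"
    using w(3) R c0 pi_ge_zero by (intro add_mono mult_right_mono order_refl) auto
  finally show ?thesis .
qed

lemma set_integrable_\<sigma>_real: "A \<in> sets borel \<Longrightarrow> A \<subseteq> {-R..R} \<Longrightarrow> set_integrable lborel A \<sigma>"
proof -
  assume A: "A \<in> sets borel" "A \<subseteq> {-R..R}"
  have "set_integrable lborel {-R..R} \<sigma>"
    using integrable_Re[OF set_integrable_\<sigma>[unfolded set_integrable_def]] by (simp add: set_integrable_def)
  then show ?thesis by (rule set_integrable_subset) (use A in auto)
qed

text \<open>The weighted integral of V round the circle over [p,2R] is computed in two ways. The
  logarithms are holomorphic in the disc and contribute 0, while the double poles of Z produce the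
  excess on (p,R] with weight p + 2R - 2x. On the other hand |V| |Im w| is of order m, except on an
  arc of length of order m where it is merely bounded; so the integral is linear in the mass m to
  the right of 2.\<close>

lemma right_excess_from:
  assumes d: "0 < d" "d \<le> (LINT x:{-R..2}|M. 2 - x)" and p: "2 < p" "p < 3"
    and small: "8 * measure M {2<..R} \<le> c" and c: "c = d / (10 * R\<^sup>2)"
  shows "(LBINT x:{p<..R}. \<sigma> x) \<le> excess_const R S c * measure M {2<..R}"
proof -
  let ?m = "measure M {2<..R}" and ?q = "2 * R"
  define C where "C = S * pi / 2 + R * (3 * R + 2 + pi) + 1 + R * (1 / c + pi)"
  have c0: "0 < c" using d R by (simp add: c)
  have C0: "0 \<le> C" unfolding C_def using R S_nonneg c0 pi_ge_zero by (intro add_nonneg_nonneg mult_nonneg_nonneg) auto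
  have pq: "p < ?q" using p R by simp
  define w where "w t = diam_circle p ?q (2 * pi * t)" for t
  define V where "V u = 1 / 2 * Z u - Ln (u - of_real a) - Ln (G {-R..2} u)" for u
  define L where "L u = Ln (u - of_real a) + Ln (G {-R..2} u)" for u
  define h where "h t = end_weight p ?q (w t) * diam_speed p ?q t" for t
  define r where "r = (2 * R - p) / 2"
  have r: "1 \<le> r" "r \<le> R" using p R by (auto simp: r_def)
  have mid: "(p + 2 * R) / 2 = 2 * R - r" "2 * R - r = p + r" by (simp_all add: r_def field_simps)
  have Re_w: "Re (w t) = 2 * R - r + r * cos (2 * pi * t)" and Im_w: "Im (w t) = r * sin (2 * pi * t)" for t
    unfolding mid(1)[symmetric] by (simp_all add: w_def r_def diam_circle_Re diam_circle_Im)
  have rc: "r * cos t \<le> r" "- r \<le> r * cos t" for t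
    using mult_left_mono[of "cos t" 1 r] mult_left_mono[of "-1" "cos t" r] r by simp_all
  have Re_le: "Re (w t) \<le> 2 * R" for t
    unfolding Re_w using rc(1)[of "2 * pi * t"] by simp
  have Re_ge: "p \<le> Re (w t)" for t
    unfolding Re_w mid(2) using rc(2)[of "2 * pi * t"] by simp
  have Im_le: "\<bar>Im (w t)\<bar> \<le> R" for t
    using mult_mono[of r R "\<bar>sin (2 * pi * t)\<bar>" 1] r by (simp add: Im_w abs_mult)
  have sg: "\<bar>\<sigma> x\<bar> \<le> S" for x using \<sigma>_bounds[of x] by simp
  have R0: "0 < R" using R by simp
  note swap = end_weight_swap[OF pq \<sigma>_measurable sg R0, folded Z_def w_def, folded h_def]
  have L_int: "(LBINT t:{0..1}. h t * L (w t)) = 0" and L_i: "set_integrable lborel {0..1} (\<lambda>t. h t * L (w t))"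
  proof -
    let ?f = "\<lambda>u. end_weight p ?q u * L u"
    have nr: "u \<notin> \<real>\<^sub>\<le>\<^sub>0" if "0 < Re u" for u using that by (auto simp: complex_nonpos_Reals_iff)
    define U where "U = {u. 2 < Re u \<and> Re u < 2 * R + 1 \<and> \<bar>Im u\<bar> < R + 1} \<inter> {u. 0 < Re (G {-R..2} u)}"
    define B where "B = cball (complex_of_real ((p + ?q) / 2)) ((?q - p) / 2)"
    have B: "p \<le> Re u" "Re u \<le> 2 * R" "\<bar>Im u\<bar> \<le> R" if "u \<in> B" for u
    proof -
      have "norm (u - of_real ((p + ?q) / 2)) \<le> r" using that by (simp add: B_def dist_norm norm_minus_commute r_def)
      then have "\<bar>Re u - (p + ?q) / 2\<bar> \<le> r" "\<bar>Im u\<bar> \<le> r"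
        using abs_Re_le_cmod[of "u - of_real ((p + ?q) / 2)"] abs_Im_le_cmod[of "u - of_real ((p + ?q) / 2)"] by auto
      then show "p \<le> Re u" "Re u \<le> 2 * R" "\<bar>Im u\<bar> \<le> R"
        unfolding mid(1) using r mid(2) by linarith+
    qed
    have Ga: "0 < Re (G {-R..2} u)" if "u \<in> B" for u
    proof -
      have "c \<le> Re (G {-R..2} u)"
        unfolding c by (rule G_left_lower[OF d(2)]) (use B[OF that] p in auto)
      then show ?thesis using c0 by simp
    qed
    have BH: "B \<subseteq> {u. 2 < Re u}" and Ba: "\<And>u. u \<in> B \<Longrightarrow> 0 < Re (u - of_real a)"
      using B(1) p a by (fastforce simp: abs_le_iff)+
    have bs: "ball (complex_of_real ((p + ?q) / 2)) ((?q - p) / 2) \<subseteq> B" by (auto simp: B_def)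
    have holG: "G {-R..2} holomorphic_on ball (complex_of_real ((p + ?q) / 2)) ((?q - p) / 2)"
      by (rule holomorphic_on_subset[OF holomorphic_G_right order_trans[OF bs BH]])
    have contG: "continuous_on B (G {-R..2})"
      by (rule continuous_on_subset[OF holomorphic_on_imp_continuous_on[OF holomorphic_G_right] BH])
    have cont: "continuous_on B ?f"
      unfolding L_def end_weight_def
      by (intro continuous_intros contG continuous_on_Ln' nr Ga Ba)
    have hol: "?f holomorphic_on ball (complex_of_real ((p + ?q) / 2)) ((?q - p) / 2)"
      unfolding L_def end_weight_def
      by (intro holomorphic_intros holG nr Ga Ba subsetD[OF bs])
    have "(?f has_contour_integral 0) (circlepath (of_real ((p + ?q) / 2)) ((?q - p) / 2))"
    proof (rule Cauchy_theorem_convex[where S = B and K = "{}"])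
      show "continuous_on B ?f" by (rule cont)
      show "?f field_differentiable at x" if "x \<in> interior B - {}" for x
        using hol that by (auto simp: B_def interior_cball holomorphic_on_open field_differentiable_def)
      show "path_image (circlepath (of_real ((p + ?q) / 2)) ((?q - p) / 2)) \<subseteq> B"
        using pq by (auto simp: B_def)
    qed (auto simp: B_def)
    moreover have "continuous_on {0..1} (\<lambda>t. ?f (diam_circle p ?q (2 * pi * t)))"
    proof (rule continuous_on_compose2[OF cont])
      show "continuous_on {0..1} (\<lambda>t. diam_circle p ?q (2 * pi * t))" by (intro continuous_intros)
      have "dist (of_real ((p + ?q) / 2)) (diam_circle p ?q t) = (?q - p) / 2" for t
        using pq by (simp add: diam_circle_def dist_norm norm_mult flip: of_real_diff)
      then show "(\<lambda>t. diam_circle p ?q (2 * pi * t)) ` {0..1} \<subseteq> B" by (auto simp: B_def)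
    qed
    ultimately show "(LBINT t:{0..1}. h t * L (w t)) = 0" "set_integrable lborel {0..1} (\<lambda>t. h t * L (w t))"
      using contour_integral_diam_circle[of ?f 0 p ?q] by (simp_all add: h_def w_def mult_ac)
  qed
  have Z_i: "set_integrable lborel {0..1} (\<lambda>t. 1 / 2 * (h t * Z (w t)))"
    by (intro set_integrable_mult_right swap(1))
  have hV: "h t * V (w t) = 1 / 2 * (h t * Z (w t)) - h t * L (w t)" for t
    by (simp add: V_def L_def algebra_simps)
  have V_i: "set_integrable lborel {0..1} (\<lambda>t. h t * V (w t))"
    unfolding hV by (rule set_integral_diff(1)[OF Z_i L_i])
  have "(LBINT t:{0..1}. h t * V (w t)) = 1 / 2 * (LBINT t:{0..1}. h t * Z (w t))"
    unfolding hV set_integral_diff(2)[OF Z_i L_i] L_int by simp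
  also have "\<dots> = 1 / 2 * (LBINT x:{-R..R}. of_real (\<sigma> x) * (if p < x \<and> x < ?q then 2 * pi * \<i> * of_real (2 * x - p - ?q) else 0))"
    unfolding swap(2) ..
  also have "\<dots> = - pi * \<i> * (LBINT x:{-R..R}. of_real (\<sigma> x * (if p < x then p + ?q - 2 * x else 0)))"
  proof -
    have "of_real (\<sigma> x) * (if p < x \<and> x < ?q then 2 * pi * \<i> * of_real (2 * x - p - ?q) else 0) =
      - 2 * pi * \<i> * of_real (\<sigma> x * (if p < x then p + ?q - 2 * x else 0))" if "x \<in> {-R..R}" for x
      using that R by (simp add: algebra_simps)
    then have "(LBINT x:{-R..R}. of_real (\<sigma> x) * (if p < x \<and> x < ?q then 2 * pi * \<i> * of_real (2 * x - p - ?q) else 0)) =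
      (LBINT x:{-R..R}. - 2 * pi * \<i> * of_real (\<sigma> x * (if p < x then p + ?q - 2 * x else 0)))"
      by (intro set_lebesgue_integral_cong) auto
    then show ?thesis by (simp only: set_integral_mult_right) simp
  qed
  finally have eq: "norm (LBINT t:{0..1}. h t * V (w t)) = pi * \<bar>LBINT x:{-R..R}. \<sigma> x * (if p < x then p + ?q - 2 * x else 0)\<bar>"
    unfolding set_integral_complex_of_real by (simp add: norm_mult)
  \<comment> \<open>For x up to R the weight p + 2R - 2x is at least p > 1. This is what the
    diameter end point 2R, beyond the end R of the segment, provides.\<close>
  have lower: "(LBINT x:{p<..R}. \<sigma> x) \<le> (LBINT x:{-R..R}. \<sigma> x * (if p < x then p + ?q - 2 * x else 0))"
    unfolding set_lebesgue_integral_def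
  proof (rule integral_mono)
    show "integrable lborel (\<lambda>x. indicator {p<..R} x *\<^sub>R \<sigma> x)"
      by (rule set_integrable_\<sigma>_real[unfolded set_integrable_def]) (use p R in auto)
    have "set_integrable lborel {-R..R} (\<lambda>x. complex_of_real (\<sigma> x) * of_real (if p < x then p + ?q - 2 * x else 0))"
      by (rule set_integrable_mult_bounded[OF set_integrable_\<sigma>, where C = "p + 4 * R"]) (use R p in auto)
    from integrable_Re[OF this[unfolded set_integrable_def]]
    show "integrable lborel (\<lambda>x. indicator {-R..R} x *\<^sub>R (\<sigma> x * (if p < x then p + ?q - 2 * x else 0)))"
      by simp
    fix x
    show "indicator {p<..R} x *\<^sub>R \<sigma> x \<le> indicator {-R..R} x *\<^sub>R (\<sigma> x * (if p < x then p + ?q - 2 * x else 0))"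
      using mult_left_mono[of 1 "p + ?q - 2 * x" "\<sigma> x"] \<sigma>_bounds[of x] p R by (auto simp: indicator_def)
  qed
  \<comment> \<open>The bad arc. If |Im w| < 4m/c and \<phi> is the angle to the left end point,
    then \<phi>/2 <= sin \<phi> <= |Im w| gives \<phi> < 8m/c; as \<phi> = 2 pi |t - 1/2| >= 4 |t -
    1/2|, the parameter is within 2m/c of 1/2.\<close>
  define J where "J = {1/2 - 2 * ?m / c..1/2 + 2 * ?m / c}"
  have main: "norm (h t * V (w t)) \<le> 4 * pi * R\<^sup>2 * (4 * R * ?m / c) + 4 * pi * R\<^sup>2 * C * indicator J t"
    if t: "t \<in> {0..1}" "t \<notin> {0, 1/2, 1}" for t
  proof -
    \<comment> \<open>Recentres the parameter so that the angle lies in (-pi,pi) and the arc starts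
      at the right end point, as \<open>V_bound\<close> requires.\<close>
    define \<tau> where "\<tau> = (if t < 1/2 then t else t - 1)"
    define \<theta> where "\<theta> = pi * (2 * \<tau>)"
    have \<tau>: "-1 < 2 * \<tau>" "2 * \<tau> < 1" "\<tau> \<noteq> 0" using t by (auto simp: \<tau>_def)
    have \<theta>: "- pi < \<theta>" "\<theta> < pi" "\<theta> \<noteq> 0"
      using mult_strict_left_mono[OF \<tau>(1) pi_gt_zero] mult_strict_left_mono[OF \<tau>(2) pi_gt_zero] \<tau>(3)
      by (auto simp: \<theta>_def)
    have \<theta>t: "\<theta> = 2 * pi * t \<or> \<theta> = 2 * pi * t - 2 * pi"
      by (auto simp: \<theta>_def \<tau>_def algebra_simps)
    then have "cis \<theta> = cis (2 * pi * t)" by (auto simp: complex_eq_iff cos_diff sin_diff)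
    then have w\<theta>: "diam_circle p ?q \<theta> = w t" by (simp add: w_def diam_circle_def)
    have sin\<theta>: "sin \<theta> = sin (2 * pi * t)" using \<theta>t by (auto simp: sin_diff)
    have Im0: "Im (w t) \<noteq> 0" using \<theta> sin_eq_0_pi[of \<theta>] r sin\<theta> by (auto simp: Im_w)
    have crude: "norm (V (w t)) * \<bar>Im (w t)\<bar> \<le> C"
      unfolding V_def C_def
      by (rule V_bound_crude[OF d _ Re_le Im_le Im0 c swap(3)[OF t]]) (use Re_ge[of t] p in auto)
    have VI: "norm (V (w t)) * \<bar>Im (w t)\<bar> \<le> 4 * R * ?m / c + C * indicator J t"
    proof (cases "\<bar>\<theta>\<bar> \<le> pi / 2 \<or> 4 * ?m \<le> c * \<bar>Im (w t)\<bar>")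
      case True
      have "norm (V (w t)) * \<bar>Im (w t)\<bar> \<le> 4 * R * ?m / c"
        using V_bound[OF d p small c \<theta> refl] True unfolding w\<theta> V_def by simp
      moreover have "0 \<le> C * indicator J t" using C0 by (simp add: indicator_def)
      ultimately show ?thesis by linarith
    next
      case False
      define \<phi> where "\<phi> = pi - \<bar>\<theta>\<bar>"
      have \<phi>: "0 \<le> \<phi>" "\<phi> \<le> pi / 2" using False \<theta> by (auto simp: \<phi>_def)
      have "\<phi> / 2 \<le> sin \<phi>" by (rule half_le_sin[OF \<phi>])
      also have "sin \<phi> = \<bar>sin \<theta>\<bar>" using sin_ge_zero[of "\<bar>\<theta>\<bar>"] \<theta> by (auto simp: \<phi>_def abs_if)
      also have "\<dots> \<le> \<bar>Im (w t)\<bar>" 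
        using r mult_right_mono[of 1 r "\<bar>sin (2 * pi * t)\<bar>"] by (auto simp: Im_w sin\<theta> abs_mult simp del: mult_le_cancel_right1)
      also have "\<dots> < 4 * ?m / c" using False c0 by (simp add: field_simps)
      finally have "\<phi> < 8 * ?m / c" by simp
      moreover have "\<phi> = 2 * pi * \<bar>t - 1/2\<bar>"
      proof -
        have "\<bar>\<theta>\<bar> = pi * (2 * \<bar>\<tau>\<bar>)" by (simp add: \<theta>_def abs_mult)
        moreover have "\<bar>\<tau>\<bar> = 1 / 2 - \<bar>t - 1/2\<bar>" using t by (auto simp: \<tau>_def abs_if)
        ultimately show ?thesis by (simp add: \<phi>_def algebra_simps)
      qed
      moreover have "4 * \<bar>t - 1/2\<bar> \<le> 2 * pi * \<bar>t - 1/2\<bar>" using pi_ge_two by (intro mult_right_mono) auto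
      ultimately have "\<bar>t - 1/2\<bar> \<le> 2 * ?m / c" by simp
      then have "t \<in> J" by (auto simp: J_def abs_le_iff)
      moreover have "0 \<le> 4 * R * ?m / c" using R c0 by simp
      ultimately show ?thesis using crude by simp
    qed
    have nh: "norm (h t) = (?q - p) * \<bar>Im (w t)\<bar> * (pi * (?q - p))"
      unfolding h_def norm_mult w_def using norm_end_weight_diam_circle[of p ?q] pq
      by (simp add: diam_speed_def norm_mult flip: of_real_diff)
    have "norm (h t * V (w t)) = (?q - p) * (pi * (?q - p)) * (norm (V (w t)) * \<bar>Im (w t)\<bar>)"
      by (simp add: norm_mult nh)
    also have "\<dots> \<le> (?q * (pi * ?q)) * (4 * R * ?m / c + C * indicator J t)"
      using p R C0 pq by (intro mult_mono VI) auto
    also have "\<dots> = 4 * pi * R\<^sup>2 * (4 * R * ?m / c) + 4 * pi * R\<^sup>2 * C * indicator J t"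
      by (simp add: power2_eq_square algebra_simps)
    finally show ?thesis .
  qed
  have ind: "integrable lborel (indicator {l..u} :: real \<Rightarrow> real)" "(LBINT t. indicator {l..u} t) = u - l"
    if "l \<le> u" for l u :: real
    using that by (auto simp: less_top[symmetric])
  have Ji: "integrable lborel (\<lambda>t. indicator J t :: real)" "(LBINT t. indicator J t) = 4 * ?m / c"
    using ind[of "1/2 - 2 * ?m / c" "1/2 + 2 * ?m / c"] c0 by (simp_all add: J_def)
  have Ii: "integrable lborel (\<lambda>t. indicator {0..1::real} t :: real)" "(LBINT t. indicator {0..1::real} t) = (1 :: real)"
    using ind[of 0 1] by simp_all
  let ?A = "4 * pi * R\<^sup>2 * (4 * R * ?m / c)" and ?B = "4 * pi * R\<^sup>2 * C"
  have "norm (LBINT t:{0..1}. h t * V (w t)) \<le> (LBINT t:{0..1}. norm (h t * V (w t)))"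
    by (rule set_integral_norm_bound[OF V_i])
  also have "\<dots> \<le> (LBINT t. ?A * indicator {0..1} t + ?B * indicator J t)"
    unfolding set_lebesgue_integral_def
  proof (rule integral_mono_AE)
    show "integrable lborel (\<lambda>t. indicator {0..1} t *\<^sub>R norm (h t * V (w t)))"
      using set_integrable_norm[OF V_i] by (simp add: set_integrable_def)
    show "integrable lborel (\<lambda>t. ?A * indicator {0..1} t + ?B * indicator J t)"
      by (intro Bochner_Integration.integrable_add integrable_mult_right Ji Ii)
    have "AE t in lborel. t \<notin> {0, 1/2, 1::real}"
      using AE_lborel_singleton[of 0] AE_lborel_singleton[of "1/2::real"] AE_lborel_singleton[of "1::real"]
      by eventually_elim auto
    then show "AE t in lborel. indicator {0..1} t *\<^sub>R norm (h t * V (w t)) \<le> ?A * indicator {0..1} t + ?B * indicator J t"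
    proof eventually_elim
      fix t :: real assume t: "t \<notin> {0, 1/2, 1}"
      have "0 \<le> ?B * indicator J t" using C0 by (simp add: indicator_def)
      then show "indicator {0..1} t *\<^sub>R norm (h t * V (w t)) \<le> ?A * indicator {0..1} t + ?B * indicator J t"
        using main[OF _ t] by (cases "t \<in> {0..1}") (simp_all del: norm_mult)
    qed
  qed
  also have "\<dots> = ?A + ?B * (4 * ?m / c)"
    using Ji Ii by simp
  finally have "pi * (LBINT x:{p<..R}. \<sigma> x) \<le> ?A + ?B * (4 * ?m / c)"
    unfolding eq using mult_left_mono[OF order_trans[OF lower abs_ge_self], of pi] pi_ge_zero by linarith
  also have "\<dots> = pi * (excess_const R S c * ?m)"
  proof -
    have "excess_const R S c = 16 * R\<^sup>2 * (R + C) / c"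
      unfolding excess_const_def C_def ..
    then show ?thesis by (simp add: algebra_simps add_divide_distrib)
  qed
  finally show ?thesis using pi_gt_zero by simp
qed

text \<open>The bound does not depend on p, so p may decrease to 2; the strip (2,p] contributes at
  most (p - 2) S.\<close>

lemma right_excess:
  assumes d: "0 < d" "d \<le> (LINT x:{-R..2}|M. 2 - x)"
    and small: "8 * measure M {2<..R} \<le> c" and c: "c = d / (10 * R\<^sup>2)"
  shows "(LBINT x:{2<..R}. \<sigma> x) \<le> excess_const R S c * measure M {2<..R}"
proof (rule field_le_epsilon)
  fix e :: real assume e: "0 < e"
  define p where "p = 2 + min (1/2) (e / (S + 1))"
  have S1: "0 < S + 1" using S_nonneg by simp
  have p: "2 < p" "p < 3" using e S1 by (auto simp: p_def min_def)
  have "{2<..R} = {2<..p} \<union> {p<..R}" using p R by auto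
  then have "(LBINT x:{2<..R}. \<sigma> x) = (LBINT x:{2<..p}. \<sigma> x) + (LBINT x:{p<..R}. \<sigma> x)"
    using p R by (simp only:, intro set_integral_Un set_integrable_\<sigma>_real) auto
  moreover have "(LBINT x:{2<..p}. \<sigma> x) \<le> (LBINT x:{2<..p}. S)"
    by (intro set_integral_mono set_integrable_\<sigma>_real)
      (use p R \<sigma>_bounds in \<open>auto simp: set_integrable_def less_top[symmetric]\<close>)
  moreover have "(LBINT x:{2<..p}. S) = (p - 2) * S"
    using p by (simp add: set_lebesgue_integral_def)
  moreover have "(p - 2) * S \<le> e"
  proof -
    have "(p - 2) * S \<le> e / (S + 1) * (S + 1)"
      by (rule mult_mono) (use e S1 S_nonneg in \<open>auto simp: p_def\<close>)
    then show ?thesis using S1 by simp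
  qed
  ultimately show "(LBINT x:{2<..R}. \<sigma> x) \<le> excess_const R S c * measure M {2<..R} + e"
    using right_excess_from[OF d p small c] by linarith
qed

end

section \<open>Reflection at 0, which transfers the bound to the left of -2\<close>

lemma set_integral_distr_uminus:
  fixes f :: "real \<Rightarrow> 'a::{banach, second_countable_topology}"
  assumes M: "sets M = sets borel" and [measurable]: "f \<in> borel_measurable borel" "A \<in> sets borel"
  shows "(LINT x:A|distr M borel uminus. f x) = (LINT x:uminus ` A|M. f (- x))"
proof -
  have [measurable]: "uminus \<in> measurable M (borel :: real measure)"
    unfolding measurable_cong_sets[OF M refl] by measurable
  have "(LINT x:A|distr M borel uminus. f x) = (LINT x|M. indicator A (- x) *\<^sub>R f (- x))"
    unfolding set_lebesgue_integral_def by (rule integral_distr) measurable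
  moreover have "indicator A (- x) = (indicator (uminus ` A) x :: real)" for x
    by (auto simp: indicator_def image_iff intro: bexI[of _ "- x"])
  ultimately show ?thesis by (simp only: set_lebesgue_integral_def)
qed

lemma set_integral_lborel_uminus:
  fixes f :: "real \<Rightarrow> 'a::euclidean_space"
  shows "(LBINT x:A. f x) = (LBINT x:uminus ` A. f (- x))"
proof -
  have "(LBINT x:A. f x) = (LBINT x. indicator A (- x) *\<^sub>R f (- x))"
    unfolding set_lebesgue_integral_def
    using lborel_integral_real_affine[of "-1" "\<lambda>x. indicator A x *\<^sub>R f x" 0] by simp
  moreover have "indicator A (- x) = (indicator (uminus ` A) x :: real)" for x
    by (auto simp: indicator_def image_iff intro: bexI[of _ "- x"])
  ultimately show ?thesis by (simp only: set_lebesgue_integral_def)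
qed

text \<open>Under x -> -x and w -> -w both factors on the right of the relation change sign, while
  the squared kernel on the left does not change.\<close>

lemma (in markov_pair) markov_pair_uminus:
  "markov_pair (distr M borel uminus) (\<lambda>x. \<sigma> (- x)) (- a) R S"
proof (rule markov_pair.intro)
  have um[measurable]: "uminus \<in> measurable M (borel :: real measure)"
    unfolding measurable_cong_sets[OF sets_M refl] by measurable
  show "prob_space (distr M borel uminus)" by (rule prob_space_distr[OF um])
  show "(\<lambda>x. \<sigma> (- x)) \<in> borel_measurable borel" by measurable
  fix w :: complex assume w: "w \<notin> of_real ` {-R..R}"
  have w': "- w \<notin> of_real ` {-R..R}"
  proof
    assume "- w \<in> of_real ` {-R..R}"
    then obtain x where x: "x \<in> {-R..R}" "- w = of_real x" by blast
    then have "- x \<in> {-R..R}" by simp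
    moreover have "w = of_real (- x)" unfolding of_real_minus x(2)[symmetric] by simp
    ultimately show False using w by blast
  qed
  have sym: "uminus ` {-R..R} = {-R..R}" by simp
  have sq: "(w + of_real x)\<^sup>2 = (- w - of_real x)\<^sup>2" for x by (simp add: power2_eq_square algebra_simps)
  have f1: "(LBINT x:{-R..R}. of_real (\<sigma> (- x)) / (w - of_real x)\<^sup>2) = (LBINT x:{-R..R}. of_real (\<sigma> x) / (- w - of_real x)\<^sup>2)"
    by (subst set_integral_lborel_uminus) (simp only: sym minus_minus of_real_minus diff_minus_eq_add sq)
  have f2: "(LINT x:{-R..R}|distr M borel uminus. 1 / (w - of_real x)) = (LINT x:{-R..R}|M. 1 / (w + of_real x))"
    by (subst set_integral_distr_uminus[OF sets_M]) (auto simp: sym)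
  have f3: "(w + of_real a) * (LINT x:{-R..R}|M. 1 / (w + of_real x)) =
      (- w - of_real a) * (LINT x:{-R..R}|M. 1 / (- w - of_real x))"
  proof -
    have "1 / (- w - of_real x) = - (1 / (w + of_real x))" for x
    proof -
      have "- w - of_real x = - (w + of_real x)" by simp
      then show ?thesis by (simp only: minus_divide_right)
    qed
    then have "(LINT x:{-R..R}|M. 1 / (- w - of_real x)) = - (LINT x:{-R..R}|M. 1 / (w + of_real x))"
      by (simp only: set_lebesgue_integral_def scaleR_minus_right integral_minus)
    then show ?thesis by (simp add: algebra_simps)
  qed
  show "exp (1 / 2 * (LBINT x:{-R..R}. of_real (\<sigma> (- x)) / (w - of_real x)\<^sup>2)) =
      (w - of_real (- a)) * (LINT x:{-R..R}|distr M borel uminus. 1 / (w - of_real x))"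
    unfolding f1 f2 transform[OF w'] using f3 by (simp only: of_real_minus diff_minus_eq_add)
qed (use \<sigma>_bounds R a in auto)

context markov_pair
begin

text \<open>Both sides follow from \<open>right_excess\<close> with d = 1, the left one for the
  reflected pair. The condition 80 R^2 m <= 1 is exactly 8 m <= c for c = 1 / (10 R^2).\<close>

lemma outside_excess:
  assumes supp: "prob {-R..R} = 1" and m: "m = 1 - prob {-2..2}" "80 * R\<^sup>2 * m \<le> 1"
    and mean: "\<bar>LINT x:{-2..2}|M. x\<bar> \<le> 1 / 2"
  shows "(LBINT x:{2<..R}. \<sigma> x) \<le> excess_const R S (1 / (10 * R\<^sup>2)) * m"
    and "(LBINT x:{-R..<-2}. \<sigma> x) \<le> excess_const R S (1 / (10 * R\<^sup>2)) * m"
proof -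
  let ?c = "1 / (10 * R\<^sup>2)" and ?N = "distr M borel uminus"
  have c0: "0 < ?c" using R by simp
  have K: "0 \<le> excess_const R S ?c"
    unfolding excess_const_def using R S_nonneg c0 pi_ge_zero
    by (intro divide_nonneg_nonneg mult_nonneg_nonneg add_nonneg_nonneg) auto
  have um: "uminus \<in> measurable M (borel :: real measure)"
    unfolding measurable_cong_sets[OF sets_M refl] by measurable
  have ms: "A \<in> sets borel \<Longrightarrow> A \<in> sets M" for A using sets_M by simp
  have split: "prob {-R..<-2} + prob {-2..2} + prob {2<..R} = 1"
  proof -
    have "{-R..R} = {-R..<-2} \<union> {-2..2} \<union> {2<..R}" using R by auto
    then have "prob {-R..R} = prob ({-R..<-2} \<union> {-2..2} \<union> {2<..R})" by simp
    also have "\<dots> = prob ({-R..<-2} \<union> {-2..2}) + prob {2<..R}"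
      by (intro finite_measure_Union ms) auto
    also have "prob ({-R..<-2} \<union> {-2..2}) = prob {-R..<-2} + prob {-2..2}"
      by (intro finite_measure_Union ms) auto
    finally show ?thesis using supp by simp
  qed
  have m1: "prob {2<..R} \<le> m" "prob {-R..<-2} \<le> m"
    using split measure_nonneg[of M "{-R..<-2}"] measure_nonneg[of M "{2<..R}"] unfolding m(1) by linarith+
  have R2: "9 \<le> R\<^sup>2" using R power_mono[of 3 R 2] by simp
  have m0: "0 \<le> m" using m(1) by simp
  have m2: "m \<le> 1 / 4"
    using m(2) mult_right_mono[OF R2 m0] by simp
  have bi: "set_integrable M A f" if "A \<in> sets borel" "A \<subseteq> {-R..R}" "f \<in> borel_measurable borel" "\<And>x. x \<in> {-R..R} \<Longrightarrow> \<bar>f x\<bar> \<le> C"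
    for A and f :: "real \<Rightarrow> real" and C
    unfolding set_integrable_def
  proof (rule integrable_const_bound[where B = "\<bar>C\<bar>"])
    show "AE x in M. norm (indicator A x *\<^sub>R f x) \<le> \<bar>C\<bar>"
    proof (rule AE_I2)
      fix x show "norm (indicator A x *\<^sub>R f x) \<le> \<bar>C\<bar>"
        using that(2) that(4)[of x] by (cases "x \<in> A") auto
    qed
    show "(\<lambda>x. indicator A x *\<^sub>R f x) \<in> borel_measurable M"
      unfolding measurable_cong_sets[OF sets_M refl] using that(1,3) by measurable
  qed
  \<comment> \<open>The mass of [-2,2] is at least 3/4 and its mean at most 1/2 in modulus, so the
    integral is at least 3/2 - 1/2 = 1; hence d = 1 on either side.\<close>
  have lin: "1 \<le> (LINT x:{-2..2}|M. 2 + e * x)" if "\<bar>e\<bar> = 1" for e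
  proof -
    have "(LINT x:{-2..2}|M. 2 + e * x) = (LINT x:{-2..2}|M. 2) + (LINT x:{-2..2}|M. e * x)"
      by (intro set_integral_add(2) bi[of _ _ "2 + R"]) (use R in auto, use that R in \<open>auto simp: abs_mult\<close>)
    also have "\<dots> = 2 * prob {-2..2} + e * (LINT x:{-2..2}|M. x)"
      by (simp add: set_lebesgue_integral_def ms)
    also have "1 \<le> \<dots>"
      using m2 m(1) mean that abs_mult[of e "LINT x:{-2..2}|M. x"] by (simp add: abs_le_iff)
    finally show ?thesis .
  qed
  have small: "8 * prob {2<..R} \<le> ?c" "8 * prob {-R..<-2} \<le> ?c"
  proof -
    have "8 * m \<le> ?c" using m(2) R by (simp add: field_simps)
    then show "8 * prob {2<..R} \<le> ?c" "8 * prob {-R..<-2} \<le> ?c" using m1 by linarith+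
  qed
  have mono: "(LINT x:{-2..2}|M. f x) \<le> (LINT x:A|M. f x)"
    if A: "{-2..2} \<subseteq> A" "A \<subseteq> {-R..R}" "A \<in> sets borel" and f: "f \<in> borel_measurable borel" "\<And>x. x \<in> {-R..R} \<Longrightarrow> \<bar>f x\<bar> \<le> C" "\<And>x. x \<in> A \<Longrightarrow> 0 \<le> f x"
    for A C and f :: "real \<Rightarrow> real"
    unfolding set_lebesgue_integral_def
  proof (rule integral_mono)
    show "integrable M (\<lambda>x. indicator {-2..2} x *\<^sub>R f x)" "integrable M (\<lambda>x. indicator A x *\<^sub>R f x)"
      by (rule bi[of _ f C, unfolded set_integrable_def]; use A f R in auto)+
    show "indicator {-2..2} x *\<^sub>R f x \<le> indicator A x *\<^sub>R f x" for x
      using f(3)[of x] A by (auto simp: indicator_def)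
  qed
  have "(LINT x:{-2..2}|M. 2 + (-1) * x) \<le> (LINT x:{-R..2}|M. 2 + (-1) * x)"
    by (rule mono[of _ _ "2 + R"]) (use R in \<open>auto simp: abs_le_iff\<close>)
  with lin[of "-1"] have dR: "1 \<le> (LINT x:{-R..2}|M. 2 - x)" by simp
  have "(LBINT x:{2<..R}. \<sigma> x) \<le> excess_const R S ?c * prob {2<..R}"
    by (rule right_excess[of 1]) (use dR small in auto)
  also have "\<dots> \<le> excess_const R S ?c * m" by (intro mult_left_mono m1 K)
  finally show "(LBINT x:{2<..R}. \<sigma> x) \<le> excess_const R S ?c * m" .
  interpret N: markov_pair ?N "\<lambda>x. \<sigma> (- x)" "- a" R S by (rule markov_pair_uminus)
  have um1: "uminus ` {2<..R} = {-R..<-2}" "uminus ` {-R..2} = {-2..R}" by simp_all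
  have pN: "measure ?N {2<..R} = prob {-R..<-2}"
  proof -
    have "space M = UNIV" using sets_eq_imp_space_eq[OF sets_M] by simp
    moreover have "uminus -` {2<..R} = {-R..<-2}" by auto
    ultimately show ?thesis using measure_distr[OF um, of "{2<..R}"] by simp
  qed
  have "(LINT x:{-2..2}|M. 2 + 1 * x) \<le> (LINT x:{-2..R}|M. 2 + 1 * x)"
    by (rule mono[of _ _ "2 + R"]) (use R in \<open>auto simp: abs_le_iff\<close>)
  with lin[of 1] have "1 \<le> (LINT x:{-2..R}|M. 2 + x)" by simp
  then have dN: "1 \<le> (LINT x:{-R..2}|?N. 2 - x)"
    by (subst set_integral_distr_uminus[OF sets_M]) (simp_all only: um1, simp_all)
  have "(LBINT x:{-R..<-2}. \<sigma> x) = (LBINT x:{2<..R}. \<sigma> (- x))"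
    by (subst set_integral_lborel_uminus) simp
  also have "\<dots> \<le> excess_const R S ?c * measure ?N {2<..R}"
    by (rule N.right_excess[of 1]) (use dN small pN in auto)
  also have "\<dots> \<le> excess_const R S ?c * m" unfolding pN by (intro mult_left_mono m1 K)
  finally show "(LBINT x:{-R..<-2}. \<sigma> x) \<le> excess_const R S ?c * m" .
qed

end

section \<open>The Markov relation in terms of the excess\<close>

definition diagram_excess :: "(real \<Rightarrow> real) \<Rightarrow> real \<Rightarrow> real" where
  "diagram_excess \<omega> x = \<omega> x - \<bar>x - diagram_center \<omega>\<bar>"

text \<open>A function with Lipschitz constant 1 that equals |x - a| far out on both sides lies
  above |x - a|. The excess has Lipschitz constant 2 and vanishes at R + 1, at distance at most 2R +
  1 from any point of the segment, whence 4R + 2.\<close>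

lemma diagram_excess_props:
  assumes \<omega>: "diagram_supported_in \<omega> {A..B}" and R: "{A..B} \<subseteq> {-R..R}" "0 \<le> R"
  shows "0 \<le> diagram_excess \<omega> x" "diagram_excess \<omega> x \<le> 4 * R + 2"
    "x \<notin> {-R..R} \<Longrightarrow> diagram_excess \<omega> x = 0" "continuous_on UNIV (diagram_excess \<omega>)"
proof -
  let ?a = "diagram_center \<omega>"
  have lip: "\<bar>\<omega> x - \<omega> y\<bar> \<le> \<bar>x - y\<bar>" for x y
    using \<omega> by (auto simp: diagram_supported_in_def continual_diagram_def)
  have out: "\<omega> x = \<bar>x - ?a\<bar>" if "x \<notin> {-R..R}" for x
    using \<omega> that R(1) unfolding diagram_supported_in_def by blast
  show zero: "x \<notin> {-R..R} \<Longrightarrow> diagram_excess \<omega> x = 0" for x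
    using out by (simp add: diagram_excess_def)
  \<comment> \<open>A point beyond the segment, beyond x and beyond the centre, so that all absolute
    values at X and -X open with known signs.\<close>
  define X where "X = R + \<bar>x\<bar> + \<bar>?a\<bar> + 1"
  have X: "X \<notin> {-R..R}" "- X \<notin> {-R..R}" using R(2) by (auto simp: X_def)
  have Xa: "?a \<le> X" "- ?a \<le> X" using R(2) unfolding X_def by linarith+
  have "\<omega> X = X - ?a" "\<omega> (- X) = X + ?a"
    unfolding out[OF X(1)] out[OF X(2)] using Xa by simp_all
  moreover have "\<bar>X - x\<bar> = X - x" "\<bar>- X - x\<bar> = X + x" using R(2) unfolding X_def by linarith+
  ultimately have "x - ?a \<le> \<omega> x" "?a - x \<le> \<omega> x"
    using lip[of X x] lip[of "- X" x] by linarith+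
  then show "0 \<le> diagram_excess \<omega> x" unfolding diagram_excess_def by linarith
  have ex_lip: "\<bar>diagram_excess \<omega> x - diagram_excess \<omega> y\<bar> \<le> 2 * \<bar>x - y\<bar>" for x y
  proof -
    have tri: "\<bar>p - u - (q - v)\<bar> \<le> \<bar>p - q\<bar> + \<bar>u - v\<bar>" for p q u v :: real by linarith
    show ?thesis
      unfolding diagram_excess_def
      using tri[of "\<omega> x" "\<bar>x - ?a\<bar>" "\<omega> y" "\<bar>y - ?a\<bar>"] lip[of x y]
        abs_triangle_ineq3[of "x - ?a" "y - ?a"] by simp
  qed
  show "diagram_excess \<omega> x \<le> 4 * R + 2"
  proof (cases "x \<in> {-R..R}")
    case True
    then show ?thesis
      using ex_lip[of x "R + 1"] zero[of "R + 1"] by auto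
  qed (use zero R in auto)
  have "2-lipschitz_on UNIV (diagram_excess \<omega>)"
    using ex_lip by (intro lipschitz_onI) (auto simp: dist_real_def)
  then show "continuous_on UNIV (diagram_excess \<omega>)" by (rule lipschitz_on_continuous_on)
qed

lemma norm_exp_minus_1_le:
  fixes u :: complex
  assumes "norm u \<le> 1" shows "norm (exp u - 1) \<le> 3 * norm u"
proof -
  have "norm (exp u - 1) \<le> exp \<bar>Re u\<bar> * norm u"
    using Taylor_exp[of u 0] by simp
  also have "exp \<bar>Re u\<bar> \<le> exp 1" using abs_Re_le_cmod[of u] assms by simp
  then have "exp \<bar>Re u\<bar> * norm u \<le> 3 * norm u"
    by (intro mult_right_mono order_trans[OF _ exp_le]) auto
  finally show ?thesis .
qed

text \<open>Translates the condition on z into one on w = 1/z: a value r <= 0 of 1 - x/w forces w =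
  x / (1 - r), which falls back into the segment because 1 - r >= 1.\<close>

lemma segment_avoids_cut:
  fixes w :: complex
  assumes w: "w \<notin> of_real ` {-R..R}" and R: "0 \<le> R" and x: "x \<in> {-R..R}"
  shows "1 - 1 / w * of_real x \<notin> \<real>\<^sub>\<le>\<^sub>0"
proof
  have w0: "w \<noteq> 0" using w R by (metis atLeastAtMost_iff image_eqI neg_le_0_iff_le of_real_0)
  assume "1 - 1 / w * of_real x \<in> \<real>\<^sub>\<le>\<^sub>0"
  then obtain r where r: "1 - 1 / w * of_real x = of_real r" "r \<le> 0" by (auto elim: nonpos_Reals_cases)
  then have "of_real x = w * of_real (1 - r)" using w0 by (simp add: field_simps)
  moreover have nz: "complex_of_real (1 - r) \<noteq> 0" using r(2) by (simp only: of_real_eq_0_iff)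
  ultimately have w_eq: "w = of_real x / of_real (1 - r)" by (simp only: nonzero_eq_divide_eq[OF nz])
  define y where "y = x / (1 - r)"
  have "w = of_real y" unfolding w_eq y_def of_real_divide ..
  moreover have "\<bar>y\<bar> \<le> R"
    using x r(2) R frac_le[of R "\<bar>x\<bar>" 1 "1 - r"] by (auto simp: abs_le_iff abs_divide y_def)
  then have "y \<in> {-R..R}" by (auto simp: abs_le_iff)
  ultimately show False using w by blast
qed

lemma second_derivative_Ln_kernel:
  fixes w :: complex
  assumes w: "w \<notin> of_real ` {-R..R}" and R: "0 \<le> R" and x: "x \<in> {-R..R}"
  shows "vector_derivative (\<lambda>t. vector_derivative (\<lambda>x. Ln (1 - 1 / w * of_real x)) (at t)) (at x) = - (1 / (w - of_real x)\<^sup>2)"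
proof -
  have w0: "w \<noteq> 0" using w R by (metis atLeastAtMost_iff image_eqI neg_le_0_iff_le of_real_0)
  let ?z = "1 / w"
  let ?U = "(\<lambda>t. 1 - ?z * of_real t) -` (- \<real>\<^sub>\<le>\<^sub>0) :: real set"
  have U: "open ?U"
    by (intro open_vimage open_Compl closed_nonpos_Reals_complex continuous_intros)
  have xU: "x \<in> ?U" using segment_avoids_cut[OF w R x] by simp
  have nz: "1 - ?z * of_real t \<noteq> 0" if "t \<in> ?U" for t using that by auto
  have d1: "((\<lambda>x. Ln (1 - ?z * of_real x)) has_vector_derivative - ?z / (1 - ?z * of_real t)) (at t)"
    if "t \<in> ?U" for t
  proof -
    have "((\<lambda>u. Ln (1 - ?z * u)) has_field_derivative - ?z / (1 - ?z * of_real t)) (at (of_real t))"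
      using that nz[OF that] by (auto intro!: derivative_eq_intros simp: field_simps)
    then show ?thesis by (rule has_vector_derivative_real_field)
  qed
  have d2: "((\<lambda>t. - ?z / (1 - ?z * of_real t)) has_vector_derivative - (1 / (w - of_real x)\<^sup>2)) (at x)"
  proof -
    have D: "((\<lambda>u. - ?z / (1 - ?z * u)) has_field_derivative - (?z * ?z) / (1 - ?z * of_real x)\<^sup>2) (at (of_real x))"
      using nz[OF xU] w0 by (auto intro!: derivative_eq_intros simp: power2_eq_square)
    have E: "- (?z * ?z) / (1 - ?z * of_real x)\<^sup>2 = - (1 / (w - of_real x)\<^sup>2)"
    proof -
      have "w - of_real x = w * (1 - ?z * of_real x)" using w0 by (simp add: field_simps)
      then show ?thesis using w0 by (simp add: power_mult_distrib power2_eq_square)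
    qed
    show ?thesis by (rule has_vector_derivative_real_field[OF D, unfolded E])
  qed
  have eq: "- ?z / (1 - ?z * of_real t) = vector_derivative (\<lambda>x. Ln (1 - ?z * of_real x)) (at t)"
    if "t \<in> ?U" for t
    using vector_derivative_at[OF d1[OF that]] by (rule sym)
  show ?thesis
    by (rule vector_derivative_at[OF has_vector_derivative_transform_within_open[OF d2 U xU eq]])
qed

text \<open>Put z = 1/w. The centre contributes 2 Ln(1 - a/w), whose exponential is elementary, and
  the excess is paired with -1 / (w - x)^2. After the factor (w - a)/w is moved across, the
  remaining integrals contain w only through w - x.\<close>

lemma markov_exp_identity:
  fixes w :: complex
  assumes mk: "is_markov_transform {A..B} \<omega> \<mu>" and R: "{A..B} \<subseteq> {-R..R}" "0 \<le> R"
    and w: "w \<notin> of_real ` {-R..R}" and wa: "w \<noteq> of_real (diagram_center \<omega>)"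
  shows "exp (1 / 2 * (LBINT x:{-R..R}. of_real (diagram_excess \<omega> x) / (w - of_real x)\<^sup>2)) =
    (w - of_real (diagram_center \<omega>)) * (LINT x:{-R..R}|\<mu>. 1 / (w - of_real x))"
proof -
  let ?a = "diagram_center \<omega>" and ?z = "1 / w"
  have w0: "w \<noteq> 0" using w R by (metis atLeastAtMost_iff image_eqI neg_le_0_iff_le of_real_0)
  have \<omega>: "diagram_supported_in \<omega> {A..B}" and "prob_space \<mu>" and sets: "sets \<mu> = sets borel"
    and em: "emeasure \<mu> {A..B} = 1"
    and tr: "\<And>z::complex. (\<forall>x\<in>{A..B}. 1 - z * of_real x \<notin> \<real>\<^sub>\<le>\<^sub>0) \<Longrightarrow>
        exp (- (1/2) * integral_dderiv \<omega> (\<lambda>x. Ln (1 - z * of_real x))) = (LINT x|\<mu>. 1 / (1 - z * of_real x))"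
    using mk unfolding is_markov_transform_def by blast+
  interpret prob_space \<mu> by fact
  note ex = diagram_excess_props[OF \<omega> R]
  note slit = segment_avoids_cut[OF w R(2)]
  have "integral_dderiv \<omega> (\<lambda>x. Ln (1 - ?z * of_real x)) =
      2 * Ln (1 - ?z * of_real ?a) - (LBINT x:{-R..R}. of_real (diagram_excess \<omega> x) / (w - of_real x)\<^sup>2)"
  proof -
    have "(\<omega> x - \<bar>x - ?a\<bar>) *\<^sub>R vector_derivative (\<lambda>t. vector_derivative (\<lambda>x. Ln (1 - ?z * of_real x)) (at t)) (at x) =
        - (indicator {-R..R} x *\<^sub>R (of_real (diagram_excess \<omega> x) / (w - of_real x)\<^sup>2))" for x
    proof (cases "x \<in> {-R..R}")
      case True
      show ?thesis
        unfolding second_derivative_Ln_kernel[OF w R(2) True] diagram_excess_def[symmetric]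
        using True by (simp add: scaleR_conv_of_real)
    next
      \<comment> \<open>Here the logarithm may meet its cut and the derivative may be a meaningless
        default value; the vanishing excess removes it.\<close>
      case False
      then have "\<omega> x - \<bar>x - ?a\<bar> = 0" using ex(3)[OF False] by (simp add: diagram_excess_def)
      then show ?thesis using False by simp
    qed
    then show ?thesis
      unfolding integral_dderiv_def set_lebesgue_integral_def by (simp only: integral_minus diff_conv_add_uminus)
  qed
  moreover have "exp (- (1/2) * (2 * L - I)) = exp (1/2 * I) / exp L" for L I :: complex
    by (simp add: exp_diff[symmetric] algebra_simps)
  moreover have "exp (Ln (1 - ?z * of_real ?a)) = (w - of_real ?a) / w"
    using w0 wa by (simp add: exp_Ln field_simps)
  moreover have "exp (- (1/2) * integral_dderiv \<omega> (\<lambda>x. Ln (1 - ?z * of_real x))) = (LINT x|\<mu>. 1 / (1 - ?z * of_real x))"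
    by (rule tr) (use slit R in auto)
  moreover have "(LINT x|\<mu>. 1 / (1 - ?z * of_real x)) = w * (LINT x:{-R..R}|\<mu>. 1 / (w - of_real x))"
  proof -
    have meas: "{-R..R} \<in> sets \<mu>" using sets by simp
    have "prob {A..B} = 1" using em by (simp add: measure_def)
    then have ae: "AE x in \<mu>. x \<in> {A..B}" by (subst (asm) prob_eq_1) (auto simp: sets)
    have "(LINT x|\<mu>. 1 / (1 - ?z * of_real x)) = (LINT x|\<mu>. w * (indicator {-R..R} x *\<^sub>R (1 / (w - of_real x))))"
    proof (rule integral_cong_AE)
      show "(\<lambda>x. 1 / (1 - ?z * of_real x)) \<in> borel_measurable \<mu>"
        unfolding measurable_cong_sets[OF sets refl] by measurable
      show "(\<lambda>x. w * (indicator {-R..R} x *\<^sub>R (1 / (w - of_real x)))) \<in> borel_measurable \<mu>"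
        unfolding measurable_cong_sets[OF sets refl] by measurable
      show "AE x in \<mu>. 1 / (1 - ?z * of_real x) = w * (indicator {-R..R} x *\<^sub>R (1 / (w - of_real x)))"
        using ae
      proof eventually_elim
        fix x assume "x \<in> {A..B}"
        then have "x \<in> {-R..R}" using R by blast
        moreover have "1 / (1 - ?z * of_real x) = w * (1 / (w - of_real x))"
        proof -
          have "w - of_real x = w * (1 - ?z * of_real x)" using w0 by (simp add: field_simps)
          then show ?thesis using w0 by simp
        qed
        ultimately show "1 / (1 - ?z * of_real x) = w * (indicator {-R..R} x *\<^sub>R (1 / (w - of_real x)))" by simp
      qed
    qed
    then show ?thesis by (simp only: set_lebesgue_integral_def integral_mult_right_zero)
  qed
  ultimately have "exp (1/2 * (LBINT x:{-R..R}. of_real (diagram_excess \<omega> x) / (w - of_real x)\<^sup>2)) / ((w - of_real ?a) / w) =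
      w * (LINT x:{-R..R}|\<mu>. 1 / (w - of_real x))" by (simp only:)
  moreover have nz: "(w - of_real ?a) / w \<noteq> 0" using w0 wa by simp
  ultimately show ?thesis using w0 by (simp only: nonzero_divide_eq_eq[OF nz]) (simp add: mult.commute)
qed

text \<open>Compare both sides at w -> infinity along the real axis. The exponent is of order 1/w^2,
  so w (exp - 1) tends to 0, while the other side tends to the mean minus the centre.\<close>

lemma markov_center_eq_mean:
  assumes mk: "is_markov_transform {A..B} \<omega> \<mu>" and R: "{A..B} \<subseteq> {-R..R}" "0 < R"
  shows "diagram_center \<omega> = (LINT x:{-R..R}|\<mu>. x)" and "measure \<mu> {-R..R} = 1"
proof -
  let ?a = "diagram_center \<omega>"
  have R0: "0 \<le> R" using R by simp
  have \<omega>: "diagram_supported_in \<omega> {A..B}" and "prob_space \<mu>" and sets: "sets \<mu> = sets borel"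
    and em: "emeasure \<mu> {A..B} = 1"
    using mk unfolding is_markov_transform_def by blast+
  interpret prob_space \<mu> by fact
  have meas: "{-R..R} \<in> sets \<mu>" using sets by simp
  show p1: "measure \<mu> {-R..R} = 1"
  proof -
    have "prob {A..B} \<le> prob {-R..R}" by (rule finite_measure_mono) (use R meas in auto)
    moreover have "prob {A..B} = 1" using em by (simp add: measure_def)
    ultimately show ?thesis using prob_le_1[of "{-R..R}"] by linarith
  qed
  note ex = diagram_excess_props[OF \<omega> R(1) R0]
  \<comment> \<open>Real points to the right of the segment and of the centre, at distance at least
    R + 1 + n from the segment.\<close>
  define w where "w n = complex_of_real (2 * R + \<bar>?a\<bar> + 1 + real n)" for n
  have Re_w: "Re (w n) = 2 * R + \<bar>?a\<bar> + 1 + real n" for n by (simp add: w_def)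
  have far: "R + 1 + real n \<le> norm (w n - of_real x)" if "x \<in> {-R..R}" for x n
  proof -
    have "x \<le> R" using that by simp
    then have "R + 1 + real n \<le> Re (w n - of_real x)"
      unfolding minus_complex.simps Re_w Re_complex_of_real using abs_ge_zero[of ?a] R(2) by linarith
    then show ?thesis using complex_Re_le_cmod order_trans by blast
  qed
  have wn: "w n \<notin> of_real ` {-R..R}" "w n \<noteq> of_real ?a" "w n \<noteq> 0" for n
    using R(2) by (auto simp: complex_eq_iff Re_w image_iff)
  have norm_w: "norm (w n) = 2 * R + \<bar>?a\<bar> + 1 + real n" for n
    unfolding w_def norm_of_real using R by simp
  have inv: "(\<lambda>n. 1 / (w n - of_real x)) \<longlonglongrightarrow> 0" if "x \<in> {-R..R}" for x
  proof (rule Lim_null_comparison)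
    show "eventually (\<lambda>n. norm (1 / (w n - of_real x)) \<le> inverse (real (Suc n))) sequentially"
    proof (rule always_eventually, rule allI)
      fix n
      have "real (Suc n) \<le> norm (w n - of_real x)" using far[OF that, of n] R(2) by simp
      then show "norm (1 / (w n - of_real x)) \<le> inverse (real (Suc n))"
        by (simp add: norm_divide inverse_eq_divide frac_le)
    qed
    show "(\<lambda>n. inverse (real (Suc n))) \<longlonglongrightarrow> 0" by (rule LIMSEQ_inverse_real_of_nat)
  qed
  have wfrac: "w n / (w n - of_real x) = 1 + of_real x * (1 / (w n - of_real x))" if "x \<in> {-R..R}" for x n
  proof -
    have "w n - of_real x \<noteq> 0" using wn(1)[of n] that by auto
    then show ?thesis by (simp add: field_simps)
  qed
  have fb: "norm (1 / (w n - of_real x)) \<le> 1" if "x \<in> {-R..R}" for x n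
    using frac_le[of 1 1 1 "norm (w n - of_real x)"] far[OF that, of n] R(2) by (simp add: norm_divide)
  have fb': "norm (w n / (w n - of_real x)) \<le> 1 + R" if "x \<in> {-R..R}" for x n
  proof -
    have "norm (of_real x * (1 / (w n - of_real x))) \<le> R * 1"
      unfolding norm_mult norm_of_real by (rule mult_mono) (use fb[OF that] that R(2) in auto)
    then show ?thesis
      unfolding wfrac[OF that] using norm_triangle_ineq[of 1 "of_real x * (1 / (w n - of_real x))"] by simp
  qed
  let ?I = "\<lambda>x. indicator {-R..R} x :: real"
  have lim: "(\<lambda>n. LINT x:{-R..R}|\<mu>. f x * (w n / (w n - of_real x))) \<longlonglongrightarrow> (LINT x:{-R..R}|\<mu>. f x)"
    "\<And>n. set_integrable \<mu> {-R..R} (\<lambda>x. f x * (w n / (w n - of_real x)))"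
    "set_integrable \<mu> {-R..R} f"
    if f: "f \<in> borel_measurable borel" "\<And>x. x \<in> {-R..R} \<Longrightarrow> norm (f x) \<le> C" for f :: "real \<Rightarrow> complex" and C
  proof -
    have C0: "0 \<le> C" using f(2)[of 0] R by (auto intro: order_trans[OF norm_ge_zero])
    have m1: "(\<lambda>x. ?I x *\<^sub>R f x) \<in> borel_measurable \<mu>"
      "\<And>n. (\<lambda>x. ?I x *\<^sub>R (f x * (w n / (w n - of_real x)))) \<in> borel_measurable \<mu>"
      unfolding measurable_cong_sets[OF sets refl] using f(1) by measurable
    have b: "AE x in \<mu>. norm (?I x *\<^sub>R (f x * (w n / (w n - of_real x)))) \<le> C * (1 + R)" for n
    proof (rule AE_I2)
      fix x
      show "norm (?I x *\<^sub>R (f x * (w n / (w n - of_real x)))) \<le> C * (1 + R)"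
      proof (cases "x \<in> {-R..R}")
        case True
        have "norm (f x * (w n / (w n - of_real x))) \<le> C * (1 + R)"
          unfolding norm_mult by (rule mult_mono[OF f(2)[OF True] fb'[OF True] C0]) auto
        then show ?thesis using True by simp
      qed (use C0 R in simp)
    qed
    have pt: "AE x in \<mu>. (\<lambda>n. ?I x *\<^sub>R (f x * (w n / (w n - of_real x)))) \<longlonglongrightarrow> ?I x *\<^sub>R f x"
    proof (rule AE_I2)
      fix x show "(\<lambda>n. ?I x *\<^sub>R (f x * (w n / (w n - of_real x)))) \<longlonglongrightarrow> ?I x *\<^sub>R f x"
      proof (cases "x \<in> {-R..R}")
        case True
        have "(\<lambda>n. f x * (1 + of_real x * (1 / (w n - of_real x)))) \<longlonglongrightarrow> f x * (1 + of_real x * 0)"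
          by (intro tendsto_intros inv True)
        then show ?thesis using True by (simp add: wfrac)
      qed simp
    qed
    have cint: "integrable \<mu> (\<lambda>_. C * (1 + R))" by simp
    show "(\<lambda>n. LINT x:{-R..R}|\<mu>. f x * (w n / (w n - of_real x))) \<longlonglongrightarrow> (LINT x:{-R..R}|\<mu>. f x)"
      unfolding set_lebesgue_integral_def by (rule integral_dominated_convergence[OF m1(1) m1(2) cint pt b])
    show "set_integrable \<mu> {-R..R} (\<lambda>x. f x * (w n / (w n - of_real x)))" for n
      unfolding set_integrable_def by (rule integrable_dominated_convergence2[OF m1(1) m1(2) cint pt b])
    show "set_integrable \<mu> {-R..R} f"
      unfolding set_integrable_def by (rule integrable_dominated_convergence[OF m1(1) m1(2) cint pt b])
  qed
  have l1: "norm (1::complex) \<le> 1" "x \<in> {-R..R} \<Longrightarrow> norm (complex_of_real x) \<le> R" for x by auto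
  have one: "(LINT x:{-R..R}|\<mu>. 1 :: complex) = 1"
    using set_integral_complex_of_real[of \<mu> "{-R..R}" "\<lambda>_. 1"] p1 meas
    by (simp add: set_lebesgue_integral_def)
  define I where "I n = 1 / 2 * (LBINT x:{-R..R}. of_real (diagram_excess \<omega> x) / (w n - of_real x)\<^sup>2)" for n
  \<comment> \<open>With J the integral of w/(w - x), the relation reads w exp(I) = (w - a) J, and
    the integral of x w/(w - x) is w (J - 1). Subtracting w leaves w (J - 1) - a J, which has a
    limit by dominated convergence.\<close>
  have id: "w n * (exp (I n) - 1) = (LINT x:{-R..R}|\<mu>. of_real x * (w n / (w n - of_real x))) -
      of_real ?a * (LINT x:{-R..R}|\<mu>. 1 * (w n / (w n - of_real x)))" for n
  proof -
    have i1: "set_integrable \<mu> {-R..R} (\<lambda>x. 1 * (w n / (w n - of_real x)))" by (rule lim(2)[OF _ l1(1)]) simp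
    have i0: "set_integrable \<mu> {-R..R} (\<lambda>x. 1 :: complex)" by (rule lim(3)[OF _ l1(1)]) simp
    have "(LINT x:{-R..R}|\<mu>. of_real x * (w n / (w n - of_real x))) =
        (LINT x:{-R..R}|\<mu>. w n * (1 * (w n / (w n - of_real x)) - 1))"
    proof (rule set_lebesgue_integral_cong[OF meas], intro allI impI)
      fix x assume "x \<in> {-R..R}"
      then have "w n - of_real x \<noteq> 0" using wn(1)[of n] by auto
      then show "of_real x * (w n / (w n - of_real x)) = w n * (1 * (w n / (w n - of_real x)) - 1)"
        by (simp add: field_simps)
    qed
    also have "\<dots> = w n * ((LINT x:{-R..R}|\<mu>. 1 * (w n / (w n - of_real x))) - 1)"
      unfolding set_integral_mult_right set_integral_diff(2)[OF i1 i0] one ..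
    finally have e1: "(LINT x:{-R..R}|\<mu>. of_real x * (w n / (w n - of_real x))) =
        w n * ((LINT x:{-R..R}|\<mu>. 1 * (w n / (w n - of_real x))) - 1)" .
    have e2: "(LINT x:{-R..R}|\<mu>. 1 * (w n / (w n - of_real x))) = w n * (LINT x:{-R..R}|\<mu>. 1 / (w n - of_real x))"
      unfolding set_integral_mult_right[symmetric] by simp
    have E: "exp (I n) = (w n - of_real ?a) * (LINT x:{-R..R}|\<mu>. 1 / (w n - of_real x))"
      unfolding I_def by (rule markov_exp_identity[OF mk R(1) R0 wn(1,2)])
    show ?thesis unfolding e1 e2 E by (simp add: algebra_simps)
  qed
  have "(\<lambda>n. w n * (exp (I n) - 1)) \<longlonglongrightarrow> (LINT x:{-R..R}|\<mu>. of_real x) - of_real ?a * (LINT x:{-R..R}|\<mu>. 1)"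
    unfolding id by (intro tendsto_diff tendsto_mult tendsto_const lim(1)[OF _ l1(1)] lim(1)[OF _ l1(2)]) auto
  moreover have "(\<lambda>n. w n * (exp (I n) - 1)) \<longlonglongrightarrow> 0"
  proof -
    \<comment> \<open>The bound 4R + 2 of the excess times the length 2R of the segment.\<close>
    define D where "D = (4 * R + 2) * (2 * R)"
    have D0: "0 \<le> D" using R by (simp add: D_def)
    have In: "norm (I n) \<le> D / (R + 1 + real n)\<^sup>2" for n
    proof -
      have pos: "0 < R + 1 + real n" using R by simp
      have cn: "continuous_on {-R..R} (\<lambda>x. of_real (diagram_excess \<omega> x) / (w n - of_real x)\<^sup>2)"
        by (intro continuous_intros continuous_on_subset[OF ex(4)]) (use wn(1)[of n] in auto)
      have "norm (LBINT x:{-R..R}. of_real (diagram_excess \<omega> x) / (w n - of_real x)\<^sup>2) \<le>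
          (LBINT x:{-R..R}. norm (of_real (diagram_excess \<omega> x) / (w n - of_real x)\<^sup>2))"
        by (intro set_integral_norm_bound set_integrable_continuous cn)
      also have "\<dots> \<le> (LBINT x:{-R..R}. (4 * R + 2) / (R + 1 + real n)\<^sup>2)"
      proof (rule set_integral_mono)
        show "set_integrable lborel {-R..R} (\<lambda>x. norm (of_real (diagram_excess \<omega> x) / (w n - of_real x)\<^sup>2))"
          by (intro set_integrable_norm set_integrable_continuous cn)
        show "set_integrable lborel {-R..R} (\<lambda>x. (4 * R + 2) / (R + 1 + real n)\<^sup>2)"
          by (intro set_integrable_continuous continuous_intros) (use pos in auto)
        show "norm (of_real (diagram_excess \<omega> x) / (w n - of_real x)\<^sup>2) \<le> (4 * R + 2) / (R + 1 + real n)\<^sup>2" if "x \<in> {-R..R}" for x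
          using ex(1,2)[of x] far[OF that, of n] pos
          by (auto simp: norm_divide norm_power intro!: frac_le power_mono)
      qed
      also have "\<dots> = D / (R + 1 + real n)\<^sup>2"
        using R by (simp add: set_lebesgue_integral_def D_def)
      finally have "norm (LBINT x:{-R..R}. of_real (diagram_excess \<omega> x) / (w n - of_real x)\<^sup>2) \<le> D / (R + 1 + real n)\<^sup>2" .
      then show ?thesis by (rule order_trans[rotated]) (simp add: I_def norm_mult)
    qed
    show ?thesis
    proof (rule Lim_null_comparison)
      have "(\<lambda>n. D / (R + 1 + real n)\<^sup>2) \<longlonglongrightarrow> 0" by real_asymp
      then have "eventually (\<lambda>n. D / (R + 1 + real n)\<^sup>2 < 1) sequentially" by (rule order_tendstoD) simp
      then show "eventually (\<lambda>n. norm (w n * (exp (I n) - 1)) \<le> (2 * R + \<bar>?a\<bar> + 1 + real n) * (3 * (D / (R + 1 + real n)\<^sup>2))) sequentially"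
      proof eventually_elim
        fix n assume n: "D / (R + 1 + real n)\<^sup>2 < 1"
        have "norm (exp (I n) - 1) \<le> 3 * norm (I n)" using In[of n] n by (intro norm_exp_minus_1_le) linarith
        also have "\<dots> \<le> 3 * (D / (R + 1 + real n)\<^sup>2)" using In[of n] by simp
        finally show "norm (w n * (exp (I n) - 1)) \<le> (2 * R + \<bar>?a\<bar> + 1 + real n) * (3 * (D / (R + 1 + real n)\<^sup>2))"
          unfolding norm_mult norm_w by (rule mult_left_mono) (use R in auto)
      qed
      show "(\<lambda>n. (2 * R + \<bar>?a\<bar> + 1 + real n) * (3 * (D / (R + 1 + real n)\<^sup>2))) \<longlonglongrightarrow> 0"
      proof -
        have "(\<lambda>n. (E + real n) / (F + real n)\<^sup>2) \<longlonglongrightarrow> 0" for E F :: real by real_asymp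
        from tendsto_mult_left[OF this[of "2 * R + \<bar>?a\<bar> + 1" "R + 1"], of "3 * D"]
        show ?thesis by (simp add: mult_ac)
      qed
    qed
  qed
  ultimately have "(LINT x:{-R..R}|\<mu>. of_real x) - of_real ?a * (LINT x:{-R..R}|\<mu>. 1) = (0 :: complex)"
    by (rule LIMSEQ_unique)
  then have "complex_of_real ?a = of_real (LINT x:{-R..R}|\<mu>. x)"
    by (simp add: set_integral_complex_of_real one)
  then show "?a = (LINT x:{-R..R}|\<mu>. x)" by (simp only: of_real_eq_iff)
qed

lemma markov_pair_of_transform:
  assumes mk: "is_markov_transform {A..B} \<omega> \<mu>" and R: "{A..B} \<subseteq> {-R..R}" "3 \<le> R"
    and a: "\<bar>diagram_center \<omega>\<bar> \<le> 1"
  shows "markov_pair \<mu> (diagram_excess \<omega>) (diagram_center \<omega>) R (4 * R + 2)"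
proof -
  have R0: "0 \<le> R" using R by simp
  have \<omega>: "diagram_supported_in \<omega> {A..B}" and "prob_space \<mu>" and sets: "sets \<mu> = sets borel"
    using mk unfolding is_markov_transform_def by blast+
  note ex = diagram_excess_props[OF \<omega> R(1) R0]
  show ?thesis
  proof (rule markov_pair.intro)
    show "diagram_excess \<omega> \<in> borel_measurable borel" by (rule borel_measurable_continuous_onI[OF ex(4)])
    fix w :: complex assume w: "w \<notin> of_real ` {-R..R}"
    then have "w \<noteq> of_real (diagram_center \<omega>)" using a R by (auto simp: image_iff abs_le_iff)
    from markov_exp_identity[OF mk R(1) R0 w this]
    show "exp (1 / 2 * (LBINT x:{-R..R}. of_real (diagram_excess \<omega> x) / (w - of_real x)\<^sup>2)) =
      (w - of_real (diagram_center \<omega>)) * (LINT x:{-R..R}|\<mu>. 1 / (w - of_real x))" .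
  qed (use ex R a sets \<open>prob_space \<mu>\<close> in auto)
qed

section \<open>Fluctuations of the measures\<close>

lemma set_integrable_continuous_finite_measure:
  fixes f :: "real \<Rightarrow> 'a::{banach, second_countable_topology}"
  assumes N: "finite_measure N" "sets N = sets borel" and f: "continuous_on {a..b} f"
  shows "set_integrable N {a..b} f"
proof -
  interpret finite_measure N by fact
  obtain C where C: "\<And>x. x \<in> {a..b} \<Longrightarrow> norm (f x) \<le> C"
    using compact_imp_bounded[OF compact_continuous_image[OF f]] unfolding bounded_iff by (metis compact_Icc imageI)
  show ?thesis
    unfolding set_integrable_def
  proof (rule integrable_const_bound[where B = "\<bar>C\<bar>"])
    show "AE x in N. norm (indicator {a..b} x *\<^sub>R f x) \<le> \<bar>C\<bar>"
    proof (rule AE_I2)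
      fix x show "norm (indicator {a..b} x *\<^sub>R f x) \<le> \<bar>C\<bar>"
        using C[of x] by (cases "x \<in> {a..b}") auto
    qed
    show "(\<lambda>x. indicator {a..b} x *\<^sub>R f x) \<in> borel_measurable N"
      unfolding measurable_cong_sets[OF N(2) refl]
      by (rule borel_measurable_continuous_on_indicator[OF _ f]) simp
  qed
qed

lemma set_integral_suminf_bounded:
  fixes f :: "nat \<Rightarrow> real \<Rightarrow> 'a::{banach, second_countable_topology}"
  assumes N: "finite_measure N" "sets N = sets borel" and f: "\<And>j. continuous_on {a..b} (f j)"
    and B: "\<And>j x. x \<in> {a..b} \<Longrightarrow> norm (f j x) \<le> B j" "\<And>j. 0 \<le> B j" "summable B"
  shows "(\<lambda>j. LINT x:{a..b}|N. f j x) sums (LINT x:{a..b}|N. (\<Sum>j. f j x))"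
proof -
  interpret finite_measure N by fact
  have int: "integrable N (\<lambda>x. indicator {a..b} x *\<^sub>R f j x)" for j
    using set_integrable_continuous_finite_measure[OF N f] by (simp add: set_integrable_def)
  have bd: "norm (indicator {a..b} x *\<^sub>R f j x) \<le> B j" for x j
    using B(1)[of x j] B(2)[of j] by (cases "x \<in> {a..b}") auto
  have "(\<lambda>j. LINT x|N. indicator {a..b} x *\<^sub>R f j x) sums (LINT x|N. (\<Sum>j. indicator {a..b} x *\<^sub>R f j x))"
  proof (rule sums_integral[OF int])
    show "AE x in N. summable (\<lambda>j. norm (indicator {a..b} x *\<^sub>R f j x))"
      by (rule AE_I2, rule summable_comparison_test'[OF B(3), of 0]) (use bd in auto)
    show "summable (\<lambda>j. LINT x|N. norm (indicator {a..b} x *\<^sub>R f j x))"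
    proof (rule summable_comparison_test'[OF summable_mult2[OF B(3), of "measure N (space N)"], of 0])
      fix j
      have "(LINT x|N. norm (indicator {a..b} x *\<^sub>R f j x)) \<le> (LINT x|N. B j)"
        by (intro integral_mono integrable_norm int bd) simp
      then show "norm (LINT x|N. norm (indicator {a..b} x *\<^sub>R f j x)) \<le> B j * measure N (space N)"
        by (simp add: mult.commute)
    qed
  qed
  moreover have "(\<Sum>j. indicator {a..b} x *\<^sub>R f j x) = indicator {a..b} x *\<^sub>R (\<Sum>j. f j x)" for x
    by (cases "x \<in> {a..b}") auto
  ultimately show ?thesis by (simp add: set_lebesgue_integral_def)
qed

section \<open>Moments of the semicircle law\<close>

lemma sets_semicircle: "sets semicircle = sets borel"
  by (simp add: semicircle_def)

lemma semicircle_integral: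
  fixes \<phi> :: "real \<Rightarrow> complex"
  assumes \<phi>: "continuous_on {-2..2} \<phi>"
  shows "(LINT x:{-2..2}|semicircle. \<phi> x) = (LBINT x:{-2..2}. \<phi> x * of_real (sqrt (4 - x\<^sup>2) / (2 * pi)))"
proof -
  have "(LINT x|semicircle. indicator {-2..2} x *\<^sub>R \<phi> x) =
      (LBINT x. (1 / (2 * pi) * sqrt (max (4 - x\<^sup>2) 0)) *\<^sub>R (indicator {-2..2} x *\<^sub>R \<phi> x))"
    unfolding semicircle_def
  proof (rule integral_density)
    show "(\<lambda>x. indicator {-2..2} x *\<^sub>R \<phi> x) \<in> borel_measurable lborel"
      using borel_measurable_continuous_on_indicator[OF _ \<phi>] by simp
  qed auto
  also have "\<dots> = (LBINT x. indicator {-2..2} x *\<^sub>R (\<phi> x * of_real (sqrt (4 - x\<^sup>2) / (2 * pi))))"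
  proof (rule Bochner_Integration.integral_cong[OF refl])
    fix x :: real
    have "x\<^sup>2 \<le> 4" if "x \<in> {-2..2}" using that abs_le_square_iff[of x 2] by auto
    then show "(1 / (2 * pi) * sqrt (max (4 - x\<^sup>2) 0)) *\<^sub>R (indicator {-2..2} x *\<^sub>R \<phi> x) =
        indicator {-2..2} x *\<^sub>R (\<phi> x * of_real (sqrt (4 - x\<^sup>2) / (2 * pi)))"
      by (cases "x \<in> {-2..2}") (auto simp: scaleR_conv_of_real mult.commute)
  qed
  finally show ?thesis by (simp only: set_lebesgue_integral_def)
qed

lemma finite_measure_semicircle: "finite_measure semicircle"
proof (rule finite_measureI)
  have eq: "1 / (2 * pi) * sqrt (max (4 - x\<^sup>2) 0) = indicator {-2..2} x *\<^sub>R (sqrt (4 - x\<^sup>2) / (2 * pi))" for x :: real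
  proof (cases "x \<in> {-2..2}")
    case True
    then have "x\<^sup>2 \<le> 4" using abs_le_square_iff[of x 2] by auto
    then show ?thesis using True by simp
  next
    case False
    then have "4 \<le> x\<^sup>2" using abs_le_square_iff[of 2 x] by auto
    then show ?thesis using False by simp
  qed
  have "integrable lborel (\<lambda>x. indicator {-2..2} x *\<^sub>R (sqrt (4 - x\<^sup>2) / (2 * pi)))"
    by (intro borel_integrable_compact continuous_intros) auto
  then have i: "integrable lborel (\<lambda>x. 1 / (2 * pi) * sqrt (max (4 - x\<^sup>2) 0))" unfolding eq .
  have "emeasure semicircle (space semicircle) = (\<integral>\<^sup>+x. ennreal (1 / (2 * pi) * sqrt (max (4 - x\<^sup>2) 0)) \<partial>lborel)"
    unfolding semicircle_def by (subst emeasure_density) auto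
  also have "\<dots> = ennreal (LBINT x. 1 / (2 * pi) * sqrt (max (4 - x\<^sup>2) 0))"
    by (rule nn_integral_eq_integral[OF i]) auto
  finally show "emeasure semicircle (space semicircle) \<noteq> \<infinity>" by simp
qed

lemma semicircle_cheb_U:
  "(LINT x:{-2..2}|semicircle. complex_of_real (U_half k x)) = (if k = 0 then 1 else 0)"
proof -
  have "(LINT x:{-2..2}|semicircle. complex_of_real (U_half k x)) =
      (LBINT x:{-2..2}. of_real (U_half 0 x * (U_half k x * (sqrt (4 - x\<^sup>2) / (2 * pi)))))"
    by (subst semicircle_integral) (auto intro!: continuous_intros)
  also have "\<dots> = (if k = 0 then 1 else 0)"
    unfolding set_integral_complex_of_real cheb_U_orthogonal by simp
  finally show ?thesis .
qed

lemma continuous_on_cheb_denom [continuous_intros]: "continuous_on S (cheb_denom z)"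
  unfolding cheb_denom_def by (intro continuous_intros)

lemma continuous_on_inverse_cheb_denom:
  "norm z < 1 \<Longrightarrow> continuous_on {-2..2} (\<lambda>x. 1 / cheb_denom z x)"
  by (intro continuous_intros) (use cheb_denom_nonzero[of _ z] in auto)

text \<open>Makes real polynomials admissible as analytic test functions in the hypothesis on the
  measures.\<close>

lemma poly_complex_extension:
  fixes p :: "real poly"
  obtains f :: "complex \<Rightarrow> complex" where "f holomorphic_on UNIV" "\<And>x. f (of_real x) = of_real (poly p x)"
proof
  show "(\<lambda>z. \<Sum>i\<le>degree p. of_real (coeff p i) * z ^ i) holomorphic_on UNIV"
    by (intro holomorphic_intros)
qed (simp add: poly_altdef)

text \<open>The data of the theorem together with a symmetric segment [-R,R] that contains [A,B], so
  that one R serves all n.\<close>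

locale linear_statistics =
  fixes \<mu> :: "nat \<Rightarrow> real measure" and \<omega> :: "nat \<Rightarrow> real \<Rightarrow> real" and \<epsilon> :: "nat \<Rightarrow> real"
    and c :: "nat \<Rightarrow> complex" and A B R :: real
  assumes markov: "\<And>n. n \<ge> 1 \<Longrightarrow> is_markov_transform {A..B} (\<omega> n) (\<mu> n)"
    and eps: "filterlim \<epsilon> (at_right 0) sequentially"
    and measures: "\<And>\<phi>::complex \<Rightarrow> complex. \<phi> analytic_on (of_real ` {-2..2::real}) \<Longrightarrow>
      (\<lambda>n. 1 / of_real (\<epsilon> n) *
           ((LINT x:{-2..2}|\<mu> n. \<phi> (of_real x)) - (LINT x:{-2..2}|semicircle. \<phi> (of_real x))))
      \<longlonglongrightarrow> (\<Sum>k. c (k + 1) *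
           (LBINT x:{-2..2}. \<phi> (of_real x) *
              of_real (2 * poly (cheb_T (k + 1)) (x / 2) / (pi * sqrt (4 - x\<^sup>2)))))"
    and AB: "{A..B} \<subseteq> {-R..R}" and R: "3 \<le> R"
begin

definition lin :: "nat \<Rightarrow> (real \<Rightarrow> complex) \<Rightarrow> complex" where
  "lin n \<phi> = 1 / of_real (\<epsilon> n) * ((LINT x:{-2..2}|\<mu> n. \<phi> x) - (LINT x:{-2..2}|semicircle. \<phi> x))"

lemma \<mu>_props:
  assumes "n \<ge> 1"
  shows "prob_space (\<mu> n)" "sets (\<mu> n) = sets borel" "finite_measure (\<mu> n)"
  using markov[OF assms] prob_space.finite_measure unfolding is_markov_transform_def by blast+

lemma set_integrable_\<mu>:
  fixes f :: "real \<Rightarrow> complex"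
  assumes "n \<ge> 1" "continuous_on {-2..2} f" shows "set_integrable (\<mu> n) {-2..2} f"
  by (rule set_integrable_continuous_finite_measure[OF \<mu>_props(3,2)]) (use assms in auto)

lemma set_integrable_semicircle:
  fixes f :: "real \<Rightarrow> complex"
  assumes "continuous_on {-2..2} f" shows "set_integrable semicircle {-2..2} f"
  by (rule set_integrable_continuous_finite_measure[OF finite_measure_semicircle sets_semicircle assms])

lemma lin_diff:
  assumes "n \<ge> 1" "continuous_on {-2..2} f" "continuous_on {-2..2} g"
  shows "lin n (\<lambda>x. f x - g x) = lin n f - lin n g"
  unfolding lin_def
    set_integral_diff(2)[OF set_integrable_\<mu>[OF assms(1,2)] set_integrable_\<mu>[OF assms(1,3)]]
    set_integral_diff(2)[OF set_integrable_semicircle[OF assms(2)] set_integrable_semicircle[OF assms(3)]]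
  by (simp add: algebra_simps)

lemma lin_mult: "lin n (\<lambda>x. a * f x) = a * lin n f"
  unfolding lin_def set_integral_mult_right by (simp add: algebra_simps)

lemma lin_suminf:
  assumes n: "n \<ge> 1" and f: "\<And>j. continuous_on {-2..2} (f j)"
    and D: "\<And>j x. x \<in> {-2..2} \<Longrightarrow> norm (f j x) \<le> D j" "\<And>j. 0 \<le> D j" "summable D"
  shows "(\<lambda>j. lin n (f j)) sums lin n (\<lambda>x. \<Sum>j. f j x)"
  unfolding lin_def
  by (intro sums_mult sums_diff set_integral_suminf_bounded[OF _ _ f D] \<mu>_props[OF n]
      finite_measure_semicircle sets_semicircle)

text \<open>Orthogonality leaves a single term of the limiting series. The series starts with c_1,
  so j = 0 leaves none.\<close>

lemma lin_cheb_T_limit: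
  "(\<lambda>n. lin n (\<lambda>x. of_real (poly (cheb_T j) (x / 2)))) \<longlonglongrightarrow> (if j = 0 then 0 else c j)"
proof -
  obtain f where f: "f holomorphic_on UNIV" "\<And>x. f (of_real x) = complex_of_real (poly (cheb_T j) x)"
    using poly_complex_extension by blast
  define \<phi> where "\<phi> z = f (z / 2)" for z
  have \<phi>: "\<phi> (of_real x) = of_real (poly (cheb_T j) (x / 2))" for x
    using f(2)[of "x / 2"] by (simp add: \<phi>_def)
  have "\<phi> holomorphic_on UNIV"
    unfolding \<phi>_def by (intro holomorphic_on_compose_gen[OF _ f(1), unfolded o_def] holomorphic_intros) auto
  then have "\<phi> analytic_on of_real ` {-2..2}"
    using analytic_on_open[of UNIV] analytic_on_subset by blast
  from measures[OF this]
  have "(\<lambda>n. lin n (\<lambda>x. of_real (poly (cheb_T j) (x / 2)))) \<longlonglongrightarrow> (\<Sum>k. c (k + 1) *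
      (LBINT x:{-2..2}. of_real (poly (cheb_T j) (x / 2) * (2 * poly (cheb_T (k + 1)) (x / 2) / (pi * sqrt (4 - x\<^sup>2))))))"
    by (simp only: lin_def \<phi> of_real_mult)
  also have "(\<Sum>k. c (k + 1) *
      (LBINT x:{-2..2}. of_real (poly (cheb_T j) (x / 2) * (2 * poly (cheb_T (k + 1)) (x / 2) / (pi * sqrt (4 - x\<^sup>2)))))) =
      (\<Sum>k. if k + 1 = j then c (k + 1) else 0)"
    unfolding set_integral_complex_of_real cheb_T_orthogonal by (intro suminf_cong) auto
  also have "\<dots> = (if j = 0 then 0 else c j)"
  proof (cases j)
    case (Suc i)
    have "(\<lambda>k. if k = i then c (k + 1) else 0) sums c (i + 1)" by (rule sums_single)
    then show ?thesis using Suc by (simp add: sums_iff)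
  qed simp
  finally show ?thesis .
qed

text \<open>The constant is T_0. As the measures have total mass 1, this is information about the
  mass outside [-2,2].\<close>

lemma lin_one_limit: "(\<lambda>n. lin n (\<lambda>x. 1)) \<longlonglongrightarrow> 0"
proof -
  have "cheb_T 0 = 1" by (rule poly_eq_if_eq_on_cos) (simp add: poly_cheb_T_cos)
  then show ?thesis using lin_cheb_T_limit[of 0] by simp
qed

lemma lin_ident_limit: "(\<lambda>n. lin n of_real) \<longlonglongrightarrow> 2 * c 1"
proof -
  have "(\<lambda>n. 2 * lin n (\<lambda>x. of_real (poly (cheb_T 1) (x / 2)))) \<longlonglongrightarrow> 2 * c 1"
    using tendsto_mult_left[OF lin_cheb_T_limit[of 1], of 2] by simp
  then show ?thesis unfolding lin_mult[symmetric] by (simp add: cheb_T_1)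
qed

lemma lin_kernel_sums:
  assumes n: "n \<ge> 1" and z: "norm z < 1"
  shows "(\<lambda>k. lin n (\<lambda>x. of_real (U_half k x)) * z ^ k) sums lin n (\<lambda>x. 1 / cheb_denom z x)"
proof -
  have one: "set_integrable (\<mu> n) {-2..2} (\<lambda>x. 1 :: complex)" "set_integrable semicircle {-2..2} (\<lambda>x. 1 :: complex)"
    by (intro set_integrable_\<mu> set_integrable_semicircle n continuous_intros)+
  from sums_mult[OF sums_diff[OF cheb_U_integral_sums(1)[OF one(1) \<mu>_props(2)[OF n] z]
      cheb_U_integral_sums(1)[OF one(2) sets_semicircle z]], of "1 / of_real (\<epsilon> n)"]
  show ?thesis by (simp add: lin_def algebra_simps)
qed

text \<open>Pointwise convergence on all analytic test functions forces a uniform bound on the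
  kernels. Otherwise kernels with unbounded values would be superposed by the gliding hump to one
  analytic function on which the functionals are unbounded, against convergence. The parameters z
  stay in a disc of radius r < 1, so all kernels are analytic in one common neighbourhood of
  [-2,2].\<close>

lemma lin_kernel_bounded:
  assumes r: "0 < r" "r < 1"
  obtains C where "0 < C" "\<And>n z. n \<ge> 1 \<Longrightarrow> norm z \<le> r \<Longrightarrow> norm (lin n (\<lambda>x. 1 / cheb_denom z x)) \<le> C"
proof -
  define D where "D n z = lin n (\<lambda>x. 1 / cheb_denom z x)" for n z
  have cont: "continuous_on (cball 0 r) (D n)" if "n \<ge> 1" for n
  proof -
    have "D n holomorphic_on ball 0 1"
      unfolding D_def by (rule power_series_holomorphic[where a = "\<lambda>k. lin n (\<lambda>x. of_real (U_half k x))"])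
        (use lin_kernel_sums[OF that] in auto)
    then show ?thesis
      by (rule continuous_on_subset[OF holomorphic_on_imp_continuous_on]) (use r in auto)
  qed
  \<comment> \<open>Taking a maximum point for each n yields the domination of each row by its
    diagonal entry, which \<open>gliding_hump\<close> demands.\<close>
  have "\<exists>z. norm z \<le> r \<and> (\<forall>u. norm u \<le> r \<longrightarrow> norm (D n u) \<le> norm (D n z))" if "n \<ge> 1" for n
    using continuous_attains_sup[OF compact_cball _ continuous_on_norm[OF cont[OF that]]] r
    by (auto simp: Bex_def Ball_def)
  then obtain zm where zm: "\<And>n. n \<ge> 1 \<Longrightarrow> norm (zm n) \<le> r"
    "\<And>n u. n \<ge> 1 \<Longrightarrow> norm u \<le> r \<Longrightarrow> norm (D n u) \<le> norm (D n (zm n))" by metis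
  have "\<exists>C. \<forall>n\<ge>1. norm (D n (zm n)) \<le> C"
  proof (rule ccontr)
    assume "\<not> ?thesis"
    \<comment> \<open>The growth 8^i must beat the weights 4^(-i) of the superposition; 2^i
      survives.\<close>
    then have "\<forall>i::nat. \<exists>n\<ge>1. 8 ^ i < norm (D n (zm n))" by (meson not_le)
    then obtain ni where ni: "\<And>i. ni i \<ge> 1" "\<And>i. 8 ^ i < norm (D (ni i) (zm (ni i)))" by metis
    define d where "d i j = D (ni i) (zm (ni j))" for i j
    have dd: "norm (d i j) \<le> norm (d i i)" for i j unfolding d_def by (intro zm ni)
    obtain s where s: "\<And>j. s j \<in> {0, 1}"
      "\<And>i. (1/4) ^ i * norm (d i i) / 6 \<le> norm (\<Sum>j. of_real (s j * (1/4) ^ j) * d i j)"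
      using gliding_hump[of d, OF dd] by blast
    \<comment> \<open>Half of the lower bound (1 - r)^2 of the denominators on the segment: moving x
      by less than \<delta> changes a denominator by less than \<delta>, so at least \<delta>
      remains.\<close>
    define \<delta> where "\<delta> = (1 - r)\<^sup>2 / 2"
    have \<delta>: "0 < \<delta>" using r by (simp add: \<delta>_def)
    define f where "f j u = of_real (s j * (1/4) ^ j) * (1 / (1 - zm (ni j) * u + (zm (ni j))\<^sup>2))" for j u
    define U where "U = (\<Union>x\<in>{-2..2}. ball (complex_of_real x) \<delta>)"
    have zr: "norm (zm (ni j)) \<le> r" for j by (intro zm ni)
    have lower: "\<delta> \<le> norm (1 - zm (ni j) * u + (zm (ni j))\<^sup>2)" if u: "u \<in> U" for u j
    proof -
      obtain x where x: "x \<in> {-2..2}" "norm (of_real x - u) < \<delta>" using u by (auto simp: U_def dist_norm)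
      let ?z = "zm (ni j)"
      have "2 * \<delta> = (1 - r)\<^sup>2" by (simp add: \<delta>_def)
      also have "\<dots> \<le> (1 - norm ?z)\<^sup>2" by (rule power_mono) (use zr[of j] r in auto)
      also have "\<dots> \<le> norm (cheb_denom ?z x)" by (rule cheb_denom_lower) (use x zr[of j] r in auto)
      also have "cheb_denom ?z x = (1 - ?z * u + ?z\<^sup>2) - ?z * (of_real x - u)"
        by (simp add: cheb_denom_def algebra_simps)
      also have "norm \<dots> \<le> norm (1 - ?z * u + ?z\<^sup>2) + norm ?z * norm (of_real x - u)"
        by (metis norm_triangle_ineq4 norm_mult)
      also have "norm ?z * norm (of_real x - u) \<le> 1 * \<delta>"
        by (intro mult_mono) (use zr[of j] r x in auto)
      finally show ?thesis by simp
    qed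
    have nz: "1 - zm (ni j) * u + (zm (ni j))\<^sup>2 \<noteq> 0" if "u \<in> U" for u j
      using lower[OF that, of j] \<delta> by (intro notI) simp
    have fb: "norm (f j u) \<le> (1/4) ^ j * (1 / \<delta>)" if "u \<in> U" for j u
    proof -
      have "norm (f j u) = s j * (1/4) ^ j * (1 / norm (1 - zm (ni j) * u + (zm (ni j))\<^sup>2))"
        using s(1)[of j] unfolding f_def norm_mult norm_of_real norm_divide by auto
      also have "\<dots> \<le> 1 * (1/4) ^ j * (1 / \<delta>)"
        using s(1)[of j] lower[OF that, of j] \<delta> by (intro mult_mono frac_le) auto
      finally show ?thesis by simp
    qed
    have sB: "summable (\<lambda>j. (1/4::real) ^ j * (1 / \<delta>))"
      by (intro summable_mult2 summable_geometric) auto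
    have U: "open U" "of_real ` {-2..2} \<subseteq> U" using \<delta> by (auto simp: U_def)
    define \<phi> where "\<phi> u = (\<Sum>j. f j u)" for u
    have "\<phi> holomorphic_on U"
    proof (rule holomorphic_uniform_sequence[OF U(1), where f = "\<lambda>n u. \<Sum>j<n. f j u"])
      show "(\<lambda>u. \<Sum>j<n. f j u) holomorphic_on U" for n
        unfolding f_def by (intro holomorphic_intros) (use nz in auto)
      fix u assume "u \<in> U"
      then obtain e where e: "0 < e" "cball u e \<subseteq> U" using U(1) open_contains_cball by blast
      have "uniform_limit (cball u e) (\<lambda>n u. \<Sum>j<n. f j u) \<phi> sequentially"
        unfolding \<phi>_def by (rule Weierstrass_m_test[OF _ sB]) (use fb e in blast)
      with e show "\<exists>d>0. cball u d \<subseteq> U \<and> uniform_limit (cball u d) (\<lambda>n u. \<Sum>j<n. f j u) \<phi> sequentially"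
        by blast
    qed
    then have "\<phi> analytic_on of_real ` {-2..2}"
      using analytic_on_open[OF U(1)] analytic_on_subset[OF _ U(2)] by blast
    from convergent_imp_Bseq[OF convergentI[OF measures[OF this]]]
    obtain K where K: "\<And>n. norm (lin n (\<lambda>x. \<phi> (of_real x))) \<le> K"
      unfolding Bseq_def lin_def by blast
    have eq: "lin (ni i) (\<lambda>x. \<phi> (of_real x)) = (\<Sum>j. of_real (s j * (1/4) ^ j) * d i j)" for i
    proof -
      have fe: "f j (of_real x) = of_real (s j * (1/4) ^ j) * (1 / cheb_denom (zm (ni j)) x)" for j x
        by (simp add: f_def cheb_denom_def)
      have "(\<lambda>j. lin (ni i) (\<lambda>x. f j (of_real x))) sums lin (ni i) (\<lambda>x. \<Sum>j. f j (of_real x))"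
      proof (rule lin_suminf[OF ni(1) _ _ _ sB])
        show "continuous_on {-2..2} (\<lambda>x. f j (of_real x))" for j
          unfolding fe
          by (intro continuous_on_mult continuous_on_const continuous_on_inverse_cheb_denom le_less_trans[OF zr r(2)])
        show "norm (f j (of_real x)) \<le> (1/4) ^ j * (1 / \<delta>)" if "x \<in> {-2..2}" for j x
          by (rule fb) (use that U(2) in blast)
      qed (use \<delta> in simp)
      moreover have "lin (ni i) (\<lambda>x. f j (of_real x)) = of_real (s j * (1/4) ^ j) * d i j" for j
        unfolding fe lin_mult d_def D_def ..
      ultimately show ?thesis by (simp add: sums_iff \<phi>_def)
    qed
    have two: "2 ^ i \<le> 6 * K" for i :: nat
    proof -
      have "(2::real) ^ i = (1/4) ^ i * 8 ^ i" by (simp flip: power_mult_distrib)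
      also have "\<dots> \<le> (1/4) ^ i * norm (d i i)" using ni(2)[of i] by (simp add: d_def)
      finally have "2 ^ i / 6 \<le> norm (lin (ni i) (\<lambda>x. \<phi> (of_real x)))" unfolding eq using s(2)[of i] by linarith
      then show ?thesis using K[of "ni i"] by linarith
    qed
    obtain i :: nat where "6 * K < 2 ^ i" using real_arch_pow[of 2 "6 * K"] by auto
    with two[of i] show False by linarith
  qed
  then obtain C where C: "\<And>n. n \<ge> 1 \<Longrightarrow> norm (D n (zm n)) \<le> C" by blast
  show thesis
  proof (rule that[of "max C 1"])
    show "norm (lin n (\<lambda>x. 1 / cheb_denom z x)) \<le> max C 1" if "n \<ge> 1" "norm z \<le> r" for n z
      using zm(2)[OF that] C[OF that(1)] by (simp add: D_def)
  qed simp
qed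

lemma lin_cheb_U_bound:
  assumes r: "0 < r" "r < 1"
  obtains C where "0 < C" "\<And>n k. n \<ge> 1 \<Longrightarrow> norm (lin n (\<lambda>x. of_real (U_half k x))) \<le> C / r ^ k"
proof -
  obtain C where C: "0 < C" "\<And>n z. n \<ge> 1 \<Longrightarrow> norm z \<le> r \<Longrightarrow> norm (lin n (\<lambda>x. 1 / cheb_denom z x)) \<le> C"
    using lin_kernel_bounded[OF r] by blast
  have "norm (lin n (\<lambda>x. of_real (U_half k x))) \<le> C / r ^ k" if "n \<ge> 1" for n k
    by (rule power_series_coeff_bound[OF lin_kernel_sums[OF that] r(1) r(2)]) (use C(2)[OF that] in auto)
  with C(1) that show thesis by blast
qed

end

section \<open>The logarithm of the Markov relation in the unit disc\<close>

lemma joukowski_kernel: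
  assumes "z \<noteq> 0"
  shows "1 / (z + 1 / z - of_real x) = z / cheb_denom z x"
proof -
  have "cheb_denom z x = z * (z + 1 / z - of_real x)"
    using assms by (simp add: cheb_denom_def field_simps power2_eq_square)
  then show ?thesis using assms by simp
qed

lemma joukowski_Im:
  assumes "z \<noteq> 0"
  shows "Im (z + 1 / z) = - (Im z * (1 - (norm z)\<^sup>2) / (norm z)\<^sup>2)"
proof -
  have "(norm z)\<^sup>2 \<noteq> 0" using assms by simp
  then show ?thesis
    by (simp add: Im_divide flip: cmod_power2) (simp add: field_simps)
qed

lemma perturbed_product_bound:
  fixes x y :: complex
  assumes "norm x \<le> k" "norm y \<le> k" "k < 1 / 10"
  shows "norm ((1 + x) * exp y - 1) \<le> 5 * k"
proof -
  have k0: "0 \<le> k" using assms(1) norm_ge_zero order_trans by blast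
  have e: "norm (exp y - 1) \<le> 3 * k"
    using norm_exp_minus_1_le[of y] assms by simp
  have "(1 + x) * exp y - 1 = x * (exp y - 1) + x + (exp y - 1)" by (simp add: algebra_simps)
  also have "norm \<dots> \<le> norm x * norm (exp y - 1) + norm x + norm (exp y - 1)"
    by (metis (no_types, lifting) add_mono norm_mult norm_triangle_ineq norm_triangle_mono order_refl)
  also have "\<dots> \<le> k * (3 * k) + k + 3 * k"
    by (intro add_mono mult_mono e assms) (use k0 in auto)
  also have "k * (3 * k) \<le> k * 1" by (rule mult_left_mono) (use assms k0 in auto)
  finally show ?thesis by simp
qed

context markov_pair
begin

text \<open>Put w = z + 1/z and split both integrals of the Markov relation at [-2,2]. The outer
  part of the measure contributes at most m / |Im w|, the outer excess at most K m / |Im w|^2. By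
  \<open>joukowski_Im\<close>, |Im w| is |Im z| (1 - |z|^2) / |z|^2, and k collects both errors in
  terms of z.\<close>

lemma inner_identity:
  assumes z: "norm z < 1" "Im z \<noteq> 0"
    and out: "(LBINT x:{2<..R}. \<sigma> x) \<le> K * m" "(LBINT x:{-R..<-2}. \<sigma> x) \<le> K * m"
    and supp: "prob {-R..R} = 1" and m: "m = 1 - prob {-2..2}"
    and g: "g = (LINT x:{-2..2}|M. 1 / cheb_denom z x)" "1 / 2 \<le> norm g"
    and nz: "1 - of_real a * (z / (1 + z\<^sup>2)) \<noteq> 0"
    and k: "k = (2 + K) * m * (norm z / \<bar>Im z\<bar>)\<^sup>2 / (1 - (norm z)\<^sup>2)\<^sup>2" "k < 1 / 10"
  shows "norm (exp (1 / 2 * (z\<^sup>2 * (LBINT x:{-2..2}. of_real (\<sigma> x) / (cheb_denom z x)\<^sup>2))) /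
      ((1 + z\<^sup>2) * (1 - of_real a * (z / (1 + z\<^sup>2))) * g) - 1) \<le> 5 * k"
proof -
  define w where "w = z + 1 / z"
  have z0: "z \<noteq> 0" using z(2) by auto
  have nz0: "0 < norm z" using z0 by simp
  define A where "A = {-R..R} - {-2..2::real}"
  have A: "A = {-R..<-2} \<union> {2<..R}" "{-R..R} = {-2..2} \<union> A" "{-2..2} \<inter> A = {}" "A \<in> sets borel" "A \<subseteq> {-R..R}"
    using R by (auto simp: A_def)
  have t: "0 < 1 - (norm z)\<^sup>2" "1 - (norm z)\<^sup>2 \<le> 1"
    using z(1) by (simp_all add: power_less_one_iff)
  have Im_w: "\<bar>Im w\<bar> = \<bar>Im z\<bar> * (1 - (norm z)\<^sup>2) / (norm z)\<^sup>2"
    unfolding w_def joukowski_Im[OF z0] using t by (simp add: abs_mult abs_divide)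
  have v: "0 < \<bar>Im w\<bar>" unfolding Im_w using z(2) z0 t by simp
  have w_off: "w \<notin> of_real ` {-R..R}" using v by auto
  have far: "\<bar>Im w\<bar> \<le> norm (w - of_real x)" for x using abs_Im_le_cmod[of "w - of_real x"] by simp
  have nw: "cheb_denom z x \<noteq> 0" for x
  proof
    assume "cheb_denom z x = 0"
    moreover have "cheb_denom z x = z * (w - of_real x)"
      using z0 by (simp add: cheb_denom_def w_def field_simps power2_eq_square)
    ultimately have "w = of_real x" using z0 by simp
    then show False using v by simp
  qed
  have wz: "w * z = 1 + z\<^sup>2" using z0 by (simp add: w_def field_simps power2_eq_square)
  have wza: "(w - of_real a) * z = (1 + z\<^sup>2) * (1 - of_real a * (z / (1 + z\<^sup>2)))"
  proof -
    have "1 + z\<^sup>2 \<noteq> 0"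
    proof
      assume "1 + z\<^sup>2 = 0"
      then have "norm (z\<^sup>2) = 1" by (metis add_eq_0_iff norm_minus_cancel norm_one)
      then show False using t by (simp add: norm_power)
    qed
    then show ?thesis using wz by (simp add: field_simps)
  qed
  have Ms: "B \<in> sets borel \<Longrightarrow> B \<in> sets M" for B using sets_M by simp
  define Gb where "Gb = G A w"
  have Gb: "norm Gb \<le> m / \<bar>Im w\<bar>"
  proof -
    have "prob A = prob {-R..R} - prob {-2..2}"
      unfolding A_def by (rule finite_measure_Diff) (use R Ms in auto)
    then have "prob A = m" using supp m by simp
    then show ?thesis
      unfolding Gb_def G_def using norm_cauchy_transform_le(2)[OF finite_measure_axioms sets_M A(4) v far] by simp
  qed
  have Gsplit: "(LINT x:{-R..R}|M. 1 / (w - of_real x)) = z * g + Gb"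
  proof -
    have "(LINT x:{-2..2} \<union> A|M. 1 / (w - of_real x)) = (LINT x:{-2..2}|M. 1 / (w - of_real x)) + (LINT x:A|M. 1 / (w - of_real x))"
      by (intro set_integral_Un A(3) norm_cauchy_transform_le(1)[OF finite_measure_axioms sets_M _ v far]) (use A in auto)
    moreover have "(LINT x:{-2..2}|M. 1 / (w - of_real x)) = z * g"
      unfolding g(1) w_def joukowski_kernel[OF z0] set_integral_mult_right[symmetric] by simp
    ultimately show ?thesis using A(2) by (simp add: Gb_def G_def)
  qed
  define Zi where "Zi = z\<^sup>2 * (LBINT x:{-2..2}. of_real (\<sigma> x) / (cheb_denom z x)\<^sup>2)"
  define Zo where "Zo = (LBINT x:A. of_real (\<sigma> x) / (w - of_real x)\<^sup>2)"
  have Zint: "set_integrable lborel {-R..R} (\<lambda>x. of_real (\<sigma> x) / (w - of_real x)\<^sup>2)"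
    by (rule DERIV_cauchy_transform(3)[OF set_integrable_\<sigma> _ _ v far]) auto
  have sub: "set_integrable lborel B (\<lambda>x. of_real (\<sigma> x) / (w - of_real x)\<^sup>2)" if "B \<in> sets borel" "B \<subseteq> {-R..R}" for B
    by (rule set_integrable_subset[OF Zint]) (use that in auto)
  have Zsplit: "Z w = Zi + Zo"
  proof -
    have "(LBINT x:{-2..2} \<union> A. of_real (\<sigma> x) / (w - of_real x)\<^sup>2) = (LBINT x:{-2..2}. of_real (\<sigma> x) / (w - of_real x)\<^sup>2) + Zo"
      unfolding Zo_def by (intro set_integral_Un A(3) sub) (use A R in auto)
    moreover have "(LBINT x:{-2..2}. of_real (\<sigma> x) / (w - of_real x)\<^sup>2) = Zi"
    proof -
      have "of_real (\<sigma> x) / (w - of_real x)\<^sup>2 = z\<^sup>2 * (of_real (\<sigma> x) / (cheb_denom z x)\<^sup>2)" for x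
      proof -
        have "of_real (\<sigma> x) / (w - of_real x)\<^sup>2 = of_real (\<sigma> x) * (1 / (w - of_real x))\<^sup>2" by (simp add: power_divide)
        also have "\<dots> = z\<^sup>2 * (of_real (\<sigma> x) / (cheb_denom z x)\<^sup>2)"
          unfolding w_def joukowski_kernel[OF z0] by (simp add: power_divide)
        finally show ?thesis .
      qed
      then show ?thesis unfolding Zi_def by (simp only: set_integral_mult_right)
    qed
    ultimately show ?thesis using A(2) by (simp add: Z_def)
  qed
  have Zo: "norm (- (1 / 2) * Zo) \<le> K * m / \<bar>Im w\<bar>\<^sup>2"
  proof -
    have si: "set_integrable lborel A \<sigma>" by (rule set_integrable_\<sigma>_real[OF A(4,5)])
    have "norm Zo \<le> (LBINT x:A. norm (of_real (\<sigma> x) / (w - of_real x)\<^sup>2))"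
      unfolding Zo_def by (intro set_integral_norm_bound sub A)
    also have "\<dots> \<le> (LBINT x:A. (1 / \<bar>Im w\<bar>\<^sup>2) * \<sigma> x)"
    proof (intro set_integral_mono set_integrable_norm sub A set_integrable_mult_right si)
      fix x
      have "\<sigma> x / norm (w - of_real x) ^ 2 \<le> \<sigma> x / \<bar>Im w\<bar>\<^sup>2"
        by (intro divide_left_mono power_mono far mult_pos_pos zero_less_power v less_le_trans[OF v far] \<sigma>_bounds) auto
      then show "norm (of_real (\<sigma> x) / (w - of_real x)\<^sup>2) \<le> (1 / \<bar>Im w\<bar>\<^sup>2) * \<sigma> x"
        using \<sigma>_bounds(1)[of x] by (simp add: norm_divide norm_power)
    qed
    also have "\<dots> = (1 / \<bar>Im w\<bar>\<^sup>2) * ((LBINT x:{-R..<-2}. \<sigma> x) + (LBINT x:{2<..R}. \<sigma> x))"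
    proof -
      have "(LBINT x:{-R..<-2} \<union> {2<..R}. \<sigma> x) = (LBINT x:{-R..<-2}. \<sigma> x) + (LBINT x:{2<..R}. \<sigma> x)"
        by (intro set_integral_Un set_integrable_\<sigma>_real) (use R in auto)
      then show ?thesis unfolding set_integral_mult_right A(1) by simp
    qed
    also have "\<dots> \<le> (1 / \<bar>Im w\<bar>\<^sup>2) * (2 * (K * m))"
      by (intro mult_left_mono) (use out in auto)
    finally show ?thesis by (simp add: norm_mult mult_ac)
  qed
  have g0: "g \<noteq> 0" using g(2) by auto
  have m0: "0 \<le> m" using m by simp
  have K0: "0 \<le> K * m"
  proof -
    have "0 \<le> (LBINT x:{2<..R}. \<sigma> x)"
      unfolding set_lebesgue_integral_def by (rule Bochner_Integration.integral_nonneg) (use \<sigma>_bounds in simp)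
    then show ?thesis using out(1) by linarith
  qed
  \<comment> \<open>At least 1, so the first-power error of the measure can be absorbed into the
    second-power error of the excess.\<close>
  define q where "q = norm z / \<bar>Im z\<bar>"
  have q1: "1 \<le> q" using abs_Im_le_cmod[of z] z(2) by (simp add: q_def)
  have tq: "q\<^sup>2 * m / (1 - (norm z)\<^sup>2)\<^sup>2 * 2 + K * m * q\<^sup>2 / (1 - (norm z)\<^sup>2)\<^sup>2 = k"
    by (simp add: k(1) q_def[symmetric] add_divide_distrib algebra_simps)
  have t2: "(1 - (norm z)\<^sup>2)\<^sup>2 \<le> 1 - (norm z)\<^sup>2"
    using mult_left_mono[OF t(2), of "1 - (norm z)\<^sup>2"] t(1) by (simp add: power2_eq_square)
  have kx: "norm (Gb / (z * g)) \<le> q\<^sup>2 * m / (1 - (norm z)\<^sup>2)\<^sup>2 * 2"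
  proof -
    have "norm (Gb / (z * g)) \<le> (m / \<bar>Im w\<bar>) / (norm z * (1 / 2))"
      unfolding norm_divide norm_mult by (intro frac_le Gb mult_left_mono g) (use nz0 v m0 in auto)
    also have "\<dots> = 2 * m * q / (1 - (norm z)\<^sup>2)"
      unfolding Im_w q_def using nz0 z(2) t by (simp add: field_simps power2_eq_square)
    also have "\<dots> \<le> 2 * m * q\<^sup>2 / (1 - (norm z)\<^sup>2)\<^sup>2"
      by (intro frac_le t2 mult_left_mono) (use m0 q1 t in \<open>auto simp: power2_eq_square\<close>)
    finally show ?thesis by (simp add: mult_ac)
  qed
  have ky: "norm (- (1 / 2) * Zo) \<le> K * m * q\<^sup>2 / (1 - (norm z)\<^sup>2)\<^sup>2"
  proof -
    have "K * m / \<bar>Im w\<bar>\<^sup>2 = K * m * (norm z)\<^sup>2 * (q\<^sup>2 / (1 - (norm z)\<^sup>2)\<^sup>2)"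
      unfolding Im_w q_def using nz0 z(2) t by (simp add: field_simps power2_eq_square)
    also have "\<dots> \<le> K * m * 1 * (q\<^sup>2 / (1 - (norm z)\<^sup>2)\<^sup>2)"
      by (intro mult_right_mono mult_left_mono K0) (use t in auto)
    finally have "K * m / \<bar>Im w\<bar>\<^sup>2 \<le> K * m * q\<^sup>2 / (1 - (norm z)\<^sup>2)\<^sup>2" by simp
    from order_trans[OF Zo this] show ?thesis .
  qed
  have kxy: "norm (Gb / (z * g)) \<le> k" "norm (- (1 / 2) * Zo) \<le> k"
  proof -
    have "0 \<le> q\<^sup>2 * m / (1 - (norm z)\<^sup>2)\<^sup>2 * 2" "0 \<le> K * m * q\<^sup>2 / (1 - (norm z)\<^sup>2)\<^sup>2"
      using m0 K0 by auto
    then show "norm (Gb / (z * g)) \<le> k" "norm (- (1 / 2) * Zo) \<le> k" using kx ky tq by linarith+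
  qed
  \<comment> \<open>From here the relation takes the form inner exponential = main product times (1
    + Gb/(z g)) exp(-Zo/2), with both perturbations at most k.\<close>
  have "exp (1 / 2 * Zi) = exp (1 / 2 * Z w) * exp (- (1 / 2) * Zo)"
    unfolding Zsplit by (simp add: exp_add[symmetric] add_divide_distrib)
  also have "exp (1 / 2 * Z w) = (w - of_real a) * (z * g + Gb)"
    unfolding Z_def transform[OF w_off] Gsplit ..
  also have "(w - of_real a) * (z * g + Gb) = (w - of_real a) * z * g * (1 + Gb / (z * g))"
    using z0 g0 by (simp add: field_simps)
  finally have E: "exp (1 / 2 * Zi) = (w - of_real a) * z * g * (1 + Gb / (z * g)) * exp (- (1 / 2) * Zo)" .
  define P where "P = (w - of_real a) * z * g"
  have "w \<noteq> of_real a" using v by auto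
  then have P0: "P \<noteq> 0" using z0 g0 by (simp add: P_def)
  have "exp (1 / 2 * Zi) / P = (1 + Gb / (z * g)) * exp (- (1 / 2) * Zo)"
    unfolding E P_def[symmetric] using P0 by (simp add: mult.assoc)
  then show ?thesis
    unfolding wza[symmetric] Zi_def[symmetric] P_def[symmetric]
    using perturbed_product_bound[OF kxy k(2)] by simp
qed

end

section \<open>Comparison with the LSVK diagram inside the disc\<close>

lemma abs_LSVK_excess_le:
  assumes "\<bar>x\<bar> \<le> 2" shows "\<bar>LSVK x - \<bar>x\<bar>\<bar> \<le> 6"
proof -
  have a: "\<bar>arcsin (x / 2)\<bar> \<le> pi / 2"
    using arcsin_bounded[of "x / 2"] assms by (auto simp: abs_le_iff)
  have "\<bar>x * arcsin (x / 2)\<bar> \<le> 2 * (pi / 2)"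
    unfolding abs_mult by (intro mult_mono assms a) auto
  moreover have "\<bar>sqrt (4 - x\<^sup>2)\<bar> \<le> 2"
  proof -
    have "x\<^sup>2 \<le> 4" using assms abs_le_square_iff[of x 2] by auto
    moreover have "sqrt (4 - x\<^sup>2) \<le> sqrt 4" by (rule real_sqrt_le_mono) simp
    ultimately show ?thesis by simp
  qed
  ultimately have "\<bar>x * arcsin (x / 2) + sqrt (4 - x\<^sup>2)\<bar> \<le> pi + 2" by linarith
  then have "\<bar>2 / pi * (x * arcsin (x / 2) + sqrt (4 - x\<^sup>2))\<bar> \<le> 2 / pi * (pi + 2)"
    unfolding abs_mult by (intro mult_mono) auto
  also have "\<dots> \<le> 4" using pi_gt3 by (simp add: field_simps)
  finally have "\<bar>LSVK x\<bar> \<le> 4" by (simp only: LSVK_def assms if_True)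
  then show ?thesis using assms by linarith
qed

text \<open>The squared kernel has a convenient series only after multiplication by 1 - z^2, which
  has no zero in the open disc and can be divided out.\<close>

lemma holomorphic_cheb_integrals:
  fixes g :: "real \<Rightarrow> complex"
  assumes g: "set_integrable M {-2..2} g" "sets M = sets borel"
  shows "(\<lambda>z. LINT x:{-2..2}|M. g x / cheb_denom z x) holomorphic_on ball 0 1"
    and "(\<lambda>z. LINT x:{-2..2}|M. g x / (cheb_denom z x)\<^sup>2) holomorphic_on ball 0 1"
proof -
  let ?c = "\<lambda>k. LINT x:{-2..2}|M. g x * of_real (U_half k x)"
  show "(\<lambda>z. LINT x:{-2..2}|M. g x / cheb_denom z x) holomorphic_on ball 0 1"
    by (rule power_series_holomorphic[where a = ?c]) (use cheb_U_integral_sums(1)[OF g] in auto)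
  have h: "(\<lambda>z. (1 - z\<^sup>2) * (LINT x:{-2..2}|M. g x / (cheb_denom z x)\<^sup>2)) holomorphic_on ball 0 1"
    by (rule power_series_holomorphic[where a = "\<lambda>k. of_nat (k + 1) * ?c k"])
      (use cheb_U_integral_sums(2)[OF g] in auto)
  have nz: "1 - z\<^sup>2 \<noteq> 0" if "z \<in> ball 0 1" for z :: complex
  proof
    assume "1 - z\<^sup>2 = 0"
    then have "norm z ^ 2 = 1" by (simp flip: norm_power)
    then show False using that norm_ge_zero[of z] by (auto simp: power2_eq_1_iff simp del: norm_ge_zero)
  qed
  show "(\<lambda>z. LINT x:{-2..2}|M. g x / (cheb_denom z x)\<^sup>2) holomorphic_on ball 0 1"
  proof (rule holomorphic_transform)
    show "(\<lambda>z. (1 - z\<^sup>2) * (LINT x:{-2..2}|M. g x / (cheb_denom z x)\<^sup>2) / (1 - z\<^sup>2)) holomorphic_on ball 0 1"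
      by (intro holomorphic_intros h nz)
  qed (use nz in auto)
qed

lemma norm_Ln_1_minus:
  fixes u :: complex
  assumes "norm u \<le> 1 / 2"
  shows "norm (Ln (1 - u) + u) \<le> 2 * (norm u)\<^sup>2" "norm (Ln (1 - u)) \<le> 1"
proof -
  have "norm (Ln (1 + - u) - - u) \<le> (norm (- u))\<^sup>2 / (1 - norm (- u))"
    by (rule Ln_approx_linear) (use assms in simp)
  also have "\<dots> \<le> (norm u)\<^sup>2 / (1 / 2)"
    unfolding norm_minus_cancel by (intro divide_left_mono) (use assms in auto)
  finally show *: "norm (Ln (1 - u) + u) \<le> 2 * (norm u)\<^sup>2" by simp
  have "(norm u)\<^sup>2 \<le> (1 / 2)\<^sup>2" by (intro power_mono assms) auto
  then show "norm (Ln (1 - u)) \<le> 1"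
    using * assms norm_triangle_ineq4[of "Ln (1 - u) + u" u] by (simp add: power2_eq_square)
qed

lemma norm_1_plus_square_ge:
  fixes z :: complex assumes "norm z \<le> r" shows "1 - r\<^sup>2 \<le> norm (1 + z\<^sup>2)"
proof -
  have "norm z ^ 2 \<le> r\<^sup>2" by (intro power_mono assms) auto
  then show ?thesis using norm_diff_ineq[of 1 "z\<^sup>2"] by (simp add: norm_power)
qed

definition LSVK_gap :: "(real \<Rightarrow> real) \<Rightarrow> complex \<Rightarrow> complex" where
  "LSVK_gap \<sigma> z = (LBINT x:{-2..2}. of_real (\<sigma> x - (LSVK x - \<bar>x\<bar>)) / (cheb_denom z x)\<^sup>2)"

text \<open>The inner product bounds |F| (Im z)^2 / m on the circle of radius r, where F is the
  logarithmic defect and 2 (S + 6) / (1 - r)^4 + 3 its crude bound. The outer factor 4 r^2 / (r^2 -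
  s^2)^2 is the price of the maximum principle.\<close>

definition inner_log_const :: "real \<Rightarrow> real \<Rightarrow> real \<Rightarrow> real \<Rightarrow> real" where
  "inner_log_const S K r s = 4 * r\<^sup>2 * (10 * (2 * (S + 6) / (1 - r) ^ 4 + 3) * ((2 + K) * r\<^sup>2 / (1 - r\<^sup>2)\<^sup>2)) / (r\<^sup>2 - s\<^sup>2)\<^sup>2"

context markov_pair
begin

lemma set_integrable_gap: "set_integrable lborel {-2..2} (\<lambda>x. complex_of_real (\<sigma> x - (LSVK x - \<bar>x\<bar>)))"
  and set_integrable_excess: "set_integrable lborel {-2..2} (\<lambda>x. complex_of_real (\<sigma> x))"
  and set_integrable_LSVK_excess: "set_integrable lborel {-2..2} (\<lambda>x. complex_of_real (LSVK x - \<bar>x\<bar>))"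
proof -
  show 1: "set_integrable lborel {-2..2} (\<lambda>x. complex_of_real (\<sigma> x))"
    by (rule set_integrable_subset[OF set_integrable_\<sigma>]) (use R in auto)
  show 2: "set_integrable lborel {-2..2} (\<lambda>x. complex_of_real (LSVK x - \<bar>x\<bar>))"
    by (intro set_integrable_continuous continuous_intros continuous_on_LSVK)
  show "set_integrable lborel {-2..2} (\<lambda>x. complex_of_real (\<sigma> x - (LSVK x - \<bar>x\<bar>)))"
    using set_integral_diff(1)[OF 1 2] by simp
qed

text \<open>By \<open>lsvk_transform\<close> the reference diagram contributes exactly 1 + z^2, so
  subtracting its excess in the exponent divides by this factor.\<close>

lemma exp_LSVK_gap:
  assumes z: "norm z < 1"
  shows "exp (1 / 2 * (z\<^sup>2 * LSVK_gap \<sigma> z)) =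
    exp (1 / 2 * (z\<^sup>2 * (LBINT x:{-2..2}. of_real (\<sigma> x) / (cheb_denom z x)\<^sup>2))) / (1 + z\<^sup>2)"
proof -
  have "LSVK_gap \<sigma> z = (LBINT x:{-2..2}. of_real (\<sigma> x) / (cheb_denom z x)\<^sup>2) -
      (LBINT x:{-2..2}. of_real (LSVK x - \<bar>x\<bar>) / (cheb_denom z x)\<^sup>2)"
    unfolding LSVK_gap_def of_real_diff[of "\<sigma> _"] diff_divide_distrib[of "complex_of_real (\<sigma> _)"]
    by (intro set_integral_diff(2) cheb_U_integral_sums(4) set_integrable_excess set_integrable_LSVK_excess z) auto
  then have "1 / 2 * (z\<^sup>2 * LSVK_gap \<sigma> z) = 1 / 2 * (z\<^sup>2 * (LBINT x:{-2..2}. of_real (\<sigma> x) / (cheb_denom z x)\<^sup>2)) -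
      1 / 2 * (z\<^sup>2 * (LBINT x:{-2..2}. of_real (LSVK x - \<bar>x\<bar>) / (cheb_denom z x)\<^sup>2))"
    by (simp only: right_diff_distrib)
  then show ?thesis
    unfolding lsvk_transform[OF z, symmetric] by (simp only: exp_diff)
qed

lemma norm_LSVK_gap_le:
  assumes z: "norm z \<le> r" "r < 1"
  shows "norm (LSVK_gap \<sigma> z) \<le> 4 * (S + 6) / (1 - r) ^ 4"
proof -
  have "norm (LSVK_gap \<sigma> z) \<le> (LBINT x:{-2..2}. norm (complex_of_real (\<sigma> x - (LSVK x - \<bar>x\<bar>)) / (cheb_denom z x)\<^sup>2))"
    unfolding LSVK_gap_def
    by (intro set_integral_norm_bound cheb_U_integral_sums(4) set_integrable_gap) (use z in auto)
  also have "\<dots> \<le> (LBINT x:{-2..2::real}. (S + 6) / (1 - r) ^ 4)"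
  proof (intro set_integral_mono set_integrable_norm cheb_U_integral_sums(4) set_integrable_gap set_integrable_continuous continuous_intros)
    fix x :: real assume x: "x \<in> {-2..2}"
    have "(1 - r)\<^sup>2 \<le> (1 - norm z)\<^sup>2" by (intro power_mono) (use z in auto)
    also have "\<dots> \<le> norm (cheb_denom z x)" by (rule cheb_denom_lower) (use x z in auto)
    finally have "((1 - r)\<^sup>2)\<^sup>2 \<le> norm (cheb_denom z x) ^ 2" by (intro power_mono) auto
    then have d: "(1 - r) ^ 4 \<le> norm (cheb_denom z x) ^ 2" by simp
    have "\<bar>\<sigma> x - (LSVK x - \<bar>x\<bar>)\<bar> \<le> S + 6"
      using \<sigma>_bounds[of x] abs_LSVK_excess_le[of x] x unfolding atLeastAtMost_iff by linarith
    then have "\<bar>\<sigma> x - (LSVK x - \<bar>x\<bar>)\<bar> / norm (cheb_denom z x) ^ 2 \<le> (S + 6) / (1 - r) ^ 4"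
      by (intro frac_le d) (use z in auto)
    then show "norm (complex_of_real (\<sigma> x - (LSVK x - \<bar>x\<bar>)) / (cheb_denom z x)\<^sup>2) \<le> (S + 6) / (1 - r) ^ 4"
      by (simp only: norm_divide norm_of_real norm_power)
  qed (use z in auto)
  also have "\<dots> = 4 * (S + 6) / (1 - r) ^ 4"
    by (simp add: set_lebesgue_integral_def)
  finally show ?thesis .
qed

text \<open>On a circle of radius \<open>r\<close> the exponential of the logarithmic defect is \<open>1 + O(k)\<close>, where
  \<open>k\<close> grows like the inverse square of \<open>Im z\<close>; the defect is followed along the ray from \<open>0\<close>
  to \<open>z\<close>, on which \<open>norm z / \<bar>Im z\<bar>\<close> is constant, to fix the branch.\<close>

lemma inner_log_bound:
  assumes s: "0 < s" "s < r" "r < \<rho>" "\<rho> < 1"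
    and out: "(LBINT x:{2<..R}. \<sigma> x) \<le> K * m" "(LBINT x:{-R..<-2}. \<sigma> x) \<le> K * m" "0 \<le> K"
    and supp: "prob {-R..R} = 1" and m: "m = 1 - prob {-2..2}"
    and g: "\<And>z. norm z < \<rho> \<Longrightarrow> norm ((LINT x:{-2..2}|M. 1 / cheb_denom z x) - 1) \<le> 1 / 2"
    and small: "\<And>z :: complex. norm z < \<rho> \<Longrightarrow> norm (of_real a * (z / (1 + z\<^sup>2))) \<le> 1 / 2"
    and z: "norm z \<le> s"
  shows "norm (1 / 2 * (z\<^sup>2 * LSVK_gap \<sigma> z) - Ln (1 - of_real a * (z / (1 + z\<^sup>2)))
      - Ln (LINT x:{-2..2}|M. 1 / cheb_denom z x)) \<le> inner_log_const S K r s * m"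
proof -
  define G where "G z = (LINT x:{-2..2}|M. 1 / cheb_denom z x)" for z
  define F where "F z = 1 / 2 * (z\<^sup>2 * LSVK_gap \<sigma> z) - Ln (1 - of_real a * (z / (1 + z\<^sup>2))) - Ln (G z)" for z
  define Fc where "Fc = 2 * (S + 6) / (1 - r) ^ 4 + 3"
  have m0: "0 \<le> m" using m by simp
  have S0: "0 \<le> S" using \<sigma>_bounds[of 0] by linarith
  have Fc1: "1 \<le> Fc" using S0 s by (simp add: Fc_def)
  have one: "set_integrable M {-2..2} (\<lambda>x. 1 :: complex)"
    by (rule set_integrable_continuous_finite_measure[OF finite_measure_axioms sets_M]) simp
  have sub: "ball 0 \<rho> \<subseteq> ball (0::complex) 1" using s by auto
  have G1: "norm (G z - 1) \<le> 1 / 2" if "norm z < \<rho>" for z using g[OF that] by (simp add: G_def)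
  have holG: "G holomorphic_on ball 0 \<rho>"
    unfolding G_def by (rule holomorphic_on_subset[OF holomorphic_cheb_integrals(1)[OF one sets_M] sub])
  have holV: "LSVK_gap \<sigma> holomorphic_on ball 0 \<rho>"
    unfolding LSVK_gap_def by (rule holomorphic_on_subset[OF holomorphic_cheb_integrals(2)[OF set_integrable_gap] sub]) simp
  have nz: "1 + z\<^sup>2 \<noteq> 0" if "norm z < \<rho>" for z :: complex
    using norm_1_plus_square_ge[of z "norm z"] that s power_less_one_iff[of "norm z" 2] by auto
  have half: "1 - u \<notin> \<real>\<^sub>\<le>\<^sub>0" if "norm u \<le> 1 / 2" for u :: complex
  proof
    assume "1 - u \<in> \<real>\<^sub>\<le>\<^sub>0"
    then have "1 \<le> Re u" by (auto simp: complex_nonpos_Reals_iff)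
    then show False using complex_Re_le_cmod[of u] that by linarith
  qed
  have G_off: "G z \<notin> \<real>\<^sub>\<le>\<^sub>0" if "norm z < \<rho>" for z
    using half[of "1 - G z"] G1[OF that] by (simp add: norm_minus_commute)
  have holF: "F holomorphic_on ball 0 \<rho>"
    unfolding F_def
    by (intro holomorphic_intros holG holV) (use nz G_off half small in auto)
  have G_ge: "1 / 2 \<le> norm (G z)" if "norm z < \<rho>" for z
    using G1[OF that] norm_triangle_ineq2[of 1 "1 - G z"] by (simp add: norm_minus_commute)
  define q where "q z = norm z / \<bar>Im z\<bar>" for z
  define k where "k z = (2 + K) * m * (q z)\<^sup>2 / (1 - (norm z)\<^sup>2)\<^sup>2" for z
  have expF: "norm (exp (F z) - 1) \<le> 5 * k z" if z: "norm z < \<rho>" "Im z \<noteq> 0" "k z < 1 / 10" for z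
  proof -
    have z1: "norm z < 1" using z s by simp
    have nz1: "1 - of_real a * (z / (1 + z\<^sup>2)) \<noteq> 0" using half[OF small[OF z(1)]] by auto
    have Gnz: "G z \<noteq> 0" using G_ge[OF z(1)] by auto
    have "exp (F z) = exp (1 / 2 * (z\<^sup>2 * LSVK_gap \<sigma> z)) / (1 - of_real a * (z / (1 + z\<^sup>2))) / G z"
      unfolding F_def exp_diff exp_Ln[OF nz1] exp_Ln[OF Gnz] ..
    also have "\<dots> = exp (1 / 2 * (z\<^sup>2 * (LBINT x:{-2..2}. of_real (\<sigma> x) / (cheb_denom z x)\<^sup>2))) /
      ((1 + z\<^sup>2) * (1 - of_real a * (z / (1 + z\<^sup>2))) * G z)"
      unfolding exp_LSVK_gap[OF z1] divide_divide_eq_left mult.assoc ..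
    finally show ?thesis
      using inner_identity[OF z1 z(2) out(1,2) supp m G_def G_ge[OF z(1)] nz1, of "k z"] z(3)
      by (simp only: k_def q_def)
  qed
  have ImF0: "Im (F 0) = 0"
  proof -
    have "G 0 = (LINT x:{-2..2}|M. complex_of_real 1)"
      unfolding G_def cheb_denom_def by simp
    also have "\<dots> = of_real (LINT x:{-2..2}|M. 1)" by (rule set_integral_complex_of_real)
    finally have "G 0 = of_real (LINT x:{-2..2}|M. 1)" .
    then obtain t where t: "G 0 = of_real t" by blast
    have "0 < t"
      using G_off[of 0] s unfolding t by (simp add: complex_nonpos_Reals_iff)
    then show ?thesis by (simp add: F_def t Ln_of_real)
  qed
  have Fcrude: "norm (F z) \<le> Fc" if z: "norm z \<le> r" for z
  proof -
    have z\<rho>: "norm z < \<rho>" using z s by simp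
    have "norm (z\<^sup>2) \<le> 1" unfolding norm_power by (rule power_le_one) (use z s in auto)
    moreover have "norm (LSVK_gap \<sigma> z) \<le> 4 * (S + 6) / (1 - r) ^ 4" by (rule norm_LSVK_gap_le) (use z s in auto)
    ultimately have "norm (z\<^sup>2) * norm (LSVK_gap \<sigma> z) \<le> 1 * (4 * (S + 6) / (1 - r) ^ 4)"
      by (intro mult_mono) auto
    then have 1: "norm (1 / 2 * (z\<^sup>2 * LSVK_gap \<sigma> z)) \<le> 2 * (S + 6) / (1 - r) ^ 4"
      by (simp only: norm_mult) simp
    have 2: "norm (Ln (1 - of_real a * (z / (1 + z\<^sup>2)))) \<le> 1" by (rule norm_Ln_1_minus(2)[OF small[OF z\<rho>]])
    have 3: "norm (Ln (G z)) \<le> 1"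
      using norm_Ln_1_minus(2)[of "1 - G z"] G1[OF z\<rho>] by (simp add: norm_minus_commute)
    show ?thesis
      unfolding F_def Fc_def
      by (rule order_trans[OF norm_triangle_ineq4], rule order_trans[OF add_right_mono[OF norm_triangle_ineq4]])
        (use 1 2 3 in linarith)
  qed
  have r1: "0 < 1 - r\<^sup>2" using s power_less_one_iff[of r 2] by auto
  define B where "B = 10 * Fc * ((2 + K) * m * r\<^sup>2 / (1 - r\<^sup>2)\<^sup>2)"
  have B0: "0 \<le> B" unfolding B_def using Fc1 out(3) m0 by auto
  have circ: "norm (F z) * (Im z)\<^sup>2 \<le> B" if z: "norm z = r" for z
  proof (cases "Im z = 0")
    case True then show ?thesis using B0 by simp
  next
    case False
    have kz: "k z * (Im z)\<^sup>2 = (2 + K) * m * r\<^sup>2 / (1 - r\<^sup>2)\<^sup>2"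
      using False unfolding k_def q_def z by (simp add: power_divide)
    have k0: "0 \<le> k z" unfolding k_def using out(3) m0 by auto
    \<comment> \<open>For small k the branch argument gives 10 k, enlarged by Fc >= 1. For k >= 1/10
      the crude bound Fc is already below 10 Fc k, so near the real axis no branch has to be
      followed.\<close>
    have "norm (F z) \<le> 10 * Fc * k z"
    proof (cases "k z < 1 / 10")
      case True
      have "norm (F (of_real 1 * z)) \<le> 2 * (5 * k z)"
      proof (rule norm_le_of_exp_near_1[where f = "\<lambda>t. F (of_real t * z)"])
        show "continuous_on {0..1} (\<lambda>t. F (of_real t * z))"
        proof (rule continuous_on_compose2[OF holomorphic_on_imp_continuous_on[OF holF]])
          show "(\<lambda>t. of_real t * z) ` {0..1} \<subseteq> ball 0 \<rho>"
          proof safe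
            fix t :: real assume "t \<in> {0..1}"
            then have "norm (of_real t * z) \<le> 1 * r" unfolding norm_mult z by (intro mult_mono) (use s in auto)
            then show "of_real t * z \<in> ball 0 \<rho>" using s by simp
          qed
        qed (intro continuous_intros)
        show "Im (F (of_real 0 * z)) = 0" using ImF0 by simp
        fix t :: real assume t: "0 < t" "t \<le> 1"
        have tz: "norm (of_real t * z) \<le> norm z" using t by (simp add: norm_mult mult_left_le_one_le)
        \<comment> \<open>On the ray the ratio of |z| to |Im z| is constant and 1 - |z|^2 is
          smallest at the end, so the error is largest there.\<close>
        have "k (of_real t * z) \<le> k z"
        proof -
          have "q (of_real t * z) = q z" using t by (simp add: q_def norm_mult abs_mult)
          moreover have "(1 - (norm z)\<^sup>2)\<^sup>2 \<le> (1 - (norm (of_real t * z))\<^sup>2)\<^sup>2"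
            using r1 tz z by (intro power_mono diff_left_mono) auto
          ultimately show ?thesis unfolding k_def using r1 z out(3) m0
            by (auto intro!: divide_left_mono mult_pos_pos simp del: norm_mult)
        qed
        then show "norm (exp (F (of_real t * z)) - 1) \<le> 5 * k z"
          using expF[of "of_real t * z"] tz z s t False True by (auto simp: simp del: norm_mult)
      qed (use True in simp)
      then have "norm (F z) \<le> 10 * k z" by simp
      also have "\<dots> \<le> 10 * Fc * k z" using Fc1 k0 mult_right_mono[OF Fc1, of "k z"] by simp
      finally show ?thesis .
    next
      case False
      then have "Fc * 1 \<le> Fc * (10 * k z)" using Fc1 by (intro mult_left_mono) auto
      then show ?thesis using Fcrude[of z] z by simp
    qed
    then have "norm (F z) * (Im z)\<^sup>2 \<le> 10 * Fc * k z * (Im z)\<^sup>2" by (rule mult_right_mono) simp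
    also have "\<dots> = B" unfolding B_def kz[symmetric] by simp
    finally show ?thesis .
  qed
  have "norm (F z) \<le> 4 * r\<^sup>2 * B / (r\<^sup>2 - s\<^sup>2)\<^sup>2"
    by (rule norm_le_off_real_boundary[OF holF _ _ circ z]) (use s in auto)
  also have "\<dots> = inner_log_const S K r s * m"
    unfolding inner_log_const_def B_def Fc_def by simp
  finally show ?thesis unfolding F_def G_def .
qed

end

lemma sums_shift:
  fixes b :: "nat \<Rightarrow> complex"
  assumes "(\<lambda>k. b k * z ^ k) sums B"
  shows "(\<lambda>k. (if k < p then 0 else b (k - p)) * z ^ k) sums (z ^ p * B)"
proof -
  let ?f = "\<lambda>k. (if k < p then 0 else b (k - p)) * z ^ k"
  have "(\<lambda>k. ?f (k + p)) sums (z ^ p * B)"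
    using sums_mult[OF assms, of "z ^ p"] by (simp add: power_add mult_ac)
  then have "?f sums (z ^ p * B + (\<Sum>k<p. ?f k))" by (rule iffD1[OF sums_iff_shift])
  then show ?thesis by simp
qed

lemma U_half_at_0: "U_half k 0 = sin (real (k + 1) * pi / 2)"
  using U_half_cos[of "pi / 2" k] by simp

text \<open>The generating series of the U_k at x = 0, shifted by one. It expands the first-order
  effect -a z / (1 + z^2) of the centre on the logarithm.\<close>

lemma sine_generating:
  fixes z :: complex
  assumes "norm z < 1"
  shows "(\<lambda>k. of_real (sin (real k * pi / 2)) * z ^ k) sums (z / (1 + z\<^sup>2))"
proof -
  have "(\<lambda>k. of_real (U_half k 0) * z ^ k) sums (1 / (1 + z\<^sup>2))"
    using cheb_U_generating[of 0 z] assms by (simp add: cheb_denom_def mult.commute)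
  from sums_shift[OF this, of 1]
  have "(\<lambda>k. (if k < 1 then 0 else of_real (U_half (k - 1) 0)) * z ^ k) sums (z / (1 + z\<^sup>2))" by simp
  moreover have "(if k < 1 then 0 else complex_of_real (U_half (k - 1) 0)) = of_real (sin (real k * pi / 2))" for k
    by (cases k) (auto simp: U_half_at_0)
  ultimately show ?thesis by simp
qed

section \<open>Expansion of analytic functions in Chebyshev polynomials\<close>

text \<open>The Stieltjes transform of the semicircle law, which is the inverse of z -> z + 1/z with
  values in the unit disc. Written as an integral it is holomorphic off [-2,2] without any choice of
  a square root.\<close>

definition inverse_joukowski :: "complex \<Rightarrow> complex" where
  "inverse_joukowski w = (LINT x:{-2..2}|semicircle. 1 / (w - of_real x))"

lemma set_integrable_semicircle_one: "set_integrable semicircle {-2..2} (\<lambda>x. 1 :: complex)"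
  by (rule set_integrable_continuous_finite_measure[OF finite_measure_semicircle sets_semicircle]) simp

lemma closed_real_segment: "closed (complex_of_real ` {a..b})"
  by (intro compact_imp_closed compact_continuous_image continuous_intros compact_Icc)

lemma holomorphic_inverse_joukowski: "inverse_joukowski holomorphic_on - of_real ` {-2..2}"
  unfolding inverse_joukowski_def
  by (rule holomorphic_cauchy_transform(1)[OF set_integrable_semicircle_one sets_semicircle])
    (auto simp: closed_real_segment)

text \<open>All coefficients beyond k = 0 vanish because U_k is orthogonal to U_0 = 1.\<close>

lemma semicircle_kernel:
  assumes z: "norm z < 1"
  shows "(LINT x:{-2..2}|semicircle. 1 / cheb_denom z x) = 1"
proof -
  have "(\<lambda>k. (if k = 0 then 1 else 0) * z ^ k) sums (LINT x:{-2..2}|semicircle. 1 / cheb_denom z x)"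
    using cheb_U_integral_sums(1)[OF set_integrable_semicircle_one sets_semicircle z]
    by (simp add: semicircle_cheb_U)
  moreover have "(\<lambda>k. (if k = 0 then 1 else 0) * z ^ k) sums 1"
    using sums_If_finite_set[of "{0::nat}" "\<lambda>k. z ^ k"] by (simp add: if_distrib[of "\<lambda>c. c * _"] cong: if_cong)
  ultimately show ?thesis by (rule sums_unique2)
qed

lemma inverse_joukowski_eq:
  assumes z: "z \<noteq> 0" "norm z < 1"
  shows "inverse_joukowski (z + 1 / z) = z"
proof -
  have e: "z / cheb_denom z x = z * (1 / cheb_denom z x)" for x by simp
  show ?thesis
    unfolding inverse_joukowski_def joukowski_kernel[OF z(1)] e set_integral_mult_right semicircle_kernel[OF z(2)] by simp
qed

text \<open>The roots of v^2 - w v + 1 have product 1, so one of them lies in the open disc unless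
  both have modulus 1. In that case 1/v = cnj v and w = 2 Re v would lie in the segment.\<close>

lemma joukowski_surj:
  fixes w :: complex
  assumes w: "w \<notin> of_real ` {-2..2}"
  obtains z where "z \<noteq> 0" "norm z < 1" "w = z + 1 / z"
proof -
  define v where "v = (w + csqrt (w\<^sup>2 - 4)) / (2::complex)"
  define d where "d = csqrt (w\<^sup>2 - 4)"
  have d: "2 * v = w + d" "d\<^sup>2 = w\<^sup>2 - 4" by (simp_all add: v_def d_def)
  have "4 * (v\<^sup>2 + 1) = (2 * v)\<^sup>2 + 4" by (simp add: power_mult_distrib)
  also have "\<dots> = w\<^sup>2 + d\<^sup>2 + 2 * w * d + 4" unfolding d(1) by (simp add: power2_sum)
  also have "\<dots> = 2 * w * (2 * v)" unfolding d by (simp add: algebra_simps power2_eq_square)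
  finally have "4 * (v\<^sup>2 + 1) = 4 * (w * v)" by simp
  then have q: "v\<^sup>2 + 1 = w * v" by (simp only: mult_cancel_left) simp
  have v0: "v \<noteq> 0" using q by auto
  have wv: "w = v + 1 / v" using q v0 by (simp add: field_simps power2_eq_square)
  consider "norm v < 1" | "norm v = 1" | "norm v > 1" by linarith
  then show thesis
  proof cases
    case 1 then show ?thesis using that v0 wv by blast
  next
    case 2
    have "v * cnj v = 1" using 2 complex_norm_square[of v] by simp
    then have cv: "1 / v = cnj v" using v0 by (simp add: divide_eq_eq mult.commute)
    have "w = of_real (2 * Re v)" by (subst wv, subst cv, rule complex_add_cnj)
    moreover have "2 * Re v \<in> {-2..2}" using abs_Re_le_cmod[of v] 2 by auto
    ultimately show ?thesis using w by blast
  next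
    case 3
    show ?thesis
      by (rule that[of "1 / v"]) (use v0 wv 3 in \<open>auto simp: norm_divide add.commute\<close>)
  qed
qed

lemma inverse_joukowski_expansion:
  assumes w: "w \<notin> of_real ` {-2..2}"
  shows "norm (inverse_joukowski w) < 1"
    and "x \<in> {-2..2} \<Longrightarrow> (\<lambda>k. of_real (U_half k x) * inverse_joukowski w ^ (k + 1)) sums (1 / (w - of_real x))"
proof -
  obtain z where z: "z \<noteq> 0" "norm z < 1" "w = z + 1 / z" using joukowski_surj[OF w] .
  have g: "inverse_joukowski w = z" unfolding z(3) by (rule inverse_joukowski_eq[OF z(1,2)])
  show "norm (inverse_joukowski w) < 1" using g z by simp
  assume x: "x \<in> {-2..2}"
  have "(\<lambda>k. z * (z ^ k * of_real (U_half k x))) sums (z * (1 / cheb_denom z x))"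
    by (intro sums_mult cheb_U_generating) (use x z in auto)
  then show "(\<lambda>k. of_real (U_half k x) * inverse_joukowski w ^ (k + 1)) sums (1 / (w - of_real x))"
    unfolding g unfolding z(3) joukowski_kernel[OF z(1)] by (simp add: mult_ac)
qed

lemma rectangle_around_segment:
  fixes U :: "complex set"
  assumes U: "open U" "of_real ` {-2..2} \<subseteq> U"
  obtains V \<gamma> where "open V" "convex V" "of_real ` {-2..2} \<subseteq> V" "V \<subseteq> U"
    "valid_path \<gamma>" "pathfinish \<gamma> = pathstart \<gamma>" "path_image \<gamma> \<subseteq> V - of_real ` {-2..2}"
    "\<And>x. x \<in> {-2..2} \<Longrightarrow> winding_number \<gamma> (of_real x) = 1"
proof -
  have "compact (complex_of_real ` {-2..2})" by (intro compact_continuous_image continuous_intros compact_Icc)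
  then obtain e where e: "e > 0" "(\<Union>x\<in>complex_of_real ` {-2..2}. ball x e) \<subseteq> U"
    using compact_subset_open_imp_ball_epsilon_subset U by metis
  \<comment> \<open>In V a point differs from its nearest point of [-2,2] by less than 2h in each
    coordinate, hence by less than 4h = e.\<close>
  define h where "h = e / 4"
  have h: "h > 0" "e = 4 * h" using e by (auto simp: h_def)
  define V where "V = box (Complex (-2 - 2 * h) (-2 * h)) (Complex (2 + 2 * h) (2 * h))"
  let ?a = "Complex (-2 - h) (-h)" and ?b = "Complex (2 + h) h"
  have VU: "V \<subseteq> U"
  proof
    fix w assume "w \<in> V"
    then have w: "-2 - 2 * h < Re w" "Re w < 2 + 2 * h" "-2 * h < Im w" "Im w < 2 * h"
      by (auto simp: V_def in_box_complex_iff)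
    define x where "x = max (-2) (min 2 (Re w))"
    have "\<bar>Re w - x\<bar> < 2 * h" using w h unfolding x_def by (auto simp: max_def min_def)
    moreover have "\<bar>Im w\<bar> < 2 * h" using w by auto
    ultimately have "norm (w - of_real x) < e"
      using cmod_le[of "w - of_real x"] h by simp
    then have "w \<in> ball (complex_of_real x) e" by (simp add: dist_norm norm_minus_commute)
    moreover have "x \<in> {-2..2}" by (auto simp: x_def)
    ultimately show "w \<in> U" using e(2) by blast
  qed
  have pi: "path_image (rectpath ?a ?b) = cbox ?a ?b - box ?a ?b"
    by (rule path_image_rectpath_cbox_minus_box) (use h in auto)
  show thesis
  proof (rule that[of V "rectpath ?a ?b"])
    show "open V" "convex V" unfolding V_def by (auto simp: open_box convex_box)
    show "of_real ` {-2..2} \<subseteq> V" using h by (auto simp: V_def in_box_complex_iff)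
    show "V \<subseteq> U" by (rule VU)
    show "valid_path (rectpath ?a ?b)" "pathfinish (rectpath ?a ?b) = pathstart (rectpath ?a ?b)" by auto
    show "path_image (rectpath ?a ?b) \<subseteq> V - of_real ` {-2..2}"
      unfolding pi using h by (auto simp: V_def in_box_complex_iff in_cbox_complex_iff)
    show "winding_number (rectpath ?a ?b) (of_real x) = 1" if "x \<in> {-2..2}" for x
      by (rule winding_number_rectpath) (use that h in \<open>auto simp: in_box_complex_iff\<close>)
  qed
qed

text \<open>Insert the expansion of 1 / (w - x) in powers of G = \<open>inverse_joukowski\<close> w
  into Cauchy's formula on a rectangle around the segment. The coefficients are contour integrals of
  \<phi> G^(k+1) divided by 2 pi i, and the maximum of |G| on the rectangle is below some q <
  1.\<close>

lemma cheb_U_expansion: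
  fixes \<phi> :: "complex \<Rightarrow> complex"
  assumes \<phi>: "\<phi> analytic_on (of_real ` {-2..2})"
  obtains b C q where "0 < q" "q < 1" "0 \<le> C" "\<And>k. norm (b k) \<le> C * q ^ k"
    "\<And>x. x \<in> {-2..2} \<Longrightarrow> (\<lambda>k. b k * of_real (U_half k x)) sums \<phi> (of_real x)"
proof -
  let ?I = "complex_of_real ` {-2..2}" and ?G = inverse_joukowski
  obtain U where U: "open U" "?I \<subseteq> U" "\<phi> holomorphic_on U"
    using \<phi> unfolding analytic_on_holomorphic by blast
  obtain V \<gamma> where V: "open V" "convex V" "?I \<subseteq> V" "V \<subseteq> U"
    and \<gamma>: "valid_path \<gamma>" "pathfinish \<gamma> = pathstart \<gamma>" "path_image \<gamma> \<subseteq> V - ?I"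
    and wind: "\<And>x. x \<in> {-2..2} \<Longrightarrow> winding_number \<gamma> (of_real x) = 1"
    using rectangle_around_segment[OF U(1,2)] by metis
  have hol\<phi>: "\<phi> holomorphic_on V" by (rule holomorphic_on_subset[OF U(3) V(4)])
  have openVI: "open (V - ?I)" using V(1) closed_real_segment by (intro open_Diff)
  have holG: "?G holomorphic_on V - ?I"
    by (rule holomorphic_on_subset[OF holomorphic_inverse_joukowski]) auto
  have cP: "compact (path_image \<gamma>)" and neP: "path_image \<gamma> \<noteq> {}"
    using compact_path_image valid_path_imp_path[OF \<gamma>(1)] by auto
  have "continuous_on (path_image \<gamma>) (\<lambda>w. norm (?G w))" "continuous_on (path_image \<gamma>) (\<lambda>w. norm (\<phi> w))"
    using \<gamma>(3) by (auto intro!: continuous_intros holomorphic_on_imp_continuous_on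
        holomorphic_on_subset[OF holG] holomorphic_on_subset[OF hol\<phi>])
  then obtain p p' where p: "p \<in> path_image \<gamma>" "\<And>w. w \<in> path_image \<gamma> \<Longrightarrow> norm (?G w) \<le> norm (?G p)"
    and p': "\<And>w. w \<in> path_image \<gamma> \<Longrightarrow> norm (\<phi> w) \<le> norm (\<phi> p')"
    using continuous_attains_sup[OF cP neP] by metis
  have "norm (?G p) < 1" using inverse_joukowski_expansion(1)[of p] p(1) \<gamma>(3) by blast
  then obtain q where q: "norm (?G p) < q" "q < 1" using dense by blast
  have q0: "0 < q" using q(1) norm_ge_zero[of "?G p"] by linarith
  define M where "M = norm (\<phi> p') + 1"
  \<comment> \<open>The strict bounds for G and \<phi> hold on an open neighbourhood of the path, as
    the available bound on contour integrals asks for an open set rather than the path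
    alone.\<close>
  define S where "S = (V - ?I) \<inter> (\<lambda>w. (?G w, \<phi> w)) -` (ball 0 q \<times> ball 0 M)"
  have "continuous_on (V - ?I) (\<lambda>w. (?G w, \<phi> w))"
    by (intro continuous_on_Pair holomorphic_on_imp_continuous_on holG holomorphic_on_subset[OF hol\<phi>]) auto
  then have openS: "open S"
    unfolding S_def by (rule continuous_open_preimage) (auto intro: openVI open_Times)
  have PS: "path_image \<gamma> \<subseteq> S"
  proof
    fix w assume w: "w \<in> path_image \<gamma>"
    then show "w \<in> S" using p(2)[OF w] p'[OF w] q \<gamma>(3) by (auto simp: S_def M_def)
  qed
  have S: "w \<in> V" "w \<notin> ?I" "norm (?G w) < q" "norm (\<phi> w) < M" if "w \<in> S" for w
    using that by (auto simp: S_def)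
  have holS: "?G holomorphic_on S" "\<phi> holomorphic_on S"
    using S by (auto intro: holomorphic_on_subset[OF holG] holomorphic_on_subset[OF hol\<phi>])
  have M: "0 < M" unfolding M_def using norm_ge_zero[of "\<phi> p'"] by linarith
  obtain L where L: "0 < L" "\<And>f B. f holomorphic_on S \<Longrightarrow> (\<And>w. w \<in> S \<Longrightarrow> norm (f w) \<le> B) \<Longrightarrow>
      norm (contour_integral \<gamma> f) \<le> L * B"
    using contour_integral_bound_exists[OF openS \<gamma>(1) PS] by metis
  define T where "T k w = \<phi> w * ?G w ^ (k + 1)" for k w
  define b where "b k = contour_integral \<gamma> (T k) / (2 * pi * \<i>)" for k
  have holT: "T k holomorphic_on S" for k unfolding T_def by (intro holomorphic_intros holS)
  have ciT: "T k contour_integrable_on \<gamma>" for k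
    by (rule contour_integrable_holomorphic_simple[OF holT openS \<gamma>(1) PS])
  show thesis
  proof (rule that[OF q0 q(2), of "L * (M * q) / (2 * pi)"])
    show "0 \<le> L * (M * q) / (2 * pi)" using L(1) M q0 by simp
    fix k
    have "norm (contour_integral \<gamma> (T k)) \<le> L * (M * q ^ (k + 1))"
    proof (rule L(2)[OF holT])
      fix w assume w: "w \<in> S"
      show "norm (T k w) \<le> M * q ^ (k + 1)"
        unfolding T_def norm_mult norm_power
        by (intro mult_mono power_mono less_imp_le[OF S(3)] less_imp_le[OF S(4)] w) (use M in auto)
    qed
    then have "norm (contour_integral \<gamma> (T k)) / (2 * pi) \<le> L * (M * q ^ (k + 1)) / (2 * pi)"
      by (rule divide_right_mono) simp
    then show "norm (b k) \<le> L * (M * q) / (2 * pi) * q ^ k"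
      unfolding b_def by (simp add: norm_divide norm_mult mult_ac)
  next
    fix x :: real assume x: "x \<in> {-2..2}"
    define h where "h k = (real k + 1) * q ^ (k + 1)" for k
    have sh: "summable h"
      using summable_mult[OF summable_linear_power[of q], of q] q q0 by (simp add: h_def[abs_def] mult_ac)
    \<comment> \<open>Tail of the majorant (k+1) q^(k+1). It bounds the remainder of the kernel
      expansion uniformly on S, so the contour integral of the remainder tends to 0.\<close>
    define \<tau> where "\<tau> n = suminf h - (\<Sum>k<n. h k)" for n
    have \<tau>0: "\<tau> \<longlonglongrightarrow> 0"
      unfolding \<tau>_def using tendsto_diff[OF tendsto_const summable_LIMSEQ[OF sh], of "suminf h"] by simp
    define E where "E n w = \<phi> w * (1 / (w - of_real x) - (\<Sum>k<n. of_real (U_half k x) * ?G w ^ (k + 1)))" for n w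
    have wx: "w - of_real x \<noteq> 0" if "w \<in> S" for w using S(2)[OF that] x by auto
    have holE: "E n holomorphic_on S" for n
      unfolding E_def by (intro holomorphic_intros holS) (use wx in auto)
    have Ebound: "norm (E n w) \<le> M * \<tau> n" if w: "w \<in> S" for n w
    proof -
      let ?f = "\<lambda>k. of_real (U_half k x) * ?G w ^ (k + 1)"
      have "norm (1 / (w - of_real x) - (\<Sum>k<n. ?f k)) \<le> \<tau> n"
      proof (rule norm_sums_le)
        show "(\<lambda>k. ?f (k + n)) sums (1 / (w - of_real x) - (\<Sum>k<n. ?f k))"
          by (rule iffD2[OF sums_iff_shift]) (use inverse_joukowski_expansion(2)[OF S(2)[OF w] x] in simp)
        show "(\<lambda>k. h (k + n)) sums \<tau> n"
          by (rule iffD2[OF sums_iff_shift]) (use summable_sums[OF sh] in \<open>simp add: \<tau>_def\<close>)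
        fix k
        show "norm (?f (k + n)) \<le> h (k + n)"
          unfolding h_def norm_mult norm_power norm_of_real
          by (intro mult_mono power_mono abs_U_half_le less_imp_le[OF S(3)] w) (use x in auto)
      qed
      then show ?thesis
        unfolding E_def norm_mult by (intro mult_mono less_imp_le[OF S(4)] w) (use M in auto)
    qed
    have ciE: "E n contour_integrable_on \<gamma>" for n
      by (rule contour_integrable_holomorphic_simple[OF holE openS \<gamma>(1) PS])
    have x_in: "of_real x \<in> interior V" using V x by (simp add: interior_open image_subset_iff)
    have "((\<lambda>w. \<phi> w / (w - of_real x)) has_contour_integral (2 * pi * \<i> * winding_number \<gamma> (of_real x) * \<phi> (of_real x))) \<gamma>"
      by (rule Cauchy_integral_formula_convex_simple[OF V(2) hol\<phi> x_in \<gamma>(1) _ \<gamma>(2)]) (use \<gamma>(3) x in auto)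
    then have cauchy: "((\<lambda>w. \<phi> w / (w - of_real x)) has_contour_integral (2 * pi * \<i> * \<phi> (of_real x))) \<gamma>"
      using wind[OF x] by simp
    have partial: "contour_integral \<gamma> (E n) = 2 * pi * \<i> * (\<phi> (of_real x) - (\<Sum>k<n. b k * of_real (U_half k x)))" for n
    proof -
      have "((\<lambda>w. \<phi> w / (w - of_real x) - (\<Sum>k<n. of_real (U_half k x) * T k w)) has_contour_integral
          (2 * pi * \<i> * \<phi> (of_real x) - (\<Sum>k<n. of_real (U_half k x) * contour_integral \<gamma> (T k)))) \<gamma>"
        by (intro has_contour_integral_diff cauchy has_contour_integral_sum has_contour_integral_lmul
            has_contour_integral_integral ciT) auto
      also have "(\<lambda>w. \<phi> w / (w - of_real x) - (\<Sum>k<n. of_real (U_half k x) * T k w)) = E n"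
        by (auto simp: fun_eq_iff E_def T_def right_diff_distrib sum_distrib_left mult_ac)
      finally show ?thesis
        by (subst contour_integral_unique) (auto simp: b_def right_diff_distrib sum_distrib_left mult_ac)
    qed
    have "(\<lambda>n. \<phi> (of_real x) - (\<Sum>k<n. b k * of_real (U_half k x))) \<longlonglongrightarrow> 0"
    proof (rule Lim_null_comparison)
      show "(\<lambda>n. L * (M * \<tau> n) / (2 * pi)) \<longlonglongrightarrow> 0"
        using tendsto_mult_left[OF \<tau>0, of "L * M / (2 * pi)"] by (simp add: mult_ac)
      show "\<forall>\<^sub>F n in sequentially. norm (\<phi> (of_real x) - (\<Sum>k<n. b k * of_real (U_half k x))) \<le> L * (M * \<tau> n) / (2 * pi)"
      proof (rule always_eventually, rule allI)
        fix n
        have "norm (2 * pi * \<i> * (\<phi> (of_real x) - (\<Sum>k<n. b k * of_real (U_half k x)))) \<le> L * (M * \<tau> n)"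
          unfolding partial[symmetric] by (rule L(2)[OF holE Ebound])
        then show "norm (\<phi> (of_real x) - (\<Sum>k<n. b k * of_real (U_half k x))) \<le> L * (M * \<tau> n) / (2 * pi)"
          unfolding norm_mult[of "2 * pi * \<i>"] by (simp add: norm_mult pos_le_divide_eq mult_ac del: right_diff_distrib_numeral)
      qed
    qed
    then have "(\<lambda>n. \<phi> (of_real x) - (\<phi> (of_real x) - (\<Sum>k<n. b k * of_real (U_half k x)))) \<longlonglongrightarrow> \<phi> (of_real x) - 0"
      by (intro tendsto_intros)
    then show "(\<lambda>k. b k * of_real (U_half k x)) sums \<phi> (of_real x)" by (simp add: sums_def)
  qed
qed

section \<open>Fluctuations of the diagrams\<close>

context linear_statistics
begin

definition center :: "nat \<Rightarrow> real" where "center n = diagram_center (\<omega> n)"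
definition outer_mass :: "nat \<Rightarrow> real" where "outer_mass n = 1 - measure (\<mu> n) {-2..2}"
definition inner_mean :: "nat \<Rightarrow> real" where "inner_mean n = (LINT x:{-2..2}|\<mu> n. x)"

lemma eps_props: "\<forall>\<^sub>F n in sequentially. 1 \<le> n \<and> 0 < \<epsilon> n" "\<epsilon> \<longlonglongrightarrow> 0"
proof -
  have *: "\<forall>\<^sub>F n in sequentially. \<epsilon> n \<in> {0<..} \<and> \<epsilon> n \<noteq> 0" and "\<epsilon> \<longlonglongrightarrow> 0"
    using eps unfolding filterlim_at by blast+
  then show "\<epsilon> \<longlonglongrightarrow> 0" by blast
  show "\<forall>\<^sub>F n in sequentially. 1 \<le> n \<and> 0 < \<epsilon> n"
    using * eventually_ge_at_top[of 1] by eventually_elim auto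
qed

lemma lin_one: "n \<ge> 1 \<Longrightarrow> lin n (\<lambda>x. 1) = of_real (- (outer_mass n / \<epsilon> n))"
proof -
  assume n: "n \<ge> 1"
  interpret prob_space "\<mu> n" by (rule \<mu>_props(1)[OF n])
  have sp: "space (\<mu> n) = UNIV" using sets_eq_imp_space_eq[OF \<mu>_props(2)[OF n]] by simp
  have "(LINT x:{-2..2}|\<mu> n. (1::complex)) = of_real (measure (\<mu> n) {-2..2})"
    by (simp add: set_lebesgue_integral_def \<mu>_props(2)[OF n] sp scaleR_conv_of_real)
  moreover have "(LINT x:{-2..2}|semicircle. (1::complex)) = 1" using semicircle_cheb_U[of 0] by simp
  ultimately show ?thesis by (simp add: lin_def outer_mass_def field_simps diff_divide_distrib)
qed

lemma lin_ident: "lin n of_real = of_real (inner_mean n / \<epsilon> n)"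
proof -
  have "(LINT x:{-2..2}|semicircle. complex_of_real x) = 0" using semicircle_cheb_U[of 1] by (simp add: U_half_1)
  then show ?thesis by (simp add: lin_def inner_mean_def set_integral_complex_of_real)
qed

lemma prob_R: "n \<ge> 1 \<Longrightarrow> measure (\<mu> n) {-R..R} = 1"
  using markov_center_eq_mean(2)[OF markov AB] R by simp

text \<open>The centre is the mean over all of [-R,R], the inner mean only over [-2,2]; on the rest
  |x| is at most R.\<close>

lemma center_minus_mean: assumes n: "n \<ge> 1" shows "\<bar>center n - inner_mean n\<bar> \<le> R * outer_mass n"
proof -
  interpret prob_space "\<mu> n" by (rule \<mu>_props(1)[OF n])
  define A where "A = {-R..R} - {-2..2::real}"
  have A: "{-R..R} = {-2..2} \<union> A" "{-2..2} \<inter> A = {}" "A \<in> sets borel" "A \<subseteq> {-R..R}"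
    using R by (auto simp: A_def)
  have int: "set_integrable (\<mu> n) {-R..R} (\<lambda>x. x)"
    by (rule set_integrable_continuous_finite_measure[OF \<mu>_props(3,2)[OF n]]) (intro continuous_intros)
  have sub: "set_integrable (\<mu> n) B (\<lambda>x. x)" if "B \<in> sets borel" "B \<subseteq> {-R..R}" for B
    by (rule set_integrable_subset[OF int]) (use that \<mu>_props(2)[OF n] in auto)
  have c: "center n = (LINT x:{-2..2} \<union> A|\<mu> n. x)"
    unfolding A(1)[symmetric] center_def by (rule markov_center_eq_mean(1)[OF markov[OF n] AB]) (use R in simp)
  have "(LINT x:{-2..2} \<union> A|\<mu> n. x) = inner_mean n + (LINT x:A|\<mu> n. x)"
    unfolding inner_mean_def by (intro set_integral_Un A(2) sub) (use A R in auto)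
  then have "\<bar>center n - inner_mean n\<bar> = norm (LINT x:A|\<mu> n. x)" unfolding c by simp
  also have "\<dots> \<le> (LINT x:A|\<mu> n. norm x)" by (intro set_integral_norm_bound sub A)
  also have "\<dots> \<le> (LINT x:A|\<mu> n. R)"
  proof (intro set_integral_mono set_integrable_norm sub A)
    show "set_integrable (\<mu> n) A (\<lambda>_. R)"
      by (rule set_integrable_subset[OF set_integrable_continuous_finite_measure[OF \<mu>_props(3,2)[OF n] continuous_on_const]])
        (use A \<mu>_props(2)[OF n] in auto)
    fix x assume "x \<in> A"
    then have "x \<in> {-R..R}" using A(4) by blast
    then show "norm x \<le> R" by auto
  qed
  also have "\<dots> = R * measure (\<mu> n) A"
    using A \<mu>_props(2)[OF n] sets_eq_imp_space_eq[OF \<mu>_props(2)[OF n]] by (simp add: set_lebesgue_integral_def)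
  also have "measure (\<mu> n) A = outer_mass n"
    unfolding A_def outer_mass_def
    by (subst finite_measure_Diff) (use R \<mu>_props(2)[OF n] prob_R[OF n] in auto)
  finally show ?thesis .
qed

text \<open>The fluctuation of the constant is minus the outer mass divided by \<epsilon>, and its
  limit is 0. This is all that is known outside [-2,2].\<close>

lemma outer_mass_over_eps: "(\<lambda>n. outer_mass n / \<epsilon> n) \<longlonglongrightarrow> 0"
proof -
  have ev: "\<forall>\<^sub>F n in sequentially. lin n (\<lambda>x. 1) = complex_of_real (- (outer_mass n / \<epsilon> n))"
    using eventually_ge_at_top[of 1] by eventually_elim (rule lin_one)
  from tendsto_Re[OF Lim_transform_eventually[OF lin_one_limit ev]]
  have "(\<lambda>n. - (outer_mass n / \<epsilon> n)) \<longlonglongrightarrow> 0" by (simp only: Re_complex_of_real zero_complex.sel)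
  from tendsto_minus[OF this] show ?thesis by simp
qed

text \<open>On [-2,2] the function x is 2 T_1(x/2), so its fluctuation tends to 2 c_1; centre and
  inner mean differ by o(\<epsilon>).\<close>

lemma center_over_eps: "(\<lambda>n. complex_of_real (center n / \<epsilon> n)) \<longlonglongrightarrow> 2 * c 1"
proof -
  have "(\<lambda>n. complex_of_real (center n / \<epsilon> n) - lin n of_real) \<longlonglongrightarrow> 0"
  proof (rule Lim_null_comparison)
    show "(\<lambda>n. R * (outer_mass n / \<epsilon> n)) \<longlonglongrightarrow> 0"
      using tendsto_mult_left[OF outer_mass_over_eps, of R] by simp
    show "\<forall>\<^sub>F n in sequentially. norm (complex_of_real (center n / \<epsilon> n) - lin n of_real) \<le> R * (outer_mass n / \<epsilon> n)"
      using eps_props(1)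
    proof eventually_elim
      case (elim n)
      have "norm (complex_of_real (center n / \<epsilon> n) - lin n of_real) = \<bar>center n - inner_mean n\<bar> / \<epsilon> n"
        unfolding lin_ident of_real_diff[symmetric] norm_of_real diff_divide_distrib[symmetric] using elim by simp
      also have "\<dots> \<le> R * outer_mass n / \<epsilon> n"
        by (intro divide_right_mono center_minus_mean) (use elim in auto)
      finally show ?case by simp
    qed
  qed
  from tendsto_add[OF this lin_ident_limit] show ?thesis by simp
qed

lemma real_limits_0: "outer_mass \<longlonglongrightarrow> 0" "center \<longlonglongrightarrow> 0" "inner_mean \<longlonglongrightarrow> 0"
proof -
  have ev: "\<forall>\<^sub>F n in sequentially. \<epsilon> n \<noteq> 0" using eps_props(1) by eventually_elim auto
  have "(\<lambda>n. outer_mass n / \<epsilon> n * \<epsilon> n) \<longlonglongrightarrow> 0"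
    using tendsto_mult[OF outer_mass_over_eps eps_props(2)] by (simp only: mult_zero_left)
  then show "outer_mass \<longlonglongrightarrow> 0"
    by (rule Lim_transform_eventually[OF _ eventually_mono[OF ev]]) simp
  have e0: "(\<lambda>n. complex_of_real (\<epsilon> n)) \<longlonglongrightarrow> of_real 0" by (intro tendsto_of_real eps_props)
  have "(\<lambda>n. center n / \<epsilon> n * \<epsilon> n) \<longlonglongrightarrow> 0"
    using tendsto_Re[OF tendsto_mult[OF center_over_eps e0]]
    by (simp only: of_real_mult[symmetric] Re_complex_of_real of_real_0 mult_zero_right zero_complex.sel)
  then show "center \<longlonglongrightarrow> 0"
    by (rule Lim_transform_eventually[OF _ eventually_mono[OF ev]]) simp
  have "(\<lambda>n. inner_mean n / \<epsilon> n * \<epsilon> n) \<longlonglongrightarrow> 0"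
    using tendsto_Re[OF tendsto_mult[OF lin_ident_limit[unfolded lin_ident] e0]]
    by (simp only: of_real_mult[symmetric] Re_complex_of_real of_real_0 mult_zero_right zero_complex.sel)
  then show "inner_mean \<longlonglongrightarrow> 0"
    by (rule Lim_transform_eventually[OF _ eventually_mono[OF ev]]) simp
qed

lemma eventually_abs_less:
  fixes f :: "nat \<Rightarrow> real"
  assumes "f \<longlonglongrightarrow> 0" "0 < e" shows "\<forall>\<^sub>F n in sequentially. \<bar>f n\<bar> < e"
  using assms unfolding tendsto_iff by simp

abbreviation excess :: "nat \<Rightarrow> real \<Rightarrow> real" where "excess n \<equiv> diagram_excess (\<omega> n)"

lemma eventually_markov_pair:
  "\<forall>\<^sub>F n in sequentially. 1 \<le> n \<and> 0 < \<epsilon> n \<and> markov_pair (\<mu> n) (excess n) (center n) R (4 * R + 2)"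
  using eps_props(1) eventually_abs_less[OF real_limits_0(2), of 1, simplified]
proof eventually_elim
  case (elim n)
  then show ?case
    using markov_pair_of_transform[OF markov[of n] AB R] by (simp add: center_def)
qed

text \<open>The linearised Markov relation, uniform on the disc of radius s. Both logarithms are
  replaced by their linear parts; their remainders are quadratic in quantities of order \<epsilon>
  and thus vanish after division by \<epsilon>, as does the error linear in the outer mass.\<close>

lemma gap_asymptotic:
  assumes s: "0 < s" "s < 1"
  obtains \<eta> where "\<eta> \<longlonglongrightarrow> 0" and "\<forall>\<^sub>F n in sequentially. \<forall>z. norm z \<le> s \<longrightarrow>
    norm (1 / 2 * (z\<^sup>2 * LSVK_gap (excess n) z) / of_real (\<epsilon> n) -
      (lin n (\<lambda>x. 1 / cheb_denom z x) - of_real (center n / \<epsilon> n) * (z / (1 + z\<^sup>2)))) \<le> \<eta> n"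
proof -
  \<comment> \<open>Radii dividing [s,1] in three: the claim lives on s, the maximum principle on r,
    and the functions are holomorphic up to \<rho>.\<close>
  define r where "r = (2 * s + 1) / 3"
  define \<rho> where "\<rho> = (s + 2) / 3"
  have r: "s < r" "r < \<rho>" "\<rho> < 1" "0 < \<rho>" using s by (auto simp: r_def \<rho>_def)
  define K where "K = excess_const R (4 * R + 2) (1 / (10 * R\<^sup>2))"
  have K0: "0 \<le> K"
    unfolding K_def excess_const_def using R pi_ge_zero
    by (intro divide_nonneg_nonneg mult_nonneg_nonneg add_nonneg_nonneg) auto
  obtain C where C: "0 < C" "\<And>n z. n \<ge> 1 \<Longrightarrow> norm z \<le> \<rho> \<Longrightarrow> norm (lin n (\<lambda>x. 1 / cheb_denom z x)) \<le> C"
    using lin_kernel_bounded[OF r(4,3)] by blast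
  define H where "H = inner_log_const (4 * R + 2) K r s"
  \<comment> \<open>In this order: logarithmic defect from the outer mass, quadratic error of the
    centre, quadratic error of the measure fluctuation.\<close>
  define \<eta> where "\<eta> n = H * (outer_mass n / \<epsilon> n) + 2 * \<bar>center n / \<epsilon> n\<bar> * \<bar>center n\<bar> / (1 - s\<^sup>2)\<^sup>2 + 2 * C\<^sup>2 * \<epsilon> n" for n
  have sq1: "0 < 1 - \<rho>\<^sup>2" "0 < 1 - s\<^sup>2"
    using r s power_less_one_iff[of \<rho> 2] power_less_one_iff[of s 2] by auto
  have collect: "(h * m + 2 * (x / p)\<^sup>2 + 2 * (e * d)\<^sup>2) / e = h * (m / e) + 2 * (x / e) * x / p\<^sup>2 + 2 * d\<^sup>2 * e"
    if "e \<noteq> 0" "p \<noteq> 0" for h m x p e d :: real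
    using that by (simp add: field_simps power2_eq_square)
  have half_cancel: "x / 2 / x = 1 / 2" if "0 < x" for x :: real using that by simp
  show thesis
  proof (rule that)
    have "(\<lambda>n. \<bar>center n / \<epsilon> n\<bar>) \<longlonglongrightarrow> norm (2 * c 1)"
      using tendsto_norm[OF center_over_eps] unfolding norm_of_real .
    then have "\<eta> \<longlonglongrightarrow> H * 0 + 2 * norm (2 * c 1) * \<bar>0\<bar> / (1 - s\<^sup>2)\<^sup>2 + 2 * C\<^sup>2 * 0"
      unfolding \<eta>_def by (intro tendsto_intros outer_mass_over_eps real_limits_0 eps_props) (use sq1 in auto)
    then show "\<eta> \<longlonglongrightarrow> 0" by simp
    have e1: "\<forall>\<^sub>F n in sequentially. \<bar>outer_mass n\<bar> < 1 / (80 * R\<^sup>2)"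
      and e2: "\<forall>\<^sub>F n in sequentially. \<bar>inner_mean n\<bar> < 1 / 2"
      and e3: "\<forall>\<^sub>F n in sequentially. \<bar>center n\<bar> < (1 - \<rho>\<^sup>2) / 2"
      and e4: "\<forall>\<^sub>F n in sequentially. \<bar>\<epsilon> n\<bar> < 1 / (2 * C)"
      by (intro eventually_abs_less real_limits_0 eps_props; use R sq1 C in simp)+
    show "\<forall>\<^sub>F n in sequentially. \<forall>z. norm z \<le> s \<longrightarrow>
      norm (1 / 2 * (z\<^sup>2 * LSVK_gap (excess n) z) / of_real (\<epsilon> n) -
        (lin n (\<lambda>x. 1 / cheb_denom z x) - of_real (center n / \<epsilon> n) * (z / (1 + z\<^sup>2)))) \<le> \<eta> n"
      using eventually_markov_pair e1 e2 e3 e4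
    proof eventually_elim
      case (elim n)
      then have n: "n \<ge> 1" and \<epsilon>0: "0 < \<epsilon> n" and mp: "markov_pair (\<mu> n) (excess n) (center n) R (4 * R + 2)" by auto
      define D where "D z = lin n (\<lambda>x. 1 / cheb_denom z x)" for z
      have m80: "80 * R\<^sup>2 * outer_mass n \<le> 1"
      proof -
        have "outer_mass n < 1 / (80 * R\<^sup>2)" using elim by linarith
        then show ?thesis using R by (simp add: pos_less_divide_eq mult_ac)
      qed
      have mean: "\<bar>LINT x:{-2..2}|\<mu> n. x\<bar> \<le> 1 / 2" using elim unfolding inner_mean_def by linarith
      note out = markov_pair.outside_excess[OF mp prob_R[OF n] outer_mass_def m80 mean, folded K_def]
      \<comment> \<open>The semicircle law contributes exactly 1, so the logarithm of this transform
        is \<epsilon> D(z) to first order.\<close>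
      have G: "(LINT x:{-2..2}|\<mu> n. 1 / cheb_denom z x) = 1 + of_real (\<epsilon> n) * D z" if "norm z < 1" for z
        unfolding D_def lin_def using semicircle_kernel[OF that] \<epsilon>0 by simp
      have \<epsilon>D: "norm (of_real (\<epsilon> n) * D z) \<le> 1 / 2" if "norm z \<le> \<rho>" for z
      proof -
        have "norm (of_real (\<epsilon> n) * D z) \<le> 1 / (2 * C) * C"
          unfolding norm_mult by (intro mult_mono) (use elim C that n in \<open>auto simp: D_def\<close>)
        then show ?thesis using C by simp
      qed
      have au: "norm (of_real (center n) * (z / (1 + z\<^sup>2))) \<le> \<bar>center n\<bar> / (1 - t\<^sup>2)"
        if "norm z \<le> t" "0 < 1 - t\<^sup>2" "t < 1" for z :: complex and t
      proof -
        have "norm z / norm (1 + z\<^sup>2) \<le> 1 / (1 - t\<^sup>2)"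
          by (intro frac_le norm_1_plus_square_ge that) (use that in auto)
        from mult_left_mono[OF this, of "\<bar>center n\<bar>"] show ?thesis by (simp add: norm_mult norm_divide)
      qed
      show ?case
      proof (intro allI impI)
        fix z :: complex assume z: "norm z \<le> s"
        let ?u = "of_real (center n) * (z / (1 + z\<^sup>2))" and ?v = "- (of_real (\<epsilon> n) * D z)"
        let ?Q = "1 / 2 * (z\<^sup>2 * LSVK_gap (excess n) z)"
        have half: "norm (of_real (center n) * (y / (1 + y\<^sup>2))) \<le> 1 / 2" if "norm y < \<rho>" for y :: complex
        proof -
          have "norm (of_real (center n) * (y / (1 + y\<^sup>2))) \<le> \<bar>center n\<bar> / (1 - \<rho>\<^sup>2)"
            by (rule au) (use that sq1 r in auto)
          also have "\<dots> \<le> (1 - \<rho>\<^sup>2) / 2 / (1 - \<rho>\<^sup>2)" by (intro divide_right_mono) (use elim sq1 in auto)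
          also have "\<dots> = 1 / 2" using half_cancel[OF sq1(1)] .
          finally show ?thesis .
        qed
        have z\<rho>: "norm z < \<rho>" "norm z < 1" using z r by auto
        have 1: "norm (?Q - Ln (1 - ?u) - Ln (LINT x:{-2..2}|\<mu> n. 1 / cheb_denom z x)) \<le> H * outer_mass n"
          unfolding H_def
        proof (rule markov_pair.inner_log_bound[OF mp s(1) r(1-3) out K0 prob_R[OF n] outer_mass_def _ half z])
          fix y :: complex assume y: "norm y < \<rho>"
          then have "norm y < 1" using r by simp
          from G[OF this] show "norm ((LINT x:{-2..2}|\<mu> n. 1 / cheb_denom y x) - 1) \<le> 1 / 2"
            using \<epsilon>D[of y] y by simp
        qed
        have 2: "norm (Ln (1 - ?u) + ?u) \<le> 2 * (\<bar>center n\<bar> / (1 - s\<^sup>2))\<^sup>2"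
        proof (rule order_trans[OF norm_Ln_1_minus(1)[OF half[OF z\<rho>(1)]]])
          have "norm ?u \<le> \<bar>center n\<bar> / (1 - s\<^sup>2)" by (rule au) (use z sq1 s in auto)
          then show "2 * (norm ?u)\<^sup>2 \<le> 2 * (\<bar>center n\<bar> / (1 - s\<^sup>2))\<^sup>2" by (intro mult_left_mono power_mono) auto
        qed
        have 3: "norm (Ln (1 - ?v) + ?v) \<le> 2 * (\<epsilon> n * C)\<^sup>2"
        proof (rule order_trans[OF norm_Ln_1_minus(1)])
          show "norm ?v \<le> 1 / 2" using \<epsilon>D[of z] z\<rho> by simp
          have "norm ?v \<le> \<epsilon> n * C"
            unfolding norm_minus_cancel norm_mult using \<epsilon>0 C(2)[OF n, of z] z\<rho> by (simp add: D_def)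
          then show "2 * (norm ?v)\<^sup>2 \<le> 2 * (\<epsilon> n * C)\<^sup>2" by (intro mult_left_mono power_mono) auto
        qed
        let ?F = "?Q - Ln (1 - ?u) - Ln (LINT x:{-2..2}|\<mu> n. 1 / cheb_denom z x)"
        have "?Q / of_real (\<epsilon> n) - (D z - of_real (center n / \<epsilon> n) * (z / (1 + z\<^sup>2))) = (?F + (Ln (1 - ?u) + ?u) + (Ln (1 - ?v) + ?v)) / of_real (\<epsilon> n)"
          unfolding G[OF z\<rho>(2)] using \<epsilon>0 by (simp add: add_divide_distrib diff_divide_distrib)
        also have "norm \<dots> \<le> (H * outer_mass n + 2 * (\<bar>center n\<bar> / (1 - s\<^sup>2))\<^sup>2 + 2 * (\<epsilon> n * C)\<^sup>2) / \<epsilon> n"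
          unfolding norm_divide norm_of_real abs_of_pos[OF \<epsilon>0]
          by (intro divide_right_mono less_imp_le[OF \<epsilon>0] order_trans[OF norm_triangle_ineq] add_mono 1 2 3)
        also have "\<dots> = \<eta> n"
          unfolding \<eta>_def abs_divide abs_of_pos[OF \<epsilon>0] using collect[of "\<epsilon> n" "1 - s\<^sup>2"] \<epsilon>0 sq1 by simp
        finally show "norm (?Q / of_real (\<epsilon> n) - (lin n (\<lambda>x. 1 / cheb_denom z x) - of_real (center n / \<epsilon> n) * (z / (1 + z\<^sup>2)))) \<le> \<eta> n"
          unfolding D_def .
      qed
    qed
  qed
qed

section \<open>Taylor coefficients of the linearised relation\<close>

definition gap_coeff :: "nat \<Rightarrow> nat \<Rightarrow> complex" where
  "gap_coeff n k = 1 / of_real (\<epsilon> n) *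
    (LBINT x:{-2..2}. of_real (excess n x - (LSVK x - \<bar>x\<bar>)) * of_real (U_half k x))"

text \<open>Coefficients of the right side of the linearised relation: measure fluctuation minus the
  contribution of the centre from \<open>sine_generating\<close>.\<close>

definition kernel_coeff :: "nat \<Rightarrow> nat \<Rightarrow> complex" where
  "kernel_coeff n k = lin n (\<lambda>x. of_real (U_half k x)) - of_real (center n / \<epsilon> n) * of_real (sin (real k * pi / 2))"

lemma two_lin_cheb_T:
  assumes n: "n \<ge> 1"
  shows "2 * lin n (\<lambda>x. of_real (poly (cheb_T (k + 2)) (x / 2))) =
    lin n (\<lambda>x. of_real (U_half (k + 2) x)) - lin n (\<lambda>x. of_real (U_half k x))"
proof -
  have "2 * lin n (\<lambda>x. of_real (poly (cheb_T (k + 2)) (x / 2))) = lin n (\<lambda>x. of_real (U_half (k + 2) x) - of_real (U_half k x))"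
    unfolding lin_mult[symmetric] U_half_def
    by (intro arg_cong[of _ _ "lin n"] ext)
      (simp only: two_cheb_T_eq[symmetric] of_real_diff[symmetric] of_real_mult of_real_numeral)
  also have "\<dots> = lin n (\<lambda>x. of_real (U_half (k + 2) x)) - lin n (\<lambda>x. of_real (U_half k x))"
    by (rule lin_diff[OF n]) (intro continuous_intros)+
  finally show ?thesis .
qed

text \<open>The step two flips the sign of sin(k pi/2), so the centre terms add instead of
  cancelling; the U-terms combine to 2 T_(k+2).\<close>

lemma kernel_coeff_diff:
  assumes n: "n \<ge> 1"
  shows "kernel_coeff n (k + 2) - kernel_coeff n k =
    2 * lin n (\<lambda>x. of_real (poly (cheb_T (k + 2)) (x / 2))) - of_real (center n / \<epsilon> n) * of_real (2 * cos (real (k + 1) * pi / 2))"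
proof -
  have "sin (real (k + 2) * pi / 2) = - sin (real k * pi / 2)"
    using sin_periodic_pi[of "real k * pi / 2"] by (simp add: field_simps)
  moreover have "cos (real (k + 1) * pi / 2) = - sin (real k * pi / 2)"
    using minus_sin_cos_eq[of "real k * pi / 2"] by (simp add: field_simps)
  ultimately show ?thesis unfolding two_lin_cheb_T[OF n] kernel_coeff_def by (simp add: algebra_simps)
qed

text \<open>Multiply the linearised relation by 1 - z^2: the left side then has coefficients
  proportional to (k+1) \<open>gap_coeff\<close>, the right side becomes a difference with step two,
  and |1 - z^2| <= 2 doubles the error. Cauchy's inequality on the circle of radius s
  finishes.\<close>

lemma gap_coeff_asymptotic:
  assumes s: "0 < s" "s < 1"
  obtains \<eta> where "\<eta> \<longlonglongrightarrow> 0" and "\<forall>\<^sub>F n in sequentially. \<forall>k.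
    norm (of_nat (k + 1) / 2 * gap_coeff n k - (kernel_coeff n (k + 2) - kernel_coeff n k)) \<le> 2 * \<eta> n / s ^ (k + 2)"
proof -
  obtain \<eta> where \<eta>: "\<eta> \<longlonglongrightarrow> 0" "\<forall>\<^sub>F n in sequentially. \<forall>z. norm z \<le> s \<longrightarrow>
    norm (1 / 2 * (z\<^sup>2 * LSVK_gap (excess n) z) / of_real (\<epsilon> n) -
      (lin n (\<lambda>x. 1 / cheb_denom z x) - of_real (center n / \<epsilon> n) * (z / (1 + z\<^sup>2)))) \<le> \<eta> n"
    using gap_asymptotic[OF s] .
  show thesis
  proof (rule that[OF \<eta>(1)])
    show "\<forall>\<^sub>F n in sequentially. \<forall>k.
      norm (of_nat (k + 1) / 2 * gap_coeff n k - (kernel_coeff n (k + 2) - kernel_coeff n k)) \<le> 2 * \<eta> n / s ^ (k + 2)"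
      using eventually_markov_pair \<eta>(2)
    proof eventually_elim
      case (elim n)
      then have n: "n \<ge> 1" and mp: "markov_pair (\<mu> n) (excess n) (center n) R (4 * R + 2)" by auto
      let ?e = "kernel_coeff n"
      define Q where "Q z = 1 / 2 * (z\<^sup>2 * LSVK_gap (excess n) z) / of_real (\<epsilon> n)" for z
      define E where "E z = lin n (\<lambda>x. 1 / cheb_denom z x) - of_real (center n / \<epsilon> n) * (z / (1 + z\<^sup>2))" for z
      \<comment> \<open>Coefficients of the error after multiplication by 1 - z^2. The factor z^2 on
        the diagram side shifts its index by two, so the claim for k is the coefficient k +
        2.\<close>
      define A where "A k = 1 / 2 * (if k < 2 then 0 else of_nat (k - 2 + 1) * gap_coeff n (k - 2)) - (?e k - (if k < 2 then 0 else ?e (k - 2)))" for k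
      have sums: "(\<lambda>k. A k * z ^ k) sums ((1 - z\<^sup>2) * (Q z - E z))" if z: "norm z < 1" for z
      proof -
        have "(\<lambda>k. of_nat (k + 1) * gap_coeff n k * z ^ k) sums (1 / of_real (\<epsilon> n) * ((1 - z\<^sup>2) * LSVK_gap (excess n) z))"
          using sums_mult[OF cheb_U_integral_sums(2)[OF markov_pair.set_integrable_gap[OF mp] _ z], of "1 / of_real (\<epsilon> n)"]
          unfolding gap_coeff_def LSVK_gap_def by (simp add: mult_ac)
        note S1 = sums_mult[OF sums_shift[OF this, of 2], of "1 / 2"]
        have S2: "(\<lambda>k. ?e k * z ^ k) sums E z"
          using sums_diff[OF lin_kernel_sums[OF n z] sums_mult[OF sine_generating[OF z], of "of_real (center n / \<epsilon> n)"]]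
          unfolding E_def kernel_coeff_def by (simp only: left_diff_distrib mult.assoc)
        have "(\<lambda>k. A k * z ^ k) sums (1 / 2 * (z\<^sup>2 * (1 / of_real (\<epsilon> n) * ((1 - z\<^sup>2) * LSVK_gap (excess n) z))) - (E z - z\<^sup>2 * E z))"
          using sums_diff[OF S1 sums_diff[OF S2 sums_shift[OF S2, of 2]]]
          unfolding A_def left_diff_distrib mult.assoc .
        also have "\<dots> = (1 - z\<^sup>2) * (Q z - E z)"
          unfolding Q_def by (simp add: algebra_simps diff_divide_distrib)
        finally show ?thesis .
      qed
      show ?case
      proof
        fix k
        have "norm (A (k + 2)) \<le> 2 * \<eta> n / s ^ (k + 2)"
        proof (rule power_series_coeff_bound[OF sums s])
          fix z :: complex assume z: "norm z = s"
          have "norm (z\<^sup>2) \<le> 1" unfolding norm_power by (rule power_le_one) (use z s in auto)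
          then have "norm (1 - z\<^sup>2) \<le> 2" using norm_triangle_ineq4[of 1 "z\<^sup>2"] by simp
          moreover have "norm (Q z - E z) \<le> \<eta> n" using elim z unfolding Q_def E_def by simp
          ultimately show "norm ((1 - z\<^sup>2) * (Q z - E z)) \<le> 2 * \<eta> n"
            unfolding norm_mult by (intro mult_mono) auto
        qed
        then show "norm (of_nat (k + 1) / 2 * gap_coeff n k - (?e (k + 2) - ?e k)) \<le> 2 * \<eta> n / s ^ (k + 2)"
          unfolding A_def by simp
      qed
    qed
  qed
qed

text \<open>The term with c_1 appears because the excess is measured from the moving centre; it is
  removed when the absolute values are put back.\<close>

lemma gap_coeff_limit:
  "(\<lambda>n. gap_coeff n k) \<longlonglongrightarrow> (4 * c (k + 2) - 8 * c 1 * of_real (cos (real (k + 1) * pi / 2))) / of_nat (k + 1)"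
proof -
  obtain \<eta> where \<eta>: "\<eta> \<longlonglongrightarrow> 0" "\<forall>\<^sub>F n in sequentially. \<forall>k.
    norm (of_nat (k + 1) / 2 * gap_coeff n k - (kernel_coeff n (k + 2) - kernel_coeff n k)) \<le> 2 * \<eta> n / (1 / 2) ^ (k + 2)"
    using gap_coeff_asymptotic[of "1 / 2"] by auto
  have 1: "(\<lambda>n. of_nat (k + 1) / 2 * gap_coeff n k - (kernel_coeff n (k + 2) - kernel_coeff n k)) \<longlonglongrightarrow> 0"
  proof (rule Lim_null_comparison)
    have "(\<lambda>n. 2 * \<eta> n / (1 / 2) ^ (k + 2)) \<longlonglongrightarrow> 2 * 0 / (1 / 2) ^ (k + 2)" by (intro tendsto_intros \<eta>(1)) auto
    then show "(\<lambda>n. 2 * \<eta> n / (1 / 2) ^ (k + 2)) \<longlonglongrightarrow> 0" by simp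
  qed (use \<eta>(2) in \<open>auto elim: eventually_mono\<close>)
  have "(\<lambda>n. 2 * lin n (\<lambda>x. of_real (poly (cheb_T (k + 2)) (x / 2))) - of_real (center n / \<epsilon> n) * of_real (2 * cos (real (k + 1) * pi / 2)))
      \<longlonglongrightarrow> 2 * c (k + 2) - 2 * c 1 * of_real (2 * cos (real (k + 1) * pi / 2))"
    using lin_cheb_T_limit[of "k + 2"] by (intro tendsto_intros center_over_eps) simp
  then have 2: "(\<lambda>n. kernel_coeff n (k + 2) - kernel_coeff n k) \<longlonglongrightarrow> 2 * c (k + 2) - 2 * c 1 * of_real (2 * cos (real (k + 1) * pi / 2))"
    by (rule Lim_transform_eventually)
      (use kernel_coeff_diff in \<open>auto intro!: eventually_mono[OF eventually_ge_at_top[of 1]]\<close>)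
  have "(\<lambda>n. 2 / of_nat (k + 1) * (of_nat (k + 1) / 2 * gap_coeff n k)) \<longlonglongrightarrow>
      2 / of_nat (k + 1) * (2 * c (k + 2) - 2 * c 1 * of_real (2 * cos (real (k + 1) * pi / 2)))"
    using tendsto_mult_left[OF tendsto_add[OF 1 2], of "2 / of_nat (k + 1)"] by simp
  moreover have "2 / of_nat (k + 1) * (of_nat (k + 1) / 2 * x) = x" for x :: complex
    using of_nat_neq_0[of k, where 'a = complex] by (simp del: of_nat_Suc)
  moreover have "2 / of_nat (k + 1) * (2 * c (k + 2) - 2 * c 1 * of_real (2 * cos (real (k + 1) * pi / 2))) =
    (4 * c (k + 2) - 8 * c 1 * of_real (cos (real (k + 1) * pi / 2))) / of_nat (k + 1)"
    by (simp add: right_diff_distrib diff_divide_distrib del: of_nat_Suc of_nat_add)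
  ultimately show ?thesis by (simp only:)
qed

text \<open>Domination for the exchange of limit and sum over k. The bound on c passes to the limit
  from the uniform bounds on the T-fluctuations.\<close>

lemma gap_coeff_bound:
  assumes s: "0 < s" "s < 1"
  obtains C where "0 \<le> C" "\<forall>\<^sub>F n in sequentially. \<forall>k. norm (gap_coeff n k) \<le> C / s ^ k"
    and "\<And>k. norm (c (k + 2)) \<le> C / s ^ k"
proof -
  obtain \<eta> where \<eta>: "\<eta> \<longlonglongrightarrow> 0" "\<forall>\<^sub>F n in sequentially. \<forall>k.
    norm (of_nat (k + 1) / 2 * gap_coeff n k - (kernel_coeff n (k + 2) - kernel_coeff n k)) \<le> 2 * \<eta> n / s ^ (k + 2)"
    using gap_coeff_asymptotic[OF s] .
  obtain C0 where C0: "0 < C0" "\<And>n k. n \<ge> 1 \<Longrightarrow> norm (lin n (\<lambda>x. of_real (U_half k x))) \<le> C0 / s ^ k"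
    using lin_cheb_U_bound[OF s] by blast
  define A where "A = norm (2 * c 1) + 1"
  have A: "0 < A" unfolding A_def by (intro add_nonneg_pos) auto
  have evA: "\<forall>\<^sub>F n in sequentially. norm (complex_of_real (center n / \<epsilon> n)) < A"
    by (rule order_tendstoD(2)[OF tendsto_norm[OF center_over_eps]]) (simp add: A_def)
  \<comment> \<open>Error 2 plus two kernel coefficients of size C0 + A, doubled when the factor 1/2
    is cleared; 1/s^2 pays for the index shift by two.\<close>
  define C where "C = (4 + 4 * (C0 + A)) / s\<^sup>2"
  have mono: "B / s ^ k \<le> B / s ^ (k + 2)" if "0 \<le> B" for B k
    by (intro divide_left_mono power_decreasing) (use that s in auto)
  show thesis
  proof (rule that[of C])
    show "0 \<le> C" unfolding C_def using C0 A by simp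
    show "\<forall>\<^sub>F n in sequentially. \<forall>k. norm (gap_coeff n k) \<le> C / s ^ k"
      using \<eta>(2) evA eventually_abs_less[OF \<eta>(1) zero_less_one] eventually_ge_at_top[of 1]
    proof eventually_elim
      case (elim n)
      have e: "norm (kernel_coeff n k) \<le> (C0 + A) / s ^ k" for k
      proof -
        have "norm (of_real (center n / \<epsilon> n) * complex_of_real (sin (real k * pi / 2))) \<le> A * 1"
          unfolding norm_mult[of "of_real (center n / \<epsilon> n)"] by (intro mult_mono) (use elim A in auto)
        also have "\<dots> \<le> A / s ^ k"
          using A s power_le_one[of s k] by (simp add: pos_le_divide_eq mult_le_cancel_left1)
        finally show ?thesis
          unfolding kernel_coeff_def add_divide_distrib
          using C0(2)[of n k] elim by (intro order_trans[OF norm_triangle_ineq4] add_mono) auto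
      qed
      show ?case
      proof
        fix k
        let ?g = "of_nat (k + 1) / 2 * gap_coeff n k"
        have "norm ?g \<le> norm (?g - (kernel_coeff n (k + 2) - kernel_coeff n k)) + (norm (kernel_coeff n (k + 2)) + norm (kernel_coeff n k))"
          using norm_triangle_sub[of ?g "kernel_coeff n (k + 2) - kernel_coeff n k"]
            norm_triangle_ineq4[of "kernel_coeff n (k + 2)" "kernel_coeff n k"] by linarith
        also have "\<dots> \<le> 2 / s ^ (k + 2) + ((C0 + A) / s ^ (k + 2) + (C0 + A) / s ^ (k + 2))"
        proof (intro add_mono e order_trans[OF e mono])
          have "2 * \<eta> n / s ^ (k + 2) \<le> 2 / s ^ (k + 2)" by (intro divide_right_mono) (use elim s in auto)
          then show "norm (?g - (kernel_coeff n (k + 2) - kernel_coeff n k)) \<le> 2 / s ^ (k + 2)"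
            using elim(1) order_trans by blast
        qed (use C0 A in simp)
        also have "\<dots> = C / s ^ k / 2" unfolding C_def by (simp add: power_add add_divide_distrib field_simps power2_eq_square)
        finally have g: "norm ?g \<le> C / s ^ k / 2" .
        have "1 * norm (gap_coeff n k) \<le> real (k + 1) * norm (gap_coeff n k)" by (intro mult_right_mono) auto
        also have "\<dots> = 2 * norm ?g" by (simp add: norm_mult norm_divide del: of_nat_Suc of_nat_add)
        finally show "norm (gap_coeff n k) \<le> C / s ^ k" using g by simp
      qed
    qed
    fix k
    have "norm (c (k + 2)) \<le> C0 / s ^ (k + 2)"
    proof (rule Lim_norm_ubound[OF sequentially_bot])
      show "(\<lambda>n. lin n (\<lambda>x. of_real (poly (cheb_T (k + 2)) (x / 2)))) \<longlonglongrightarrow> c (k + 2)"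
        using lin_cheb_T_limit[of "k + 2"] by simp
      show "\<forall>\<^sub>F n in sequentially. norm (lin n (\<lambda>x. of_real (poly (cheb_T (k + 2)) (x / 2)))) \<le> C0 / s ^ (k + 2)"
        using eventually_ge_at_top[of 1]
      proof eventually_elim
        case (elim n)
        have "2 * norm (lin n (\<lambda>x. of_real (poly (cheb_T (k + 2)) (x / 2)))) \<le> C0 / s ^ (k + 2) + C0 / s ^ (k + 2)"
          using norm_triangle_ineq4[of "lin n (\<lambda>x. of_real (U_half (k + 2) x))" "lin n (\<lambda>x. of_real (U_half k x))"]
            C0(2)[OF elim, of "k + 2"] order_trans[OF C0(2)[OF elim, of k] mono[of C0 k]] C0(1)
            norm_mult[of 2 "lin n (\<lambda>x. complex_of_real (poly (cheb_T (k + 2)) (x / 2)))"]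
          unfolding two_lin_cheb_T[OF elim] norm_numeral by linarith
        then show ?case by simp
      qed
    qed
    also have "\<dots> \<le> C / s ^ k"
      unfolding C_def using C0(1) A s by (simp add: power_add power2_eq_square divide_right_mono mult_ac)
    finally show "norm (c (k + 2)) \<le> C / s ^ k" .
  qed
qed

end

section \<open>Summation of the coefficient limits against a test function\<close>

lemma cheb_series_integral:
  fixes g f :: "real \<Rightarrow> complex"
  assumes g: "set_integrable lborel {-2..2} g"
    and q: "0 < q" "q < 1" and b: "\<And>k. norm (b k) \<le> C * q ^ k" "0 \<le> C"
    and f: "\<And>x. x \<in> {-2..2} \<Longrightarrow> (\<lambda>k. b k * of_real (U_half k x)) sums f x"
  shows "(\<lambda>k. b k * (LBINT x:{-2..2}. g x * of_real (U_half k x))) sums (LBINT x:{-2..2}. g x * f x)"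
proof -
  let ?F = "\<lambda>k x. indicator {-2..2} x *\<^sub>R (b k * (g x * of_real (U_half k x)))"
  define B where "B k = C * ((real k + 1) * q ^ k)" for k
  have sB: "summable B" unfolding B_def using q by (intro summable_mult summable_linear_power) auto
  have ng: "integrable lborel (\<lambda>x. norm (indicator {-2..2} x *\<^sub>R g x))"
    using g unfolding set_integrable_def by (rule integrable_norm)
  have int: "integrable lborel (?F k)" for k
  proof -
    have "set_integrable lborel {-2..2} (\<lambda>x. g x * of_real (U_half k x))"
      by (rule set_integrable_mult_bounded[OF g, where C = "real k + 1"]) (auto intro: abs_U_half_le)
    then have "set_integrable lborel {-2..2} (\<lambda>x. b k * (g x * of_real (U_half k x)))"
      by (rule set_integrable_mult_right)
    then show ?thesis unfolding set_integrable_def .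
  qed
  have bd: "norm (?F k x) \<le> B k * norm (indicator {-2..2} x *\<^sub>R g x)" for k x
  proof (cases "x \<in> {-2..2}")
    case True
    have "norm (b k) * \<bar>U_half k x\<bar> \<le> (C * q ^ k) * (real k + 1)"
      by (intro mult_mono b abs_U_half_le) (use True b q in auto)
    from mult_right_mono[OF this, of "norm (g x)"] True show ?thesis
      by (simp add: B_def norm_mult mult_ac)
  qed simp
  have "(\<lambda>k. LBINT x. ?F k x) sums (LBINT x. (\<Sum>k. ?F k x))"
  proof (rule sums_integral[OF int])
    show "AE x in lborel. summable (\<lambda>k. norm (?F k x))"
      by (rule AE_I2, rule summable_comparison_test'[OF summable_mult2[OF sB], of 0]) (use bd in auto)
    show "summable (\<lambda>k. LBINT x. norm (?F k x))"
    proof (rule summable_comparison_test'[OF summable_mult2[OF sB], of 0])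
      fix k
      have "(LBINT x. norm (?F k x)) \<le> (LBINT x. B k * norm (indicator {-2..2} x *\<^sub>R g x))"
        by (intro integral_mono integrable_norm int integrable_mult_right ng bd)
      then show "norm (LBINT x. norm (?F k x)) \<le> B k * (LBINT x. norm (indicator {-2..2} x *\<^sub>R g x))"
        by (simp del: norm_scaleR)
    qed
  qed
  moreover have "(LBINT x. ?F k x) = b k * (LBINT x:{-2..2}. g x * of_real (U_half k x))" for k
  proof -
    have "(LBINT x:{-2..2}. b k * (g x * of_real (U_half k x))) = b k * (LBINT x:{-2..2}. g x * of_real (U_half k x))"
      by (rule set_integral_mult_right)
    then show ?thesis by (simp only: set_lebesgue_integral_def)
  qed
  moreover have "(\<Sum>k. ?F k x) = indicator {-2..2} x *\<^sub>R (g x * f x)" for x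
  proof (cases "x \<in> {-2..2}")
    case True
    then show ?thesis using sums_unique[OF sums_mult[OF f[OF True], of "g x"]] by (simp add: mult_ac)
  qed simp
  ultimately show ?thesis by (simp add: set_lebesgue_integral_def)
qed

text \<open>First-order expansion of |x - a| in a: it is exact for |x| > |a|, and elsewhere the
  error is at most 2|a|. Its integral is therefore of second order in a.\<close>

lemma abs_shift_expansion: "\<bar>\<bar>x - a\<bar> - \<bar>x\<bar> + a * sgn x\<bar> \<le> 2 * \<bar>a\<bar> * indicator {-\<bar>a\<bar>..\<bar>a\<bar>} (x::real)"
  by (auto simp: indicator_def sgn_if abs_if)

context linear_statistics
begin

lemma gap_expansion:
  assumes n: "n \<ge> 1" and q: "0 < q" "q < 1" and b: "\<And>k. norm (b k) \<le> C * q ^ k" "0 \<le> C"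
    and f: "\<And>x. x \<in> {-2..2} \<Longrightarrow> (\<lambda>k. b k * of_real (U_half k x)) sums f x"
  shows "(\<lambda>k. b k * gap_coeff n k) sums
    (1 / of_real (\<epsilon> n) * (LBINT x:{-2..2}. f x * of_real (excess n x - (LSVK x - \<bar>x\<bar>))))"
proof -
  have ce: "continuous_on {-2..2} (excess n)"
    using diagram_excess_props(4)[of "\<omega> n" A B R] markov[OF n] AB R
    by (auto simp: is_markov_transform_def intro: continuous_on_subset)
  have "set_integrable lborel {-2..2} (\<lambda>x. complex_of_real (excess n x - (LSVK x - \<bar>x\<bar>)))"
    by (intro set_integrable_continuous continuous_intros ce continuous_on_LSVK)
  from sums_mult[OF cheb_series_integral[OF this q b f], of "1 / of_real (\<epsilon> n)"]
  show ?thesis unfolding gap_coeff_def by (simp add: mult_ac)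
qed

text \<open>The linear part is -a sgn x with a/\<epsilon> -> 2 c_1; the remainder is of order a^2
  and vanishes after division by \<epsilon>.\<close>

lemma center_shift_limit:
  fixes f :: "real \<Rightarrow> complex"
  assumes f: "continuous_on {-2..2} f"
  shows "(\<lambda>n. 1 / of_real (\<epsilon> n) * (LBINT x:{-2..2}. f x * of_real (\<bar>x - center n\<bar> - \<bar>x\<bar>)))
    \<longlonglongrightarrow> - (2 * c 1) * (LBINT x:{-2..2}. f x * of_real (sgn x))"
proof -
  obtain F where F: "\<And>x. x \<in> {-2..2} \<Longrightarrow> norm (f x) \<le> F"
    using compact_imp_bounded[OF compact_continuous_image[OF f]] unfolding bounded_iff by (metis compact_Icc imageI)
  have F0: "0 \<le> F" using order_trans[OF norm_ge_zero F[of 0]] by simp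
  let ?S = "LBINT x:{-2..2}. f x * of_real (sgn x)"
  let ?I = "\<lambda>n. LBINT x:{-2..2}. f x * of_real (\<bar>x - center n\<bar> - \<bar>x\<bar>)"
  have i1: "set_integrable lborel {-2..2} (\<lambda>x. f x * of_real (\<bar>x - center n\<bar> - \<bar>x\<bar>))" for n
    by (intro set_integrable_continuous continuous_intros f)
  have i2: "set_integrable lborel {-2..2} (\<lambda>x. of_real (center n) * (f x * of_real (sgn x)))" for n
    by (intro set_integrable_mult_right set_integrable_sgn_mult f)
  have indicator_integral: "(LBINT x. w * indicator {-y..y} x) = w * (2 * y)" if "0 \<le> y" for w y :: real
    using that by simp
  have key: "norm (?I n + of_real (center n) * ?S) \<le> F * (2 * \<bar>center n\<bar>) * (2 * \<bar>center n\<bar>)" for n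
  proof -
    let ?H = "\<lambda>x. f x * of_real (\<bar>x - center n\<bar> - \<bar>x\<bar>) + of_real (center n) * (f x * of_real (sgn x))"
    let ?J = "{-\<bar>center n\<bar>..\<bar>center n\<bar>}"
    have cS: "(LBINT x:{-2..2}. of_real (center n) * (f x * of_real (sgn x))) = of_real (center n) * ?S"
      by (rule set_integral_mult_right)
    have eq: "?I n + of_real (center n) * ?S = (LBINT x. indicator {-2..2} x *\<^sub>R ?H x)"
      using set_integral_add(2)[OF i1 i2, of n n] unfolding cS by (simp only: set_lebesgue_integral_def)
    have "norm (LBINT x. indicator {-2..2} x *\<^sub>R ?H x) \<le> (LBINT x. F * (2 * \<bar>center n\<bar>) * indicator ?J x)"
    proof (rule Bochner_Integration.integral_norm_bound_integral)
      show "integrable lborel (\<lambda>x. indicator {-2..2} x *\<^sub>R ?H x)"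
        using set_integral_add(1)[OF i1 i2, of n n] unfolding set_integrable_def .
      show "integrable lborel (\<lambda>x. F * (2 * \<bar>center n\<bar>) * indicator ?J x)" by simp
      fix x
      have "?H x = f x * of_real (\<bar>x - center n\<bar> - \<bar>x\<bar> + center n * sgn x)" by (simp add: algebra_simps)
      then have "norm (?H x) = norm (f x) * \<bar>\<bar>x - center n\<bar> - \<bar>x\<bar> + center n * sgn x\<bar>"
        by (simp only: norm_mult norm_of_real)
      then have "norm (?H x) \<le> F * (2 * \<bar>center n\<bar> * indicator ?J x)" if "x \<in> {-2..2}"
        using mult_mono[OF F[OF that] abs_shift_expansion[of x "center n"] F0] by simp
      then show "norm (indicator {-2..2} x *\<^sub>R ?H x) \<le> F * (2 * \<bar>center n\<bar>) * indicator ?J x"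
        using F0 by (cases "x \<in> {-2..2}") (auto simp: mult_ac)
    qed
    also have "\<dots> = F * (2 * \<bar>center n\<bar>) * (2 * \<bar>center n\<bar>)" by (rule indicator_integral) simp
    finally show ?thesis unfolding eq .
  qed
  have "(\<lambda>n. 1 / of_real (\<epsilon> n) * ?I n + of_real (center n / \<epsilon> n) * ?S) \<longlonglongrightarrow> 0"
  proof (rule Lim_null_comparison)
    have "(\<lambda>n. 4 * F * \<bar>center n / \<epsilon> n\<bar> * \<bar>center n\<bar>) \<longlonglongrightarrow> 4 * F * norm (2 * c 1) * \<bar>0\<bar>"
      using tendsto_norm[OF center_over_eps] unfolding norm_of_real by (intro tendsto_intros real_limits_0)
    then show "(\<lambda>n. 4 * F * \<bar>center n / \<epsilon> n\<bar> * \<bar>center n\<bar>) \<longlonglongrightarrow> 0" by simp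
    show "\<forall>\<^sub>F n in sequentially. norm (1 / of_real (\<epsilon> n) * ?I n + of_real (center n / \<epsilon> n) * ?S)
        \<le> 4 * F * \<bar>center n / \<epsilon> n\<bar> * \<bar>center n\<bar>"
      using eps_props(1)
    proof eventually_elim
      case (elim n)
      have "1 / of_real (\<epsilon> n) * ?I n + of_real (center n / \<epsilon> n) * ?S = (?I n + of_real (center n) * ?S) / of_real (\<epsilon> n)"
        by (simp add: add_divide_distrib)
      then have "norm (1 / of_real (\<epsilon> n) * ?I n + of_real (center n / \<epsilon> n) * ?S) = norm (?I n + of_real (center n) * ?S) / \<epsilon> n"
        using elim by (simp add: norm_divide)
      also have "\<dots> \<le> F * (2 * \<bar>center n\<bar>) * (2 * \<bar>center n\<bar>) / \<epsilon> n"
        by (intro divide_right_mono key) (use elim in auto)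
      also have "\<dots> = 4 * F * \<bar>center n / \<epsilon> n\<bar> * \<bar>center n\<bar>" using elim by (simp add: abs_divide)
      finally show ?case .
    qed
  qed
  from tendsto_diff[OF this tendsto_mult_right[OF center_over_eps, of ?S]] show ?thesis by simp
qed

text \<open>\<omega> - LSVK is the difference of the two excesses plus |x - a| - |x|. The first part
  is expanded in the U_k, where the coefficient limits apply termwise; the second is
  \<open>center_shift_limit\<close>.\<close>

lemma diagram_limit:
  fixes \<phi> :: "complex \<Rightarrow> complex"
  assumes \<phi>: "\<phi> analytic_on (of_real ` {-2..2})"
  shows "summable (\<lambda>k. 4 * c (k + 2) / of_nat (k + 1) *
      (LBINT x:{-2..2}. \<phi> (of_real x) * of_real (poly (cheb_U k) (x / 2) * (sqrt (4 - x\<^sup>2) / (2 * pi)))))" (is ?summ)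
    and "(\<lambda>n. 1 / of_real (\<epsilon> n) * (LBINT x:{-2..2}. \<phi> (of_real x) * of_real (\<omega> n x - LSVK x)))
      \<longlonglongrightarrow> - (4 * c 1 / of_real pi) * (LBINT x:{-2..2}. \<phi> (of_real x) * of_real (arcsin (x / 2)))
         + (\<Sum>k. 4 * c (k + 2) / of_nat (k + 1) *
           (LBINT x:{-2..2}. \<phi> (of_real x) * of_real (poly (cheb_U k) (x / 2) * (sqrt (4 - x\<^sup>2) / (2 * pi)))))" (is ?lim)
proof -
  define f where "f x = \<phi> (of_real x)" for x :: real
  have cf: "continuous_on {-2..2} f"
    unfolding f_def
    by (rule continuous_on_compose2[OF holomorphic_on_imp_continuous_on[OF analytic_imp_holomorphic[OF \<phi>]]])
      (auto intro!: continuous_intros)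
  obtain b C q where q: "0 < q" "q < 1" and C: "0 \<le> C" and b: "\<And>k. norm (b k) \<le> C * q ^ k"
    and expansion: "\<And>x. x \<in> {-2..2} \<Longrightarrow> (\<lambda>k. b k * of_real (U_half k x)) sums \<phi> (of_real x)"
    by (rule cheb_U_expansion[OF \<phi>]) (rule that, assumption+)
  have f: "(\<lambda>k. b k * of_real (U_half k x)) sums f x" if "x \<in> {-2..2}" for x
    using expansion[OF that] by (simp add: f_def)
  note series = cheb_series_integral[OF _ q b C f]
  \<comment> \<open>Strictly between q and 1, so that coefficient bounds D / s^k against the decay C
    q^k still sum as a geometric series of ratio q/s.\<close>
  define s where "s = (1 + q) / 2"
  have s: "0 < s" "s < 1" "q < s" using q by (auto simp: s_def)
  obtain D where D: "0 \<le> D" "\<forall>\<^sub>F n in sequentially. \<forall>k. norm (gap_coeff n k) \<le> D / s ^ k"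
    and cD: "\<And>k. norm (c (k + 2)) \<le> D / s ^ k"
    by (rule gap_coeff_bound[OF s(1,2)]) (rule that, assumption+)
  have geo: "summable (\<lambda>k. B * (q / s) ^ k)" for B :: real
    using s q by (intro summable_mult summable_geometric) auto
  have prod_bound: "norm (b k * y) \<le> C * E * (q / s) ^ k" if "norm y \<le> E / s ^ k" for y k E
  proof -
    have "norm (b k * y) \<le> (C * q ^ k) * (E / s ^ k)"
      unfolding norm_mult by (intro mult_mono b that) (use C q in auto)
    then show ?thesis by (simp add: power_divide mult_ac)
  qed
  define L where "L k = (4 * c (k + 2) - 8 * c 1 * of_real (cos (real (k + 1) * pi / 2))) / of_nat (k + 1)" for k
  \<comment> \<open>Orthogonality identifies the contour-integral coefficients with the semicircle
    moments that occur in the claim.\<close>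
  have coeff: "(LBINT x:{-2..2}. f x * of_real (poly (cheb_U k) (x / 2) * (sqrt (4 - x\<^sup>2) / (2 * pi)))) = b k" for k
  proof -
    let ?w = "\<lambda>x. complex_of_real (U_half k x * (sqrt (4 - x\<^sup>2) / (2 * pi)))"
    have "set_integrable lborel {-2..2} ?w"
      by (intro set_integrable_continuous continuous_intros) auto
    from series[OF this]
    have S: "(\<lambda>j. b j * (LBINT x:{-2..2}. ?w x * of_real (U_half j x))) sums (LBINT x:{-2..2}. ?w x * f x)" .
    have J: "(LBINT x:{-2..2}. ?w x * of_real (U_half j x)) = (if j = k then 1 else 0)" for j
    proof -
      have "(LBINT x:{-2..2}. ?w x * of_real (U_half j x)) =
          (LBINT x:{-2..2}. complex_of_real (U_half j x * (U_half k x * (sqrt (4 - x\<^sup>2) / (2 * pi)))))"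
        by (simp add: mult_ac)
      also have "\<dots> = (if j = k then 1 else 0)"
        unfolding set_integral_complex_of_real cheb_U_orthogonal by simp
      finally show ?thesis .
    qed
    have e: "b j * (if j = k then 1 else 0) = (if j = k then b j else 0)" for j by simp
    from S have "(\<lambda>j. if j = k then b j else 0) sums (LBINT x:{-2..2}. ?w x * f x)" unfolding J e .
    from sums_unique2[OF this sums_single[of k b]] show ?thesis
      by (simp add: U_half_def mult.commute)
  qed
  have slope: "(\<lambda>k. b k * (4 * of_real (cos (real (k + 1) * pi / 2)) / of_nat (k + 1))) sums (LBINT x:{-2..2}. f x * of_real (lsvk_slope x))"
  proof -
    have "set_integrable lborel {-2..2} (\<lambda>x. complex_of_real (lsvk_slope x))"
      using lsvk_slope_integral(1)[of "\<lambda>_. 1"] by simp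
    from series[OF this]
    have "(\<lambda>k. b k * (LBINT x:{-2..2}. of_real (lsvk_slope x) * of_real (U_half k x))) sums (LBINT x:{-2..2}. of_real (lsvk_slope x) * f x)" .
    moreover have "(LBINT x:{-2..2}. complex_of_real (lsvk_slope x) * of_real (U_half k x)) = 4 * of_real (cos (real (k + 1) * pi / 2)) / of_nat (k + 1)" for k
    proof -
      have "(LBINT x:{-2..2}. complex_of_real (lsvk_slope x) * of_real (U_half k x)) = (LBINT x:{-2..2}. complex_of_real (U_half k x * lsvk_slope x))"
        by (simp add: mult.commute)
      also have "\<dots> = of_real (4 * cos (real (k + 1) * pi / 2) / real (k + 1))"
        unfolding set_integral_complex_of_real lsvk_slope_cheb_U ..
      finally show ?thesis by (simp only: of_real_divide of_real_mult of_real_numeral of_real_of_nat_eq)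
    qed
    ultimately show ?thesis by (simp only: mult.commute[of _ "f _"])
  qed
  have summ: "summable (\<lambda>k. 4 * c (k + 2) / of_nat (k + 1) * b k)"
  proof (rule summable_comparison_test'[OF geo[of "C * (4 * D)"], of 0])
    fix k
    have "norm (4 * c (k + 2) / of_nat (k + 1)) \<le> 4 * norm (c (k + 2)) / 1"
      unfolding norm_divide norm_mult norm_of_nat norm_numeral by (intro divide_left_mono) auto
    also have "\<dots> \<le> 4 * D / s ^ k" using cD[of k] by simp
    finally show "norm (4 * c (k + 2) / of_nat (k + 1) * b k) \<le> C * (4 * D) * (q / s) ^ k"
      by (subst mult.commute) (rule prod_bound)
  qed
  show ?summ using summ by (simp only: coeff[unfolded f_def])
  \<comment> \<open>Tannery's theorem: termwise limits together with a majorant that is summable and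
    independent of n.\<close>
  have tannery: "(\<lambda>n. \<Sum>k. b k * gap_coeff n k) \<longlonglongrightarrow> (\<Sum>k. b k * L k)"
  proof -
    have "\<forall>\<^sub>F (k, n) in at_top \<times>\<^sub>F sequentially. norm (b k * gap_coeff n k) \<le> C * D * (q / s) ^ k"
      unfolding eventually_prod_filter
      by (rule exI[of _ "\<lambda>_. True"], rule exI[of _ "\<lambda>n. \<forall>k. norm (gap_coeff n k) \<le> D / s ^ k"])
        (use D(2) prod_bound in auto)
    from tannerys_theorem[where a = "\<lambda>k n. b k * gap_coeff n k" and b = "\<lambda>k. b k * L k",
        OF tendsto_mult_left[OF gap_coeff_limit[folded L_def]] this geo]
    show ?thesis by simp
  qed
  have split: "1 / of_real (\<epsilon> n) * (LBINT x:{-2..2}. f x * of_real (\<omega> n x - LSVK x)) =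
      (\<Sum>k. b k * gap_coeff n k) + 1 / of_real (\<epsilon> n) * (LBINT x:{-2..2}. f x * of_real (\<bar>x - center n\<bar> - \<bar>x\<bar>))"
    if n: "n \<ge> 1" for n
  proof -
    have ce: "continuous_on {-2..2} (excess n)"
      using diagram_excess_props(4)[of "\<omega> n" A B R] markov[OF n] AB R
      by (auto simp: is_markov_transform_def intro: continuous_on_subset)
    have i1: "set_integrable lborel {-2..2} (\<lambda>x. f x * of_real (excess n x - (LSVK x - \<bar>x\<bar>)))"
      by (intro set_integrable_continuous continuous_intros cf ce continuous_on_LSVK)
    have i2: "set_integrable lborel {-2..2} (\<lambda>x. f x * of_real (\<bar>x - center n\<bar> - \<bar>x\<bar>))"
      by (intro set_integrable_continuous continuous_intros cf)
    have "f x * of_real (\<omega> n x - LSVK x) =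
      f x * of_real (excess n x - (LSVK x - \<bar>x\<bar>)) + f x * of_real (\<bar>x - center n\<bar> - \<bar>x\<bar>)" for x
      unfolding distrib_left[symmetric] of_real_add[symmetric] by (simp add: diagram_excess_def center_def)
    then have "1 / of_real (\<epsilon> n) * (LBINT x:{-2..2}. f x * of_real (\<omega> n x - LSVK x)) =
        1 / of_real (\<epsilon> n) * (LBINT x:{-2..2}. f x * of_real (excess n x - (LSVK x - \<bar>x\<bar>))) +
        1 / of_real (\<epsilon> n) * (LBINT x:{-2..2}. f x * of_real (\<bar>x - center n\<bar> - \<bar>x\<bar>))"
      by (simp only: set_integral_add(2)[OF i1 i2] distrib_left)
    moreover have "(\<Sum>k. b k * gap_coeff n k) = 1 / of_real (\<epsilon> n) * (LBINT x:{-2..2}. f x * of_real (excess n x - (LSVK x - \<bar>x\<bar>)))"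
      by (rule sums_unique[symmetric], rule gap_expansion[OF n q b C f])
    ultimately show ?thesis by (simp only:)
  qed
  have "(\<lambda>n. (\<Sum>k. b k * gap_coeff n k) + 1 / of_real (\<epsilon> n) * (LBINT x:{-2..2}. f x * of_real (\<bar>x - center n\<bar> - \<bar>x\<bar>)))
      \<longlonglongrightarrow> (\<Sum>k. b k * L k) + - (2 * c 1) * (LBINT x:{-2..2}. f x * of_real (sgn x))"
    by (intro tendsto_add tannery center_shift_limit cf)
  then have lim: "(\<lambda>n. 1 / of_real (\<epsilon> n) * (LBINT x:{-2..2}. f x * of_real (\<omega> n x - LSVK x)))
      \<longlonglongrightarrow> (\<Sum>k. b k * L k) + - (2 * c 1) * (LBINT x:{-2..2}. f x * of_real (sgn x))"
    by (rule Lim_transform_eventually)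
      (rule eventually_mono[OF eventually_ge_at_top[of 1]], rule split[symmetric])
  have total: "(\<Sum>k. b k * L k) = (\<Sum>k. 4 * c (k + 2) / of_nat (k + 1) * b k) - 2 * c 1 * (LBINT x:{-2..2}. f x * of_real (lsvk_slope x))"
  proof -
    have S: "(\<lambda>k. 4 * c (k + 2) / of_nat (k + 1) * b k - 2 * c 1 * (b k * (4 * of_real (cos (real (k + 1) * pi / 2)) / of_nat (k + 1))))
        sums ((\<Sum>k. 4 * c (k + 2) / of_nat (k + 1) * b k) - 2 * c 1 * (LBINT x:{-2..2}. f x * of_real (lsvk_slope x)))"
      by (intro sums_diff sums_mult summable_sums summ slope)
    have E: "4 * c (k + 2) / of_nat (k + 1) * b k - 2 * c 1 * (b k * (4 * of_real (cos (real (k + 1) * pi / 2)) / of_nat (k + 1))) = b k * L k" for k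
      unfolding L_def diff_divide_distrib right_diff_distrib by (simp only: mult_ac times_divide_eq_left times_divide_eq_right) simp
    from S show ?thesis unfolding E by (rule sums_unique[symmetric])
  qed
  \<comment> \<open>The slope is (2/pi) arcsin(x/2) - sgn x, so its sign part cancels the
    contribution of the moving centre, and -(4 c_1 / pi) times the arcsine integral remains.\<close>
  have "(\<Sum>k. b k * L k) + - (2 * c 1) * (LBINT x:{-2..2}. f x * of_real (sgn x)) =
      - (4 * c 1 / of_real pi) * (LBINT x:{-2..2}. f x * of_real (arcsin (x / 2))) + (\<Sum>k. 4 * c (k + 2) / of_nat (k + 1) * b k)"
    unfolding total lsvk_slope_integral(2)[OF cf] by (simp add: algebra_simps)
  with lim show ?lim
    unfolding f_def[symmetric] coeff by (simp only:)
qed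

end

text \<open>The sum over k >= 2 is indexed from 0, so c_k / (k - 1) and U_(k-2) appear as
  \<open>c (k + 2)\<close>, \<open>k + 1\<close> and \<open>cheb_U k\<close>. Convergence of the
  series is asserted as well, because \<open>suminf\<close> denotes some value even for a divergent
  series.\<close>

theorem proposition3p1p4:
  fixes \<mu> :: "nat \<Rightarrow> real measure"
    and \<omega> :: "nat \<Rightarrow> real \<Rightarrow> real"
    and \<epsilon> :: "nat \<Rightarrow> real"
    and c :: "nat \<Rightarrow> complex"
    and A B :: real
  assumes markov: "\<And>n. n \<ge> 1 \<Longrightarrow> is_markov_transform {A..B} (\<omega> n) (\<mu> n)"
    and eps: "filterlim \<epsilon> (at_right 0) sequentially"
    and c: "limsup (\<lambda>k. ereal (root k (norm (c k)))) = 1"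
    and measures: "\<forall>\<phi>::complex \<Rightarrow> complex. \<phi> analytic_on (of_real ` {-2..2::real}) \<longrightarrow>
      (\<lambda>n. 1 / of_real (\<epsilon> n) *
           ((LINT x:{-2..2}|\<mu> n. \<phi> (of_real x)) - (LINT x:{-2..2}|semicircle. \<phi> (of_real x))))
      \<longlonglongrightarrow> (\<Sum>k. c (k + 1) *
           (LBINT x:{-2..2}. \<phi> (of_real x) *
              of_real (2 * poly (cheb_T (k + 1)) (x / 2) / (pi * sqrt (4 - x\<^sup>2)))))"
  shows "\<forall>\<phi>::complex \<Rightarrow> complex. \<phi> analytic_on (of_real ` {-2..2::real}) \<longrightarrow>
      summable (\<lambda>k. 4 * c (k + 2) / of_nat (k + 1) *
           (LBINT x:{-2..2}. \<phi> (of_real x) *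
              of_real (poly (cheb_U k) (x / 2) * (sqrt (4 - x\<^sup>2) / (2 * pi))))) \<and>
      (\<lambda>n. 1 / of_real (\<epsilon> n) *
           (LBINT x:{-2..2}. \<phi> (of_real x) * of_real (\<omega> n x - LSVK x)))
      \<longlonglongrightarrow> - (4 * c 1 / of_real pi) * (LBINT x:{-2..2}. \<phi> (of_real x) * of_real (arcsin (x / 2)))
         + (\<Sum>k. 4 * c (k + 2) / of_nat (k + 1) *
           (LBINT x:{-2..2}. \<phi> (of_real x) *
              of_real (poly (cheb_U k) (x / 2) * (sqrt (4 - x\<^sup>2) / (2 * pi)))))"
proof -
  \<comment> \<open>Symmetric, large enough for both end points whatever their signs, and at least 3
    as the locale requires.\<close>
  define R where "R = max 3 (\<bar>A\<bar> + \<bar>B\<bar>)"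
  interpret linear_statistics \<mu> \<omega> \<epsilon> c A B R
  proof
    show "{A..B} \<subseteq> {-R..R}" "3 \<le> R" by (auto simp: R_def)
  qed (use markov eps measures in blast)+
  show ?thesis using diagram_limit by blast
qed

end
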